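(* Let $1<p<\infty$, set $q=\max\bigl(p,\tfrac{p}{p-1}\bigr)$, and let $\delta\ge 0$. The following statement holds if and only if $\delta<\frac{1}{2q}$: There is a constant $C_p>0$, independent of $n$, such that for every integer $n\ge 0$ and every choice of points $z_{n0},\dots,z_{nn}$ on the unit circle satisfying $|\arg(z_{nj}\overline{\omega_{nj}})|\le \frac{2\pi\delta}{n+1}$ for $0\le j\le n$, one has \[ \frac{C_p^{-1}}{n+1}\sum_{j=0}^n |P(z_{nj})|^p \;\le\; \int_0^{2\pi}|P(e^{i\theta})|^p\,\frac{d\theta}{2\pi}\;\le\; \frac{C_p}{n+1}\sum_{j=0}^n |P(z_{nj})|^p \] for every holomorphic (complex) polynomial $P$ of degree at most $n$.
   Context: For $n\ge 0$ and $0\le j\le n$, $\omega_{nj}=e^{2\pi i j/(n+1)}$ denote the $(n+1)$th roots of unity. $\arg$ denotes the principal argument with values in $(-\pi,\pi]$. *)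

theory Defs
  imports "HOL-Analysis.Analysis" "HOL-Computational_Algebra.Polynomial"
begin

definition root_unity :: "nat \<Rightarrow> nat \<Rightarrow> complex" where
  "root_unity n j = cis (2 * pi * real j / real (n + 1))"

definition MZ_property :: "real \<Rightarrow> real \<Rightarrow> bool" where
  "MZ_property p \<delta> \<longleftrightarrow>
    (\<exists>C>0. \<forall>(n::nat) (z::nat \<Rightarrow> complex).
       (\<forall>j\<le>n. norm (z j) = 1 \<and>
               \<bar>Arg (z j * cnj (root_unity n j))\<bar> \<le> 2 * pi * \<delta> / real (n + 1)) \<longrightarrow>
       (\<forall>P :: complex poly. degree P \<le> n \<longrightarrow>
          (inverse C / real (n + 1)) * (\<Sum>j\<le>n. norm (poly P (z j)) powr p)
            \<le> integral {0..2*pi} (\<lambda>\<theta>. norm (poly P (cis \<theta>)) powr p) / (2 * pi) \<and>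
          integral {0..2*pi} (\<lambda>\<theta>. norm (poly P (cis \<theta>)) powr p) / (2 * pi)
            \<le> (C / real (n + 1)) * (\<Sum>j\<le>n. norm (poly P (z j)) powr p)))"

end

(*
Write N = n + 1, W u = (PROD j. 1 - u / z j) and D j = (PROD i ~= j. 1 - z j / z i). By Lagrange
interpolation P u = W u * (SUM j. P (z j) / D j / (1 - u / z j)), so the upper estimate is a weighted
inequality for the Herglotz functions F z = (SUM j. c j * (z j + z) / (z j - z)), c j >= 0.
The weight is |exp L|, where exp L is W u / (1 - u ^ N) up to a unimodular constant. Moving a node
changes Im L by half the integral of a Poisson kernel, so perturbations of size 2 pi delta / N give
|Im L| <= pi delta (1 + small) on the circle |u| ^ N = small. For 1 < p <= 2 this is just what Riesz's
argument needs: F ^ p * exp (p * L) is analytic, and while |p * Im L| < (p - 1) * pi / 2, i.e.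
delta < 1 / (2 q), its real part is negative wherever Re F is small against |F|. The same bound on
Im L and the Schwarz-Pick lemma show that |exp L| varies like a power less than 1 of the distance,
which is absorbed by the decay of the Poisson kernel. For p >= 2 one dualizes, which interchanges nodes
and evaluation points and inverts the weight. The lower estimate follows from a Poisson representation.

At delta = 1 / (2 q) move the nodes of the upper half circle forwards and the others backwards. Then
|W| is comparable to (|1 + u| / |1 - u|) ^ (2 delta), and testing with P = W * (SUM j. b j / (1 - u / z j)),
b j >= 0, where Re (1 / (1 - v)) = 1/2 for |v| = 1 prevents cancellation, gives a divergent harmonic sum.
*)
theory Submission
  imports Defs "HOL-Complex_Analysis.Complex_Analysis"
begin

section \<open>Finite sums and the geometry of the nodes\<close>

text \<open>Two obstacles shape the proof. On the unit circle \<open>W\<close> has zeros and the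
  kernel is singular. The estimate is therefore proved at the radius \<open>r\<^sup>2\<close> with
  \<open>r ^ N = \<rho>\<close> fixed, at distance comparable to 1/N from the circle. There Harnack
  inequalities allow free passage between integrals, nodes and shifted grids, and a polynomial of
  degree below N returns to the unit circle at a cost depending on \<rho> and p alone. The square
  splits evenly: \<open>F\<close> and \<open>exp L\<close> are rescaled by \<open>r\<close> so that
  they live on the whole disc, and they are evaluated at radius \<open>r\<close>. Secondly, Riesz's
  argument is carried out for exponents at most 2. To allow dualization the circle integral is
  replaced by sums over rotated grids: the interpolation operator becomes a matrix whose two index
  sets are both near the roots of unity, with a kernel that is conjugate-symmetric in them. The
  exponent used is p0 = q / (q - 1), the smaller of p and its conjugate; (p0 - 1) / p0 = 1 / q turns
  Riesz's condition into \<eta> < pi / (2 q).\<close>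

text \<open>Convexity of the power function: its graph lies above the tangent at \<open>m\<close>.
  Young's inequality for \<open>x\<close> and \<open>m powr (p - 1)\<close> yields this without
  derivatives. It is the source of every Jensen-type inequality below.\<close>

lemma powr_tangent_le:
  fixes p x m :: real
  assumes "1 < p" "0 \<le> x" "0 \<le> m"
  shows "m powr p + p * m powr (p - 1) * (x - m) \<le> x powr p"
proof (cases "m = 0")
  case False
  then have m: "m > 0" using assms by simp
  define q where "q = p / (p - 1)"
  have q: "q > 1" "1 / p + 1 / q = 1" using assms by (auto simp: q_def field_simps)
  have "x * m powr (p - 1) \<le> x powr p / p + (m powr (p - 1)) powr q / q"
    using assms q by (intro Youngs_inequality) auto
  also have "(m powr (p - 1)) powr q = m powr p"
    using assms by (simp add: powr_powr q_def)
  finally have "p * (x * m powr (p - 1)) \<le> p * (x powr p / p + m powr p / q)"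
    using assms by (intro mult_left_mono) auto
  also have "\<dots> = x powr p + (p - 1) * m powr p"
    using assms by (simp add: q_def field_simps)
  finally have "p * x * m powr (p - 1) \<le> x powr p + (p - 1) * m powr p" by simp
  moreover have "m powr (p - 1) * m = m powr p"
    using m by (simp add: powr_diff)
  ultimately show ?thesis by (simp add: algebra_simps)
qed (use assms in auto)

text \<open>Jensen's inequality by summing the tangent inequality at \<open>m\<close>, the weighted
  sum divided by \<open>Z\<close>. Since \<open>Z\<close> only dominates the total weight, an extra
  term \<open>(Z - sum w J) * ((p - 1) * m powr p)\<close> appears, and it has the right
  sign.\<close>

lemma weighted_power_mean:
  fixes w b :: "'a \<Rightarrow> real"
  assumes p: "1 < p" and fin: "finite J" and w: "\<And>j. j \<in> J \<Longrightarrow> 0 \<le> w j"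
    and b: "\<And>j. j \<in> J \<Longrightarrow> 0 \<le> b j" and Z: "sum w J \<le> Z" "0 < Z"
  shows "(\<Sum>j\<in>J. w j * b j) powr p \<le> Z powr (p - 1) * (\<Sum>j\<in>J. w j * b j powr p)"
proof -
  define m where "m = (\<Sum>j\<in>J. w j * b j) / Z"
  have m: "m \<ge> 0" unfolding m_def using w b Z by (auto intro!: divide_nonneg_pos sum_nonneg)
  have s: "(\<Sum>j\<in>J. w j * b j) = Z * m" using Z by (simp add: m_def)
  have mm: "m powr (p - 1) * m = m powr p" using m p by (cases "m = 0") (auto simp: powr_diff)
  have "(\<Sum>j\<in>J. w j * (m powr p + p * m powr (p - 1) * (b j - m))) \<le> (\<Sum>j\<in>J. w j * b j powr p)"
    using powr_tangent_le[OF p b m] w by (intro sum_mono mult_left_mono) auto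
  moreover have "(\<Sum>j\<in>J. w j * (m powr p + p * m powr (p - 1) * (b j - m)))
     = sum w J * m powr p + p * m powr (p - 1) * (Z * m) - p * (m powr (p - 1) * m) * sum w J"
    by (simp add: s[symmetric] algebra_simps sum.distrib sum_distrib_left sum_distrib_right sum_subtractf)
  moreover have "\<dots> = Z * m powr p + (Z - sum w J) * ((p - 1) * m powr p)"
    unfolding mm[symmetric] by (simp add: algebra_simps)
  moreover have "(Z - sum w J) * ((p - 1) * m powr p) \<ge> 0" using Z p by (intro mult_nonneg_nonneg) auto
  ultimately have "Z * m powr p \<le> (\<Sum>j\<in>J. w j * b j powr p)" by linarith
  then have "Z powr (p - 1) * (Z * m powr p) \<le> Z powr (p - 1) * (\<Sum>j\<in>J. w j * b j powr p)"
    by (intro mult_left_mono) auto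
  moreover have "Z powr (p - 1) * (Z * m powr p) = (Z * m) powr p"
    using Z m by (simp add: powr_mult powr_diff)
  ultimately show ?thesis by (simp add: s)
qed

lemma power_mean_sum:
  fixes b :: "'a \<Rightarrow> real"
  assumes p: "1 < p" and fin: "finite J" and b: "\<And>j. j \<in> J \<Longrightarrow> 0 \<le> b j" 
  shows "(\<Sum>j\<in>J. b j) powr p \<le> real (card J) powr (p - 1) * (\<Sum>j\<in>J. b j powr p)"
proof (cases "J = {}")
  case False
  then show ?thesis
    using weighted_power_mean[of p J "\<lambda>_. 1" b "real (card J)"] assms by (simp add: card_gt_0_iff)
qed auto

text \<open>Schur's test: Jensen with the weights \<open>\<kappa> j k\<close> for fixed
  \<open>k\<close> uses one bound on the kernel sums and costs \<open>Z powr (p - 1)\<close>;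
  exchanging the sums uses the other and costs \<open>Z\<close>.\<close>

lemma schur_powr:
  fixes \<kappa> :: "'a \<Rightarrow> 'b \<Rightarrow> real" and b :: "'a \<Rightarrow> real"
  assumes p: "1 < p" and fin: "finite J" "finite K"
    and \<kappa>: "\<And>j k. j \<in> J \<Longrightarrow> k \<in> K \<Longrightarrow> 0 \<le> \<kappa> j k"
    and b: "\<And>j. j \<in> J \<Longrightarrow> 0 \<le> b j" and Z: "0 < Z"
    and J: "\<And>k. k \<in> K \<Longrightarrow> (\<Sum>j\<in>J. \<kappa> j k) \<le> Z" and K: "\<And>j. j \<in> J \<Longrightarrow> (\<Sum>k\<in>K. \<kappa> j k) \<le> Z"
  shows "(\<Sum>k\<in>K. (\<Sum>j\<in>J. \<kappa> j k * b j) powr p) \<le> Z powr p * (\<Sum>j\<in>J. b j powr p)"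
proof -
  have "(\<Sum>k\<in>K. (\<Sum>j\<in>J. \<kappa> j k * b j) powr p)
      \<le> (\<Sum>k\<in>K. Z powr (p - 1) * (\<Sum>j\<in>J. \<kappa> j k * b j powr p))"
    using assms by (intro sum_mono weighted_power_mean) auto
  also have "\<dots> = Z powr (p - 1) * (\<Sum>j\<in>J. b j powr p * (\<Sum>k\<in>K. \<kappa> j k))"
    by (subst sum_distrib_left[symmetric], subst sum.swap) (simp add: sum_distrib_left sum_distrib_right mult_ac)
  also have "\<dots> \<le> Z powr (p - 1) * (\<Sum>j\<in>J. b j powr p * Z)"
    using K by (intro mult_left_mono sum_mono) auto
  also have "\<dots> = Z powr p * (\<Sum>j\<in>J. b j powr p)"
    using Z by (simp add: powr_diff sum_distrib_right[symmetric])
  finally show ?thesis .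
qed

section \<open>Chords of the circle and the cyclic distance of indices\<close>

text \<open>Jordan's inequality: concavity places the sine above its chord on the first quarter
  period, and reflection at pi / 2 covers the second.\<close>

lemma sin_ge_min:
  assumes "0 \<le> x" "x \<le> pi"
  shows "sin x \<ge> (2 / pi) * min x (pi - x)"
proof -
  have *: "(2 / pi) * y \<le> sin y" if "0 \<le> y" "y \<le> pi / 2" for y
  proof -
    have "concave_on {0..pi/2} sin"
    proof (rule f''_le0_imp_concave)
      fix x assume "x \<in> {0..pi/2}"
      show "DERIV sin x :> cos x" "DERIV cos x :> - sin x" by (auto intro!: derivative_eq_intros)
      show "- sin x \<le> 0" using \<open>x \<in> {0..pi/2}\<close> by (auto intro!: sin_ge_zero)
    qed auto
    from concave_onD[OF this, of "2 * y / pi" 0 "pi / 2"] show ?thesis using that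
      by (auto simp: field_simps)
  qed
  show ?thesis
  proof (cases "x \<le> pi / 2")
    case True then show ?thesis using *[of x] assms by (simp add: min_def)
  next
    case False then show ?thesis using *[of "pi - x"] assms by (auto simp: min_def)
  qed
qed

lemma norm_cis_diff: "norm (cis a - cis b) = 2 * \<bar>sin ((a - b) / 2)\<bar>"
proof -
  have "cis a - cis b = cis ((a + b) / 2) * (2 * \<i> * of_real (sin ((a - b) / 2)))"
  proof -
    have "a = (a + b) / 2 + (a - b) / 2" "b = (a + b) / 2 - (a - b) / 2" by (auto simp: field_simps)
    then have "cis a = cis ((a + b) / 2) * cis ((a - b) / 2)" "cis b = cis ((a + b) / 2) * cis (-((a - b) / 2))"
      by (metis cis_mult, metis cis_mult diff_conv_add_uminus)
    moreover have "cis ((a - b) / 2) - cis (-((a - b) / 2)) = 2 * \<i> * of_real (sin ((a - b) / 2))"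
      by (simp add: complex_eq_iff)
    ultimately show ?thesis by (metis right_diff_distrib)
  qed
  then show ?thesis by (simp add: norm_mult)
qed

text \<open>Distance in the cyclic group of order \<open>N\<close>, for indices below
  \<open>N\<close>.\<close>

definition cdist :: "nat \<Rightarrow> nat \<Rightarrow> nat \<Rightarrow> nat" where
  "cdist N j k = (let m = (if j \<le> k then k - j else j - k) in min m (N - m))"

lemma cdist_sym: "cdist N j k = cdist N k j"
  by (auto simp: cdist_def Let_def)

text \<open>Offsets are measured in grid steps, so they can shorten the cyclic distance by at most
  \<open>E\<close>. The factor 4 is 2 from the chord formula, times 2 / pi from Jordan's inequality,
  times pi from the half angle.\<close>

lemma cdist_le_norm:
  assumes N: "j < N" "k < N" and E: "\<bar>e - e'\<bar> \<le> E"
  shows "4 * (real (cdist N j k) - E)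
    \<le> real N * norm (cis (2 * pi * (real j + e) / N) - cis (2 * pi * (real k + e') / N))"
proof -
  have main: "4 * (real (cdist N j k) - E)
    \<le> real N * norm (cis (2 * pi * (real j + e) / N) - cis (2 * pi * (real k + e') / N))"
    if N: "j < N" "k \<le> j" and E: "\<bar>e - e'\<bar> \<le> E" for j k and e e' :: real
  proof (cases "real (cdist N j k) \<le> E")
    case True
    then have "4 * (real (cdist N j k) - E) \<le> 0" by simp
    also have "0 \<le> real N * norm (cis (2 * pi * (real j + e) / N) - cis (2 * pi * (real k + e') / N))" by simp
    finally show ?thesis .
  next
    case False
    define m where "m = j - k"
    have rm: "real j = real k + real m" using N by (simp add: m_def)
    have c: "cdist N j k = min m (N - m)" using N by (auto simp: cdist_def m_def Let_def)
    have mN: "m < N" using N by (simp add: m_def)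
    have m1: "real m > E" "real N - real m > E" using False mN unfolding c by (auto simp: min_def split: if_splits)
    define \<tau> where "\<tau> = (real m + (e - e')) * (pi / N)"
    have N0: "real N > 0" using N by simp
    have t: "(2 * pi * (real j + e) / N - 2 * pi * (real k + e') / N) / 2 = \<tau>"
      unfolding \<tau>_def rm using N0 by (simp add: field_simps)
    have "0 \<le> \<tau>" unfolding \<tau>_def using m1 E N0 by (intro mult_nonneg_nonneg) auto
    moreover have "pi - \<tau> = (real N - real m - (e - e')) * (pi / N)"
      unfolding \<tau>_def using N0 by (simp add: field_simps)
    moreover have "\<dots> \<ge> 0" using m1 E N0 by (intro mult_nonneg_nonneg) auto
    ultimately have "sin \<tau> \<ge> (2 / pi) * min \<tau> (pi - \<tau>)" by (intro sin_ge_min) auto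
    moreover have "min \<tau> (pi - \<tau>) \<ge> (real (cdist N j k) - E) * (pi / N)"
    proof -
      have "(real (cdist N j k) - E) * (pi / N) \<le> (real m + (e - e')) * (pi / N)"
        using E N0 unfolding c by (intro mult_right_mono) auto
      moreover have "(real (cdist N j k) - E) * (pi / N) \<le> (real N - real m - (e - e')) * (pi / N)"
        using E N0 mN unfolding c by (intro mult_right_mono) (auto simp: min_def)
      ultimately show ?thesis using \<open>pi - \<tau> = _\<close> unfolding \<tau>_def by simp
    qed
    then have "(2 / pi) * ((real (cdist N j k) - E) * (pi / N)) \<le> (2 / pi) * min \<tau> (pi - \<tau>)"
      by (intro mult_left_mono) auto
    moreover have "(2 / pi) * ((real (cdist N j k) - E) * (pi / N)) = 2 * (real (cdist N j k) - E) / N"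
      by simp
    ultimately have "2 * (real (cdist N j k) - E) / N \<le> \<bar>sin \<tau>\<bar>" by linarith
    then show ?thesis unfolding norm_cis_diff t using N0 by (simp add: field_simps)
  qed
  show ?thesis
  proof (cases "k \<le> j")
    case True then show ?thesis using main[of j k e e'] assms by auto
  next
    case False then show ?thesis using main[of k j e' e] assms
      by (auto simp: norm_minus_commute cdist_sym)
  qed
qed

text \<open>A summand at \<open>min m (N - m)\<close> is at most the sum of the summands at
  \<open>m\<close> and at \<open>N - m\<close>. On either side of \<open>j\<close> both are
  injective functions of \<open>k\<close>, so four copies of one convergent series suffice,
  uniformly in \<open>N\<close>.\<close>

lemma cdist_kernel_sum:
  fixes s :: real
  assumes "s > 1"
  obtains Z where "Z > 0" "\<And>N j. j < N \<Longrightarrow> (\<Sum>k<N. (1 + real (cdist N j k)) powr (-s)) \<le> Z"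
proof
  define f where "f m = (1 + real m) powr (-s)" for m
  have "summable (\<lambda>n. real (Suc n) powr (-s))"
    using summable_real_powr_iff[of "-s"] assms by (subst summable_Suc_iff) simp
  then have sf: "summable f" unfolding f_def by (simp add: add.commute)
  have f0: "f m \<ge> 0" for m by (simp add: f_def)
  have fs: "sum f A \<le> suminf f" if "finite A" for A
    using sf f0 that by (intro sum_le_suminf) auto
  show "4 * (suminf f + 1) > 0" using fs[of "{}"] by simp
  fix N j :: nat assume j: "j < N"
  have b: "f (cdist N j k) \<le> f m + f (N - m)" if "m = (if j \<le> k then k - j else j - k)" for k m
    using f0 that unfolding cdist_def Let_def min_def by simp
  have im: "(\<Sum>k\<in>A. f (g k)) \<le> suminf f" if "inj_on g A" "finite A" for A and g :: "nat \<Rightarrow> nat"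
    using sum.reindex[OF that(1), of f] fs[of "g ` A"] that by (simp add: o_def)
  have "(\<Sum>k<N. f (cdist N j k)) \<le> (\<Sum>k\<in>{..<j} \<union> {j..<N}. f (cdist N j k))"
    using j by (intro eq_refl sum.cong) auto
  also have "\<dots> = (\<Sum>k\<in>{..<j}. f (cdist N j k)) + (\<Sum>k\<in>{j..<N}. f (cdist N j k))"
    by (subst sum.union_disjoint) auto
  also have "\<dots> \<le> (\<Sum>k\<in>{..<j}. f (j - k) + f (N - (j - k))) + (\<Sum>k\<in>{j..<N}. f (k - j) + f (N - (k - j)))"
    by (intro add_mono sum_mono b) auto
  also have "\<dots> = ((\<Sum>k\<in>{..<j}. f (j - k)) + (\<Sum>k\<in>{..<j}. f (N - (j - k))))
       + ((\<Sum>k\<in>{j..<N}. f (k - j)) + (\<Sum>k\<in>{j..<N}. f (N - (k - j))))"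
    by (simp add: sum.distrib)
  also have "\<dots> \<le> (suminf f + suminf f) + (suminf f + suminf f)"
    using j by (intro add_mono im inj_onI) auto
  also have "\<dots> \<le> 4 * (suminf f + 1)" by simp
  finally show "(\<Sum>k<N. (1 + real (cdist N j k)) powr (-s)) \<le> 4 * (suminf f + 1)"
    unfolding f_def .
qed

section \<open>A weighted M. Riesz inequality in the disc\<close>

lemma circle_mean_value:
  assumes "f holomorphic_on ball 0 1" "0 < r" "r < 1"
  shows "((\<lambda>t. f (of_real r * cis t)) has_integral 2 * of_real pi * f 0) {0..2*pi}"
proof -
  have "f holomorphic_on cball 0 r" using assms by (auto intro: holomorphic_on_subset)
  then have "((\<lambda>u. f u / (u - 0)) has_contour_integral (2 * of_real pi * \<i> * f 0)) (circlepath 0 r)"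
    using assms by (intro Cauchy_integral_circlepath_simple) auto
  then have "((\<lambda>t. f (of_real r * cis t) / (of_real r * cis t) * of_real r * \<i> * cis t) has_integral
     (2 * of_real pi * \<i> * f 0)) {0..2*pi}"
    unfolding circlepath_def by (subst (asm) has_contour_integral_part_circlepath_iff) auto
  then have "((\<lambda>t. (- \<i>) * (f (of_real r * cis t) / (of_real r * cis t) * of_real r * \<i> * cis t)) has_integral
     (- \<i>) * (2 * of_real pi * \<i> * f 0)) {0..2*pi}"
    by (rule has_integral_mult_right)
  moreover have "(- \<i>) * (f (of_real r * cis t) / (of_real r * cis t) * of_real r * \<i> * cis t) = f (of_real r * cis t)" for t
    using assms by (simp add: mult_ac)
  ultimately show ?thesis by (simp add: mult_ac)
qed

section \<open>Harnack inequalities for the modulus\<close>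

text \<open>The Moebius map carries 0 to \<open>w\<close>, and the Cayley transform centred at
  \<open>f w\<close> carries the half plane to the disc; Schwarz's lemma applies to the composition.
  The result is stated with denominators cleared.\<close>

lemma schwarz_pick_half_plane:
  assumes f: "f holomorphic_on ball 0 1" and pos: "\<And>z. norm z < 1 \<Longrightarrow> Re (f z) > 0"
    and z: "norm z < 1" and w: "norm w < 1"
  shows "norm (f z - f w) * norm (1 - cnj w * z) \<le> norm (z - w) * norm (f z + cnj (f w))"
proof -
  let ?M = "Moebius_function 0 (-w)"
  define g where "g u = (f (?M u) - f w) / (f (?M u) + cnj (f w))" for u
  have M: "norm (?M u) < 1" if "norm u < 1" for u using that w by (intro Moebius_function_norm_lt_1) auto
  have nz: "f (?M u) + cnj (f w) \<noteq> 0" if "norm u < 1" for u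
    using pos[OF M[OF that]] pos[OF w] by (auto simp: complex_eq_iff)
  have hM: "?M holomorphic_on ball 0 1" using w by (intro Moebius_function_holomorphic) auto
  have "(f \<circ> ?M) holomorphic_on ball 0 1"
    using M by (intro holomorphic_on_compose_gen[OF hM f]) auto
  then have hg: "g holomorphic_on ball 0 1" unfolding g_def
    using nz by (intro holomorphic_intros) (auto simp: o_def)
  have "g 0 = 0" by (simp add: g_def Moebius_function_of_zero)
  have ng: "norm (g u) < 1" if "norm u < 1" for u
  proof -
    \<comment> \<open>The two squares differ by four times the product of the two real parts, which
      is positive.\<close>
    have "norm (f (?M u) - f w) ^ 2 < norm (f (?M u) + cnj (f w)) ^ 2"
      using mult_pos_pos[OF pos[OF M[OF that]] pos[OF w]]
      unfolding cmod_power2 by (simp add: power2_eq_square algebra_simps)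
    then have "norm (f (?M u) - f w) < norm (f (?M u) + cnj (f w))" by (rule power_less_imp_less_base) simp
    then show ?thesis using nz[OF that] by (simp add: g_def norm_divide)
  qed
  define u where "u = Moebius_function 0 w z"
  have u: "norm u < 1" unfolding u_def using w z by (rule Moebius_function_norm_lt_1)
  have Mu: "?M u = z" unfolding u_def by (rule Moebius_function_compose) (use w z in auto)
  have le: "norm (g u) \<le> norm u" using Schwarz_Lemma(1)[OF hg \<open>g 0 = 0\<close> ng u] .
  have "norm (cnj w * z) < 1" using w z
    by (simp add: norm_mult) (metis mult.commute mult_less_cancel_right1 norm_ge_zero order.asym not_less_iff_gr_or_eq mult_strict_mono' norm_one mult_1)
  then have nz1: "1 - cnj w * z \<noteq> 0" by auto
  have "norm (f z - f w) / norm (f z + cnj (f w)) \<le> norm (z - w) / norm (1 - cnj w * z)"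
    using le unfolding g_def Mu unfolding u_def Moebius_function_simple by (simp add: norm_divide)
  then show ?thesis using nz[OF u] nz1 unfolding Mu by (simp add: field_simps)
qed

text \<open>Unlike the usual Harnack inequality this controls |f|, not just Re f. With \<sigma> = |1
  - cnj w z| and \<tau> = |z - w|, Schwarz-Pick bounds the quotient of the moduli by (\<sigma> +
  \<tau>) / (\<sigma> - \<tau>), and \<sigma>^2 - \<tau>^2 = (1 - r^2)^2 turns this into the square
  of (\<sigma> + \<tau>) / (1 - r^2). Measured in units of 1 - r, the growth is quadratic in the
  distance.\<close>

lemma harnack_circle:
  assumes f: "f holomorphic_on ball 0 1" and pos: "\<And>z. norm z < 1 \<Longrightarrow> Re (f z) > 0"
    and x: "norm x = 1" and y: "norm y = 1" and r: "0 < r" "r < 1"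
  shows "norm (f (of_real r * x)) \<le> norm (f (of_real r * y)) * (1 + 2 * norm (x - y) / (1 - r)) ^ 2"
proof -
  define z w where "z = of_real r * x" and "w = of_real r * y"
  have nz: "norm z = r" "norm w = r" using assms by (auto simp: z_def w_def norm_mult)
  define \<sigma> \<tau> where "\<sigma> = norm (1 - cnj w * z)" and "\<tau> = norm (z - w)"
  have \<tau>: "\<tau> \<le> norm (x - y)"
  proof -
    have "z - w = of_real r * (x - y)" by (simp add: z_def w_def algebra_simps)
    then have "\<tau> = r * norm (x - y)" using r by (simp add: \<tau>_def norm_mult)
    then show ?thesis using r by (simp add: mult_left_le_one_le)
  qed
  have \<sigma>: "\<sigma> \<le> (1 - r\<^sup>2) + \<tau>"
  proof -
    have "1 - cnj w * z = of_real (1 - r\<^sup>2) + cnj w * (w - z)"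
      using complex_norm_square[of w] nz by (simp add: algebra_simps)
    then have "\<sigma> \<le> norm (of_real (1 - r\<^sup>2) :: complex) + norm (cnj w * (w - z))"
      unfolding \<sigma>_def by (metis norm_triangle_ineq)
    also have "norm (of_real (1 - r\<^sup>2) :: complex) = 1 - r\<^sup>2"
      using r by (subst norm_of_real) (simp add: power_le_one)
    also have "norm (cnj w * (w - z)) \<le> \<tau>" using r nz
      by (simp add: norm_mult \<tau>_def norm_minus_commute mult_left_le_one_le)
    finally show ?thesis by simp
  qed
  have id: "\<sigma>\<^sup>2 - \<tau>\<^sup>2 = (1 - r\<^sup>2)\<^sup>2"
  proof -
    have "\<sigma>\<^sup>2 - \<tau>\<^sup>2 = (1 - (norm z)\<^sup>2) * (1 - (norm w)\<^sup>2)"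
      unfolding \<sigma>_def \<tau>_def cmod_power2 by (simp add: power2_eq_square algebra_simps)
    then show ?thesis using nz by (simp add: power2_eq_square)
  qed
  define a b where "a = norm (f z)" and "b = norm (f w)"
  have "(a - b) * \<sigma> \<le> norm (f z - f w) * \<sigma>"
    unfolding a_def b_def \<sigma>_def by (intro mult_right_mono norm_triangle_ineq2) auto
  also have "\<dots> \<le> \<tau> * norm (f z + cnj (f w))"
    unfolding \<sigma>_def \<tau>_def using nz r by (intro schwarz_pick_half_plane f pos) auto
  also have "\<dots> \<le> \<tau> * (a + b)"
    unfolding a_def b_def using norm_triangle_ineq[of "f z" "cnj (f w)"] by (intro mult_left_mono) (auto simp: \<tau>_def)
  finally have "a * (\<sigma> - \<tau>) \<le> b * (\<sigma> + \<tau>)" by (simp add: algebra_simps)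
  then have "a * (\<sigma> - \<tau>) * (\<sigma> + \<tau>) \<le> b * (\<sigma> + \<tau>) * (\<sigma> + \<tau>)"
    by (intro mult_right_mono) (auto simp: \<sigma>_def \<tau>_def)
  then have "a * (1 - r\<^sup>2)\<^sup>2 \<le> b * (\<sigma> + \<tau>)\<^sup>2"
    unfolding id[symmetric] by (simp add: power2_eq_square algebra_simps)
  also have "\<dots> \<le> b * ((1 - r\<^sup>2) + 2 * \<tau>)\<^sup>2"
    using \<sigma> by (intro mult_left_mono power_mono) (auto simp: b_def \<sigma>_def \<tau>_def)
  finally have 1: "a * (1 - r\<^sup>2)\<^sup>2 \<le> b * ((1 - r\<^sup>2) + 2 * \<tau>)\<^sup>2" .
  have r2: "1 - r\<^sup>2 \<ge> 1 - r" "1 - r > 0" using r by (auto simp: power2_eq_square mult_left_le_one_le)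
  have "(1 - r\<^sup>2) + 2 * \<tau> \<le> (1 - r\<^sup>2) * (1 + 2 * norm (x - y) / (1 - r))"
  proof -
    have "2 * \<tau> \<le> (1 - r\<^sup>2) / (1 - r) * (2 * norm (x - y))"
    proof -
      have "(1 - r\<^sup>2) / (1 - r) = 1 + r" using r by (simp add: field_simps power2_eq_square)
      moreover have "2 * \<tau> \<le> (1 + r) * (2 * norm (x - y))"
        using mult_mono[of 1 "1 + r" "2 * \<tau>" "2 * norm (x - y)"] r \<tau> by (simp add: \<tau>_def)
      ultimately show ?thesis by simp
    qed
    then show ?thesis by (simp add: field_simps)
  qed
  then have "((1 - r\<^sup>2) + 2 * \<tau>)\<^sup>2 \<le> ((1 - r\<^sup>2) * (1 + 2 * norm (x - y) / (1 - r)))\<^sup>2"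
    using r2 by (intro power_mono) (auto simp: \<tau>_def)
  then have "b * ((1 - r\<^sup>2) + 2 * \<tau>)\<^sup>2 \<le> b * ((1 - r\<^sup>2) * (1 + 2 * norm (x - y) / (1 - r)))\<^sup>2"
    by (intro mult_left_mono) (auto simp: b_def)
  with 1 have "(1 - r\<^sup>2)\<^sup>2 * a \<le> (1 - r\<^sup>2)\<^sup>2 * (b * (1 + 2 * norm (x - y) / (1 - r))\<^sup>2)"
    by (simp add: power_mult_distrib mult_ac)
  then show ?thesis using r2 unfolding a_def b_def z_def w_def by (subst (asm) mult_le_cancel_left_pos) auto
qed

text \<open>The multiple \<open>c = pi / (2 * \<eta>)\<close> is the largest for which
  \<open>exp (c * L)\<close> stays in the right half plane. Harnack gives exponent 2 for it, and the
  root of order \<open>c\<close> reduces this to 2 / c.\<close>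

lemma exp_harnack_circle:
  assumes L: "L holomorphic_on ball 0 1" and \<eta>: "\<And>z. norm z < 1 \<Longrightarrow> \<bar>Im (L z)\<bar> < \<eta>"
    and x: "norm x = 1" and y: "norm y = 1" and r: "0 < r" "r < 1"
  shows "norm (exp (L (of_real r * x)))
    \<le> norm (exp (L (of_real r * y))) * (1 + 2 * norm (x - y) / (1 - r)) powr (4 * \<eta> / pi)"
proof -
  have \<eta>0: "\<eta> > 0" using \<eta>[of 0] by simp
  define c where "c = pi / (2 * \<eta>)"
  define f where "f z = exp (of_real c * L z)" for z
  have c: "c > 0" using \<eta>0 by (simp add: c_def)
  have "Re (f z) > 0" if "norm z < 1" for z
  proof -
    have "\<bar>c * Im (L z)\<bar> < c * \<eta>" using \<eta>[OF that] c by (simp add: abs_mult)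
    also have "c * \<eta> = pi / 2" using \<eta>0 by (simp add: c_def)
    finally show ?thesis by (auto simp: f_def Re_exp intro!: mult_pos_pos cos_gt_zero_pi)
  qed
  moreover have "f holomorphic_on ball 0 1" unfolding f_def using L by (intro holomorphic_intros)
  ultimately have h: "norm (f (of_real r * x)) \<le> norm (f (of_real r * y)) * (1 + 2 * norm (x - y) / (1 - r)) ^ 2"
    using x y r by (intro harnack_circle)
  let ?T = "1 + 2 * norm (x - y) / (1 - r)"
  have T: "?T > 0" using r by (intro add_pos_nonneg) auto
  have nf: "norm (f z) powr (1 / c) = norm (exp (L z))" for z
    using c by (simp add: f_def exp_powr_real)
  have "norm (f (of_real r * x)) powr (1 / c) \<le> (norm (f (of_real r * y)) * ?T ^ 2) powr (1 / c)"
    using h c by (intro powr_mono2) auto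
  also have "\<dots> = norm (f (of_real r * y)) powr (1 / c) * ?T powr (2 / c)"
    using T by (simp add: powr_mult powr_powr flip: powr_numeral)
  also have "2 / c = 4 * \<eta> / pi" by (simp add: c_def)
  finally show ?thesis unfolding nf .
qed

section \<open>Riesz's inequality with an analytic weight\<close>

text \<open>Close to \<phi> = pi / 2 the angle \<open>p * \<phi> + g\<close> lies strictly between
  pi / 2 and 3 pi / 2, so the cosine term is positive after its sign; elsewhere
  \<open>cos \<phi>\<close> is bounded below and a large \<open>A\<close> wins. The slack \<kappa>
  in the hypothesis determines how wide the first zone may be; \<phi> near - pi / 2 is
  reflected.\<close>

lemma riesz_trig_inequality:
  fixes p \<eta> :: real
  assumes p: "1 < p" "p \<le> 2" and \<eta>: "0 \<le> \<eta>" "p * \<eta> < (p - 1) * pi / 2"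
  obtains A B where "A > 0" "B > 0"
    "\<And>\<phi> g. \<bar>\<phi>\<bar> < pi / 2 \<Longrightarrow> \<bar>g\<bar> \<le> p * \<eta> \<Longrightarrow> 1 \<le> A * cos \<phi> powr p - B * cos (p * \<phi> + g)"
proof -
  define \<kappa> where "\<kappa> = (p - 1) * pi / 2 - p * \<eta>"
  have \<kappa>: "\<kappa> > 0" using \<eta> by (simp add: \<kappa>_def)
  have ub: "(p - 1) * pi \<le> 1 * pi" using p by (intro mult_right_mono) auto
  have pe: "p * \<eta> \<ge> 0" using p \<eta> by auto
  have \<kappa>1: "\<kappa> \<le> pi / 2" using ub pe unfolding \<kappa>_def by linarith
  have s1: "sin (\<kappa> / 2) > 0" using \<kappa> \<kappa>1 by (intro sin_gt_zero) auto
  have pk: "\<kappa> / (2 * p) > 0" "\<kappa> / (2 * p) < \<kappa>" using p \<kappa> by (auto simp: field_simps)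
  have s2: "sin (\<kappa> / (2 * p)) > 0" using pk \<kappa>1 by (intro sin_gt_zero) auto
  \<comment> \<open>\<open>B\<close> makes the cosine term at least 1 in the zone near the imaginary
    axis; \<open>A\<close> then compensates its worst value \<open>- B\<close> in the remaining zone
    and leaves 1.\<close>
  define B where "B = 1 / sin (\<kappa> / 2)"
  define A where "A = (1 + B) / sin (\<kappa> / (2 * p)) powr p"
  have B: "B > 0" using s1 by (simp add: B_def)
  have A: "A > 0" using B s2 by (simp add: A_def)
  have c: "cos x \<le> - sin (\<kappa> / 2)" if "pi / 2 + \<kappa> / 2 \<le> x" "x \<le> 3 * pi / 2 - \<kappa> / 2" for x
  proof -
    have "cos (pi / 2 - \<kappa> / 2) \<le> cos \<bar>x - pi\<bar>" using that \<kappa> \<kappa>1 by (subst cos_mono_le_eq) auto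
    also have "cos \<bar>x - pi\<bar> = - cos x" by simp
    also have "cos (pi / 2 - \<kappa> / 2) = sin (\<kappa> / 2)" by (simp add: sin_cos_eq)
    finally show ?thesis by simp
  qed
  have "1 \<le> A * cos \<phi> powr p - B * cos (p * \<phi> + g)" if h: "\<bar>\<phi>\<bar> < pi / 2" "\<bar>g\<bar> \<le> p * \<eta>" for \<phi> g
  proof (cases "\<bar>\<phi>\<bar> \<ge> pi / 2 - \<kappa> / (2 * p)")
    case True
    define g' where "g' = (if \<phi> \<ge> 0 then g else - g)"
    have e: "cos (p * \<phi> + g) = cos (p * \<bar>\<phi>\<bar> + g')"
      using cos_minus[of "p * \<phi> + g"] by (auto simp: g'_def abs_if)
    have g': "\<bar>g'\<bar> \<le> p * \<eta>" using h by (auto simp: g'_def)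
    have "p * \<bar>\<phi>\<bar> \<ge> p * (pi / 2 - \<kappa> / (2 * p))" using True p by (intro mult_left_mono) auto
    also have "p * (pi / 2 - \<kappa> / (2 * p)) = p * pi / 2 - \<kappa> / 2" using p by (simp add: field_simps)
    finally have l: "p * \<bar>\<phi>\<bar> \<ge> p * pi / 2 - \<kappa> / 2" .
    have "p * \<bar>\<phi>\<bar> \<le> p * (pi / 2)" using h p by (intro mult_left_mono) auto
    then have u: "p * \<bar>\<phi>\<bar> \<le> p * pi / 2" by simp
    have k: "\<kappa> = p * pi / 2 - pi / 2 - p * \<eta>" by (simp add: \<kappa>_def field_simps)
    have "cos (p * \<bar>\<phi>\<bar> + g') \<le> - sin (\<kappa> / 2)"
    proof (rule c)
      show "pi / 2 + \<kappa> / 2 \<le> p * \<bar>\<phi>\<bar> + g'" using l g' k by linarith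
      have "p * pi \<le> 2 * pi" using p by auto
      then show "p * \<bar>\<phi>\<bar> + g' \<le> 3 * pi / 2 - \<kappa> / 2" using u g' k \<kappa> by linarith
    qed
    then have "B * cos (p * \<bar>\<phi>\<bar> + g') \<le> B * (- sin (\<kappa> / 2))" using B by (intro mult_left_mono) auto
    also have "\<dots> = - 1" using s1 by (simp add: B_def)
    finally have "B * cos (p * \<phi> + g) \<le> - 1" using e by simp
    moreover have "A * cos \<phi> powr p \<ge> 0" using A by simp
    ultimately show ?thesis by linarith
  next
    case False
    have "sin (\<kappa> / (2 * p)) = cos (pi / 2 - \<kappa> / (2 * p))" by (simp add: sin_cos_eq)
    also have "\<dots> \<le> cos \<bar>\<phi>\<bar>" using False pk \<kappa>1 by (subst cos_mono_le_eq) auto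
    finally have "sin (\<kappa> / (2 * p)) powr p \<le> cos \<phi> powr p" using s2 p by (intro powr_mono2) auto
    then have "A * sin (\<kappa> / (2 * p)) powr p \<le> A * cos \<phi> powr p" using A by (intro mult_left_mono) auto
    then have "1 + B \<le> A * cos \<phi> powr p" using s2 by (simp add: A_def)
    moreover have "B * cos (p * \<phi> + g) \<le> B * 1" using B by (intro mult_left_mono) auto
    ultimately show ?thesis by linarith
  qed
  with A B that show ?thesis by blast
qed

text \<open>The second summand is there because the kernel 1 / (1 - w) is half the Herglotz kernel
  plus 1/2, so the sums to be estimated contain the constant \<open>F 0\<close> besides
  \<open>F\<close>. The normalization at 0 is the usual one of the conjugate function.\<close>

definition weighted_riesz_bound :: "real \<Rightarrow> real \<Rightarrow> real \<Rightarrow> bool" where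
  "weighted_riesz_bound p \<eta> A \<longleftrightarrow> A > 0 \<and> (\<forall>F L r.
      F holomorphic_on ball 0 1 \<longrightarrow> (\<forall>z. norm z < 1 \<longrightarrow> Re (F z) > 0) \<longrightarrow> Im (F 0) = 0 \<longrightarrow>
      L holomorphic_on ball 0 1 \<longrightarrow> (\<forall>z. norm z < 1 \<longrightarrow> \<bar>Im (L z)\<bar> \<le> \<eta>) \<longrightarrow> 0 < r \<longrightarrow> r < 1 \<longrightarrow>
      integral {0..2*pi} (\<lambda>t. norm (F (of_real r * cis t) * exp (L (of_real r * cis t))) powr p)
      + norm (F 0) powr p * integral {0..2*pi} (\<lambda>t. norm (exp (L (of_real r * cis t))) powr p)
      \<le> A * integral {0..2*pi} (\<lambda>t. (Re (F (of_real r * cis t)) * norm (exp (L (of_real r * cis t)))) powr p))"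

text \<open>Riesz's argument for the conjugate function with the weight \<open>\<bar>exp L\<bar>\<close>: multiplying \<open>F powr p\<close>
  by \<open>exp (p * L)\<close> keeps it analytic, and the bound on \<open>Im L\<close> keeps its real part negative where
  \<open>Re F\<close> is small compared to \<open>\<bar>F\<bar>\<close>.\<close>

lemma weighted_riesz:
  fixes p \<eta> :: real
  assumes p: "1 < p" "p \<le> 2" and \<eta>: "0 \<le> \<eta>" "p * \<eta> < (p - 1) * pi / 2"
  shows "\<exists>A. weighted_riesz_bound p \<eta> A"
proof -
  from riesz_trig_inequality[OF assms] obtain A B where AB: "A > 0" "B > 0"
    and trig: "\<And>\<phi> g. \<bar>\<phi>\<bar> < pi / 2 \<Longrightarrow> \<bar>g\<bar> \<le> p * \<eta> \<Longrightarrow> 1 \<le> A * cos \<phi> powr p - B * cos (p * \<phi> + g)" by metis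
  have ub: "(p - 1) * pi \<le> 1 * pi" using p by (intro mult_right_mono) auto
  have pe: "p * \<eta> < pi / 2" using ub \<eta> by linarith
  have pe0: "p * \<eta> \<ge> 0" using \<eta> p by auto
  define c where "c = cos (p * \<eta>)"
  have c: "c > 0" unfolding c_def using pe pe0 by (intro cos_gt_zero_pi) auto
  \<comment> \<open>One factor \<open>c\<close> is lost when the integral of the weight is bounded
    by its value at 0, the other when \<open>Re (G 0)\<close> is bounded below.\<close>
  define A' where "A' = A + A / (B * c * c)"
  have A': "A' > 0" using AB c by (simp add: A'_def add_pos_pos)
  have main: "integral {0..2*pi} (\<lambda>t. norm (F (of_real r * cis t) * exp (L (of_real r * cis t))) powr p)
      + norm (F 0) powr p * integral {0..2*pi} (\<lambda>t. norm (exp (L (of_real r * cis t))) powr p)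
      \<le> A' * integral {0..2*pi} (\<lambda>t. (Re (F (of_real r * cis t)) * norm (exp (L (of_real r * cis t)))) powr p)"
    if F: "F holomorphic_on ball 0 1" and Fp: "\<And>z. norm z < 1 \<Longrightarrow> Re (F z) > 0" and F0: "Im (F 0) = 0"
      and L: "L holomorphic_on ball 0 1" and Li: "\<And>z. norm z < 1 \<Longrightarrow> \<bar>Im (L z)\<bar> \<le> \<eta>" and r: "0 < r" "r < 1"
    for F L r
  proof -
    let ?z = "\<lambda>t. of_real r * cis t :: complex"
    have nz: "norm (?z t) < 1" for t using r by (simp add: norm_mult)
    have rng: "(\<lambda>t. ?z t) ` {0..2*pi} \<subseteq> ball 0 1" using nz by auto
    have cz: "continuous_on {0..2*pi} ?z" by (intro continuous_intros)
    have comp: "continuous_on {0..2*pi} (\<lambda>t. f (?z t))" if "f holomorphic_on ball 0 1" for f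
      using continuous_on_compose2[OF holomorphic_on_imp_continuous_on[OF that] cz rng] .
    have cF: "continuous_on {0..2*pi} (\<lambda>t. F (?z t))" and cL: "continuous_on {0..2*pi} (\<lambda>t. L (?z t))"
      using comp[OF F] comp[OF L] .
    have Fnz: "F (?z t) \<noteq> 0" for t using Fp[OF nz[of t]] by auto
    \<comment> \<open>This is F^p exp (p L); the principal logarithm is analytic here because Re F >
      0.\<close>
    define G where "G z = exp (of_real p * (Ln (F z) + L z))" for z
    define E where "E z = exp (of_real p * L z)" for z
    have hG: "G holomorphic_on ball 0 1" unfolding G_def using F L Fp
      by (intro holomorphic_intros) (force simp: complex_nonpos_Reals_iff)
    have hE: "E holomorphic_on ball 0 1" unfolding E_def using L by (intro holomorphic_intros)
    have mv: "((\<lambda>t. Re (f (?z t))) has_integral 2 * pi * Re (f 0)) {0..2*pi}" if "f holomorphic_on ball 0 1" for f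
      using has_integral_linear[OF circle_mean_value[OF that r] bounded_linear_Re] by (simp add: o_def)
    define I1 where "I1 = integral {0..2*pi} (\<lambda>t. norm (F (?z t) * exp (L (?z t))) powr p)"
    define I2 where "I2 = integral {0..2*pi} (\<lambda>t. norm (exp (L (?z t))) powr p)"
    define I3 where "I3 = integral {0..2*pi} (\<lambda>t. (Re (F (?z t)) * norm (exp (L (?z t)))) powr p)"
    have h1: "((\<lambda>t. norm (F (?z t) * exp (L (?z t))) powr p) has_integral I1) {0..2*pi}"
      unfolding I1_def using Fnz by (intro integrable_integral integrable_continuous_real continuous_intros cF cL) auto
    have h2: "((\<lambda>t. norm (exp (L (?z t))) powr p) has_integral I2) {0..2*pi}"
      unfolding I2_def by (intro integrable_integral integrable_continuous_real continuous_intros cL) auto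
    have h3: "((\<lambda>t. (Re (F (?z t)) * norm (exp (L (?z t)))) powr p) has_integral I3) {0..2*pi}"
      unfolding I3_def using Fp[OF nz]
      by (intro integrable_integral integrable_continuous_real continuous_intros cF cL) (auto simp: less_imp_neq[symmetric])
    have nE: "norm (E z) = norm (exp (L z)) powr p" for z
      by (simp add: E_def exp_powr_real mult.commute)
    have ReE: "c * norm (exp (L z)) powr p \<le> Re (E z)" if "norm z < 1" for z
    proof -
      have "\<bar>p * Im (L z)\<bar> \<le> p * \<eta>" using Li[OF that] p by (simp add: abs_mult)
      then have "cos (p * \<eta>) \<le> cos \<bar>p * Im (L z)\<bar>" using pe by (subst cos_mono_le_eq) auto
      then have "norm (E z) * c \<le> norm (E z) * cos (p * Im (L z))" unfolding c_def
        by (intro mult_left_mono) auto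
      then show ?thesis using nE[of z] by (simp add: E_def Re_exp mult.commute)
    qed
    \<comment> \<open>The argument of \<open>E\<close> is at most
      \<open>p * \<eta> < pi / 2\<close>, so |E| is comparable to the harmonic function Re E, whose
      mean is its value at 0. Hence the weight has mean at most a constant times its central
      value.\<close>
    have I2: "c * I2 \<le> 2 * pi * norm (exp (L 0)) powr p"
    proof -
      have "c * I2 \<le> 2 * pi * Re (E 0)"
        using ReE[OF nz] by (intro has_integral_le[OF has_integral_mult_right[OF h2] mv[OF hE]]) auto
      also have "\<dots> \<le> 2 * pi * norm (E 0)" by (intro mult_left_mono complex_Re_le_cmod) auto
      finally show ?thesis by (simp add: nE)
    qed
    have pt: "norm (F z * exp (L z)) powr p \<le> A * (Re (F z) * norm (exp (L z))) powr p - B * Re (G z)"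
      if "norm z < 1" for z
    proof -
      define a \<phi> where "a = norm (F z) * norm (exp (L z))" and "\<phi> = Arg (F z)"
      have F: "F z \<noteq> 0" using Fp[OF that] by auto
      have ReF: "Re (F z) = norm (F z) * cos \<phi>" unfolding \<phi>_def by (metis Re_rcis rcis_cmod_Arg)
      have ph: "\<bar>\<phi>\<bar> < pi / 2" unfolding \<phi>_def using Fp[OF that] Arg_Re_pos by blast
      have c0: "cos \<phi> \<ge> 0" using ph by (intro cos_ge_zero) auto
      have a: "a > 0" using F by (simp add: a_def)
      have "\<bar>p * Im (L z)\<bar> \<le> p * \<eta>" using Li[OF that] p by (simp add: abs_mult)
      then have "a powr p * 1 \<le> a powr p * (A * cos \<phi> powr p - B * cos (p * \<phi> + p * Im (L z)))"
        using trig[OF ph] a by (intro mult_left_mono) auto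
      also have "\<dots> = A * (a * cos \<phi>) powr p - B * (a powr p * cos (p * \<phi> + p * Im (L z)))"
        using a c0 by (simp add: powr_mult algebra_simps)
      also have "a * cos \<phi> = Re (F z) * norm (exp (L z))" by (simp add: ReF a_def mult_ac)
      also have "a powr p * cos (p * \<phi> + p * Im (L z)) = Re (G z)"
        using F by (simp add: G_def Re_exp a_def \<phi>_def Arg_def powr_def ln_mult distrib_left)
      finally show ?thesis by (simp add: a_def norm_mult)
    qed
    have I13: "I1 \<le> A * I3 - B * (2 * pi * Re (G 0))"
      using pt[OF nz] by (intro has_integral_le[OF h1 has_integral_diff[OF has_integral_mult_right[OF h3]
        has_integral_mult_right[OF mv[OF hG]]]]) auto
    \<comment> \<open>\<open>F 0\<close> is a positive real, so its power does not rotate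
      \<open>E 0\<close>. The term \<open>B * Re (G 0)\<close> therefore has a favourable sign and
      even absorbs the constant term of the bound.\<close>
    have G0: "Re (G 0) \<ge> c * norm (F 0) powr p * norm (exp (L 0)) powr p"
    proof -
      have F0': "F 0 = of_real (norm (F 0))" "norm (F 0) > 0"
        using F0 Fp[of 0] by (auto simp: complex_eq_iff cmod_eq_Re)
      have "Ln (F 0) = of_real (ln (norm (F 0)))" using F0' by (metis Ln_of_real)
      moreover have "exp (of_real p * of_real (ln a)) = (of_real (exp (p * ln a)) :: complex)" for a
        by (metis exp_of_real of_real_mult)
      ultimately have "G 0 = of_real (norm (F 0) powr p) * E 0"
        using F0' by (simp add: G_def E_def powr_def distrib_left exp_add)
      then have "Re (G 0) = norm (F 0) powr p * Re (E 0)" by simp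
      also have "\<dots> \<ge> norm (F 0) powr p * (c * norm (exp (L 0)) powr p)"
        using ReE[of 0] by (intro mult_left_mono) auto
      finally show ?thesis by (simp add: mult_ac)
    qed
    have "c * norm (F 0) powr p * norm (exp (L 0)) powr p \<ge> 0" using c by simp
    then have "0 \<le> Re (G 0)" using G0 by linarith
    then have "0 \<le> B * (2 * pi * Re (G 0))" using AB by (intro mult_nonneg_nonneg) auto
    with I13 have "I1 \<le> A * I3" by linarith
    have "0 \<le> I1" using h1 by (rule has_integral_nonneg) auto
    with I13 have "2 * pi * Re (G 0) \<le> A / B * I3"
      using AB by (simp add: field_simps)
    have "norm (F 0) powr p * I2 \<le> norm (F 0) powr p * (2 * pi * norm (exp (L 0)) powr p / c)"
      using I2 c by (intro mult_left_mono) (auto simp: field_simps)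
    also have "\<dots> = 2 * pi * (c * norm (F 0) powr p * norm (exp (L 0)) powr p) / (c * c)" using c by (simp add: field_simps)
    also have "\<dots> \<le> 2 * pi * Re (G 0) / (c * c)"
      using G0 c by (intro divide_right_mono mult_left_mono) auto
    also have "\<dots> \<le> A / B * I3 / (c * c)"
      using \<open>2 * pi * Re (G 0) \<le> A / B * I3\<close> c by (intro divide_right_mono) auto
    finally have "norm (F 0) powr p * I2 \<le> A / (B * c * c) * I3" by simp
    with \<open>I1 \<le> A * I3\<close> show ?thesis unfolding A'_def I1_def I2_def I3_def by (simp add: distrib_right)
  qed
  have "weighted_riesz_bound p \<eta> A'"
    unfolding weighted_riesz_bound_def by (intro conjI allI impI A', rule main) auto
  then show ?thesis ..
qed

section \<open>Discrete Herglotz sums\<close>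

lemma integral_arcs:
  fixes g :: "real \<Rightarrow> real"
  assumes g: "continuous_on {0..2*pi} g" and N: "N > 0"
  shows "integral {0..2*pi} g = (\<Sum>k<N. integral {2*pi*real k/real N..2*pi*(real k+1)/real N} g)"
proof -
  have "integral {0..2*pi*real m/real N} g = (\<Sum>k<m. integral {2*pi*real k/real N..2*pi*(real k+1)/real N} g)"
    if "m \<le> N" for m
    using that
  proof (induction m)
    case (Suc m)
    have le: "2*pi*real m/real N \<le> 2*pi*real (Suc m)/real N" using N by (intro divide_right_mono) auto
    have "2*pi*real (Suc m)/real N \<le> 2*pi*real N/real N" using Suc.prems N by (intro divide_right_mono) auto
    then have "g integrable_on {0..2*pi*real (Suc m)/real N}" using N
      by (intro integrable_continuous_real continuous_on_subset[OF g]) auto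
    then have "integral {0..2*pi*real (Suc m)/real N} g
       = integral {0..2*pi*real m/real N} g + integral {2*pi*real m/real N..2*pi*real (Suc m)/real N} g"
      using le by (intro Henstock_Kurzweil_Integration.integral_combine[symmetric]) auto
    with Suc show ?case by (simp add: add.commute)
  qed auto
  from this[of N] show ?thesis using N by simp
qed

lemma arc_subset:
  assumes "k < N"
  shows "{2*pi*real k/real N..2*pi*(real k+1)/real N} \<subseteq> {0..2*pi}"
proof -
  have "2*pi*(real k+1)/real N \<le> 2*pi*real N/real N" using assms by (intro divide_right_mono mult_left_mono) auto
  then show ?thesis using assms by auto
qed

lemma arc_index:
  assumes t: "0 \<le> t" "t \<le> 2 * pi" and N: "N > 0"
  obtains k s where "k < N" "0 \<le> s" "s \<le> 1" "t = 2 * pi * (real k + s) / real N"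
proof -
  define u where "u = t * N / (2 * pi)"
  have u: "0 \<le> u" "u \<le> N" "t = 2 * pi * u / N" using t N by (auto simp: u_def field_simps)
  show thesis
  proof (cases "u = N")
    case True
    \<comment> \<open>The endpoint 2 pi would have index \<open>N\<close>; it is assigned to the end
      of the last arc.\<close>
    show thesis by (rule that[of "N - 1" 1]) (use True u N in \<open>auto simp: of_nat_diff\<close>)
  next
    case False
    have fu: "real (nat \<lfloor>u\<rfloor>) + frac u = u" using u by (simp add: frac_def)
    have "real (nat \<lfloor>u\<rfloor>) < real N" using fu False u frac_ge_0[of u] by linarith
    then have "nat \<lfloor>u\<rfloor> < N" by (simp only: of_nat_less_iff)
    then show thesis by (intro that[of "nat \<lfloor>u\<rfloor>" "frac u"])
      (use u fu frac_lt_1[of u] frac_ge_0[of u] in auto)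
  qed
qed

lemma sum_le_integral_arcs:
  fixes g :: "real \<Rightarrow> real"
  assumes g: "continuous_on {0..2*pi} g" and N: "N > 0"
    and le: "\<And>k s. k < N \<Longrightarrow> 0 \<le> s \<Longrightarrow> s \<le> 1 \<Longrightarrow> V k \<le> g (2*pi*(real k + s)/real N)"
  shows "(2 * pi / real N) * (\<Sum>k<N. V k) \<le> integral {0..2*pi} g"
  unfolding integral_arcs[OF g N] sum_distrib_left
proof (rule sum_mono)
  fix k assume k: "k \<in> {..<N}"
  let ?a = "2*pi*real k/real N" and ?b = "2*pi*(real k+1)/real N"
  have ab: "?a \<le> ?b" using N by (intro divide_right_mono) auto
  have "integral {?a..?b} (\<lambda>_. V k) \<le> integral {?a..?b} g"
  proof (rule integral_le)
    show "g integrable_on {?a..?b}" using arc_subset[of k N] k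
      by (intro integrable_continuous_real continuous_on_subset[OF g]) auto
    fix t assume t: "t \<in> {?a..?b}"
    define s where "s = t * N / (2 * pi) - real k"
    have "t = 2*pi*(real k + s)/real N" using N by (simp add: s_def)
    moreover have "0 \<le> s" "s \<le> 1" using t N by (auto simp: s_def field_simps)
    ultimately show "V k \<le> g t" using le[of k s] k by simp
  qed auto
  moreover have "?b - ?a = 2 * pi / N" by (simp add: distrib_left add_divide_distrib)
  ultimately show "2 * pi / real N * V k \<le> integral {?a..?b} g" using ab by simp
qed

lemma integral_arcs_le_sum:
  fixes g :: "real \<Rightarrow> real"
  assumes g: "continuous_on {0..2*pi} g" and N: "N > 0"
    and le: "\<And>k s. k < N \<Longrightarrow> 0 \<le> s \<Longrightarrow> s \<le> 1 \<Longrightarrow> g (2*pi*(real k + s)/real N) \<le> V k"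
  shows "integral {0..2*pi} g \<le> (2 * pi / real N) * (\<Sum>k<N. V k)"
  using sum_le_integral_arcs[of "\<lambda>t. - g t" N "\<lambda>k. - V k"] assms
  by (auto simp: sum_negf intro: continuous_on_minus)

section \<open>Node families and sums of Herglotz kernels\<close>

text \<open>Offsets of up to a full grid step admit both perturbed nodes and rotated grids, so
  either can serve as nodes or as evaluation points. Coinciding points are allowed.\<close>

definition node_family :: "nat \<Rightarrow> (nat \<Rightarrow> complex) \<Rightarrow> bool" where
  "node_family N x \<longleftrightarrow> (\<forall>j<N. \<exists>e. \<bar>e\<bar> \<le> 1 \<and> x j = cis (2 * pi * (real j + e) / real N))"

lemma node_family_norm: "node_family N x \<Longrightarrow> j < N \<Longrightarrow> norm (x j) = 1"
  by (auto simp: node_family_def)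

lemma norm_cis_diff_le: "norm (cis a - cis b) \<le> \<bar>a - b\<bar>"
  unfolding norm_cis_diff using abs_sin_x_le_abs_x[of "(a - b) / 2"] by simp

lemma poisson_identity:
  assumes "norm w < 1"
  shows "Re ((1 + w) / (1 - w)) = (1 - (norm w)\<^sup>2) / (norm (1 - w))\<^sup>2"
  unfolding Re_divide cmod_power2 by (auto simp: power2_eq_square algebra_simps)

lemma norm_one_minus_scaled_ge:
  fixes u :: complex
  assumes R: "0 \<le> R" "R < 1" and u: "norm u = 1"
  shows "1 - R \<le> norm (1 - of_real R * u)" "norm (1 - u) \<le> 2 * norm (1 - of_real R * u)"
proof -
  have "norm (1::complex) - norm (of_real R * u) \<le> norm (1 - of_real R * u)" by (rule norm_triangle_ineq2)
  then show 1: "1 - R \<le> norm (1 - of_real R * u)" using R u by (simp add: norm_mult)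
  have "1 - u = (1 - of_real R * u) - of_real (1 - R) * u" by (simp add: algebra_simps)
  then have "norm (1 - u) \<le> norm (1 - of_real R * u) + norm (of_real (1 - R) * u)" by (metis norm_triangle_ineq4)
  also have "norm (of_real (1 - R) * u) = 1 - R" using R u by (simp only: norm_mult norm_of_real) simp
  finally show "norm (1 - u) \<le> 2 * norm (1 - of_real R * u)" using 1 by simp
qed

text \<open>At distance about 1/N from the circle, N |1 - R y/x| dominates both a constant and N |y
  - x|. The 3 on the left is 1 plus the offset error 2 of two nodes, which makes the left side
  dominate one plus the cyclic distance.\<close>

lemma scaled_distance_lower:
  fixes x y :: complex
  assumes c: "0 < c1" and R: "0 \<le> R" "R < 1" and N: "c1 \<le> real N * (1 - R)" and xy: "norm x = 1" "norm y = 1"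
  shows "3 + real N * norm (y - x) \<le> (3 / c1 + 2) * (real N * norm (1 - of_real R * (y / x)))"
proof -
  define u where "u = y / x"
  have u: "norm u = 1" using xy by (simp add: u_def norm_divide)
  define q where "q = norm (1 - of_real R * u)"
  have "x \<noteq> 0" using xy by auto
  then have "1 - u = (x - y) / x" by (simp add: u_def diff_divide_distrib)
  then have "norm (1 - u) = norm (y - x)" using xy by (simp add: norm_divide norm_minus_commute)
  then have q2: "norm (y - x) \<le> 2 * q" using norm_one_minus_scaled_ge(2)[OF R u] by (simp add: q_def)
  have q1: "1 - R \<le> q" using norm_one_minus_scaled_ge(1)[OF R u] by (simp add: q_def)
  have Nq: "c1 \<le> real N * q" using N mult_left_mono[OF q1, of "real N"] by linarith
  have "3 + real N * norm (y - x) \<le> (3 / c1) * (real N * q) + 2 * (real N * q)"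
  proof (rule add_mono)
    show "3 \<le> 3 / c1 * (real N * q)" using Nq c by (simp add: field_simps)
    show "real N * norm (y - x) \<le> 2 * (real N * q)" using mult_left_mono[OF q2, of "real N"] by simp
  qed
  then show ?thesis by (simp add: q_def u_def algebra_simps)
qed

text \<open>\<open>B\<close> is the set of admissible coefficients: nonnegative reals first, all of
  the complex plane later. Since \<open>x\<close>, \<open>y\<close> and \<open>L\<close> are
  quantified independently, the bound may be used with the two families exchanged and with
  \<open>- L\<close>, as duality requires. In the kernel, one factor \<open>r\<close> comes from the
  evaluation point and one from the definition of \<open>F\<close>.\<close>

definition herglotz_bound :: "complex set \<Rightarrow> real \<Rightarrow> real \<Rightarrow> real \<Rightarrow> real \<Rightarrow> real \<Rightarrow> bool" where
  "herglotz_bound B p \<eta> c1 c2 C \<longleftrightarrow> C > 0 \<and> (\<forall>N r x y L b.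
      N > 0 \<longrightarrow> 0 < r \<longrightarrow> r < 1 \<longrightarrow> c1 \<le> real N * (1 - r) \<longrightarrow> real N * (1 - r) \<le> c2 \<longrightarrow>
      node_family N x \<longrightarrow> node_family N y \<longrightarrow>
      L holomorphic_on ball 0 1 \<longrightarrow> (\<forall>z. norm z < 1 \<longrightarrow> \<bar>Im (L z)\<bar> < \<eta>) \<longrightarrow> (\<forall>j<N. b j \<in> B) \<longrightarrow>
      (\<Sum>k<N. (norm (exp (L (of_real r * y k))) * norm (\<Sum>j<N. b j / (1 - of_real (r\<^sup>2) * (y k / x j)))) powr p)
      \<le> C * (\<Sum>j<N. (real N * norm (b j) * norm (exp (L (of_real r * x j)))) powr p))"

lemma herglotz_boundD:
  assumes "herglotz_bound B p \<eta> c1 c2 C"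
    and "N > 0" "0 < r" "r < 1" "c1 \<le> real N * (1 - r)" "real N * (1 - r) \<le> c2"
      "node_family N x" "node_family N y" "L holomorphic_on ball 0 1"
      "\<And>z. norm z < 1 \<Longrightarrow> \<bar>Im (L z)\<bar> < \<eta>" "\<And>j. j < N \<Longrightarrow> b j \<in> B"
  shows "(\<Sum>k<N. (norm (exp (L (of_real r * y k))) * norm (\<Sum>j<N. b j / (1 - of_real (r\<^sup>2) * (y k / x j)))) powr p)
      \<le> C * (\<Sum>j<N. (real N * norm (b j) * norm (exp (L (of_real r * x j)))) powr p)"
  using assms(1) unfolding herglotz_bound_def
  by (elim conjE allE[of _ N] allE[of _ r] allE[of _ x] allE[of _ y] allE[of _ L] allE[of _ b])
    (use assms(2-) in simp)

text \<open>Harnack replaces the sum over \<open>y\<close> by an integral, Riesz's inequality passes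
  from |F| to Re F, and Re F is a sum of Poisson kernels of width about 1/N at the nodes. Moving the
  weight from the integration variable to a node costs a power 4 \<eta> / pi of the distance in grid
  steps, while the Poisson kernel gains a power 2. What remains decays with exponent
  \<open>s\<close>, and Schur's test applies.\<close>

lemma herglotz_bound_nonneg:
  fixes p \<eta> c1 c2 :: real
  assumes p: "1 < p" "p \<le> 2" and \<eta>: "0 \<le> \<eta>" "p * \<eta> < (p - 1) * pi / 2" and c: "0 < c1" "c1 \<le> c2"
  shows "\<exists>C. herglotz_bound \<real>\<^sub>\<ge>\<^sub>0 p \<eta> c1 c2 C"
proof -
  from weighted_riesz[OF p \<eta>] obtain A where WR: "weighted_riesz_bound p \<eta> A" ..
  then have A: "A > 0" by (simp add: weighted_riesz_bound_def)
  define s where "s = 2 - 4 * \<eta> / pi"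
  \<comment> \<open>For p at most 2 the Riesz condition implies \<eta> < pi / 4, which is exactly
    \<open>s > 1\<close>, the summability of the kernel.\<close>
  have "(p - 1) * pi \<le> p / 2 * pi" using p by (intro mult_right_mono) auto
  then have "p * \<eta> < p * (pi / 4)" using \<eta> by linarith
  then have "\<eta> < pi / 4" using p by simp
  then have s: "s > 1" "s \<le> 2" using \<eta> by (auto simp: s_def field_simps)
  from cdist_kernel_sum[OF s(1)] obtain Z where Z: "Z > 0"
    "\<And>N j. j < N \<Longrightarrow> (\<Sum>k<N. (1 + real (cdist N j k)) powr (-s)) \<le> Z" by metis
  define T where "T = 1 + 2 * (4 * pi) / c1"
  define H where "H = T ^ 2 * T powr (4 * \<eta> / pi)"
  define M where "M = 4 * c2 * (3 / c1 + 2)\<^sup>2 * (1 + 2 / c1) powr (4 * \<eta> / pi)"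
  define C where "C = H powr p * A * (M * Z) powr p"
  have T1: "T \<ge> 1" using c by (auto simp: T_def)
  have HT: "H \<ge> T powr (4 * \<eta> / pi)" using T1 unfolding H_def
    by (intro mult_right_mono[of 1 "T^2", simplified]) (auto simp: one_le_power)
  have H0: "H > 0" using T1 by (simp add: H_def)
  have "3 / c1 + 2 > 0" "1 + 2 / c1 > 0" using c by (auto intro!: add_nonneg_pos add_pos_nonneg)
  then have M0: "M > 0" unfolding M_def using c by (intro mult_pos_pos) auto
  have C: "C > 0" unfolding C_def using H0 A M0 Z(1) by (intro mult_pos_pos) auto
  have main: "(\<Sum>k<N. (norm (exp (L (of_real r * y k))) * norm (\<Sum>j<N. of_real (b j) / (1 - of_real (r\<^sup>2) * (y k / x j)))) powr p)
      \<le> C * (\<Sum>j<N. (real N * b j * norm (exp (L (of_real r * x j)))) powr p)"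
    if N: "N > 0" and r: "0 < r" "r < 1" and r1: "c1 \<le> real N * (1 - r)" and r2: "real N * (1 - r) \<le> c2"
      and x: "node_family N x" and y: "node_family N y" and L: "L holomorphic_on ball 0 1"
      and Li: "\<And>z. norm z < 1 \<Longrightarrow> \<bar>Im (L z)\<bar> < \<eta>" and b: "\<And>j. j < N \<Longrightarrow> 0 \<le> b j"
    for N r x y L b
  proof (cases "\<forall>j<N. b j = 0")
    \<comment> \<open>With all coefficients zero \<open>F\<close> vanishes, whereas Riesz's bound
      asks for a strictly positive real part.\<close>
    case True
    then show ?thesis by simp
  next
    case False
    then obtain j0 where j0: "j0 < N" "b j0 > 0" using b by force
    have nx: "norm (x j) = 1" if "j < N" for j using x that by (rule node_family_norm)
    have ny: "norm (y j) = 1" if "j < N" for j using y that by (rule node_family_norm)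
    define F where "F z = (\<Sum>j<N. of_real (b j) * ((1 + of_real r * z / x j) / (1 - of_real r * z / x j)))" for z
    have w1: "norm (of_real r * z / x j) < 1" if "norm z < 1" "j < N" for z j
    proof -
      have "r * norm z < 1 * 1" using r that by (intro mult_strict_mono) auto
      then show ?thesis using nx[OF that(2)] r by (simp add: norm_mult norm_divide)
    qed
    have wn: "1 - of_real r * z / x j \<noteq> 0" if "norm z < 1" "j < N" for z j
      using w1[OF that] by auto
    have hF: "F holomorphic_on ball 0 1" unfolding F_def
      using wn nx by (intro holomorphic_intros) force+
    have kpos: "Re ((1 + of_real r * z / x j) / (1 - of_real r * z / x j)) > 0" if "norm z < 1" "j < N" for z j
    proof -
      have "(norm (of_real r * z / x j))\<^sup>2 < 1" using w1[OF that] by (simp add: power_less_one_iff abs_square_less_1)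
      then show ?thesis unfolding poisson_identity[OF w1[OF that]] using wn[OF that] by simp
    qed
    have ReF: "Re (F z) = (\<Sum>j<N. b j * Re ((1 + of_real r * z / x j) / (1 - of_real r * z / x j)))" for z
    proof -
      have "Re (of_real c * w) = c * Re w" for c w by simp
      then show ?thesis unfolding F_def Re_sum by presburger
    qed
    have pF: "Re (F z) > 0" if "norm z < 1" for z unfolding ReF
      using j0 b kpos[OF that] by (intro sum_pos2[where i = j0] mult_nonneg_nonneg) (auto intro: less_imp_le)
    have F0: "F 0 = of_real (\<Sum>j<N. b j)" by (simp add: F_def)
    let ?z = "\<lambda>t. of_real r * cis t :: complex"
    define E where "E t = norm (exp (L (?z t)))" for t
    define g1 where "g1 t = norm (F (?z t) * exp (L (?z t))) powr p + norm (F 0) powr p * E t powr p" for t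
    define g3 where "g3 t = (Re (F (?z t)) * E t) powr p" for t
    have nz: "norm (?z t) < 1" for t using r by (simp add: norm_mult)
    have rng: "(\<lambda>t. ?z t) ` {0..2*pi} \<subseteq> ball 0 1" using nz by auto
    have cz: "continuous_on {0..2*pi} ?z" by (intro continuous_intros)
    have cF: "continuous_on {0..2*pi} (\<lambda>t. F (?z t))"
      using continuous_on_compose2[OF holomorphic_on_imp_continuous_on[OF hF] cz rng] .
    have cL: "continuous_on {0..2*pi} (\<lambda>t. L (?z t))"
      using continuous_on_compose2[OF holomorphic_on_imp_continuous_on[OF L] cz rng] .
    have Fnz: "F (?z t) \<noteq> 0" for t using pF[OF nz[of t]] by auto
    have c1': "continuous_on {0..2*pi} (\<lambda>t. norm (F (?z t) * exp (L (?z t))) powr p)"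
      using Fnz by (intro continuous_intros cF cL) auto
    have c2': "continuous_on {0..2*pi} (\<lambda>t. E t powr p)"
      unfolding E_def by (intro continuous_intros cL) auto
    have cg1: "continuous_on {0..2*pi} g1" unfolding g1_def by (intro continuous_intros c1' c2')
    have cg3: "continuous_on {0..2*pi} g3" unfolding g3_def E_def using pF[OF nz]
      by (intro continuous_intros cF cL) (auto simp: less_imp_neq[symmetric])
    have int: "integral {0..2*pi} g1 \<le> A * integral {0..2*pi} g3"
    proof -
      have "integral {0..2*pi} g1 = integral {0..2*pi} (\<lambda>t. norm (F (?z t) * exp (L (?z t))) powr p)
         + norm (F 0) powr p * integral {0..2*pi} (\<lambda>t. E t powr p)"
        unfolding g1_def by (subst integral_add)
          (auto intro!: integrable_continuous_real c1' c2' continuous_intros)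
      also have "\<dots> \<le> A * integral {0..2*pi} g3" unfolding g3_def E_def
        using WR hF pF L r Li unfolding weighted_riesz_bound_def
        by (elim conjE allE[of _ F] allE[of _ L] allE[of _ r]) (simp add: F0 less_imp_le)
      finally show ?thesis .
    qed
    define V where "V k = (norm (exp (L (of_real r * y k))) * norm (\<Sum>j<N. of_real (b j) / (1 - of_real (r\<^sup>2) * (y k / x j)))) powr p" for k
    \<comment> \<open>A node and a point of its arc differ by at most two grid steps, 4 pi / N,
      which is a bounded multiple of 1 - r. Harnack thus costs \<open>T ^ 2\<close> for
      \<open>F\<close> and \<open>T powr (4 * \<eta> / pi)\<close> for the weight; \<open>H\<close>
      collects both.\<close>
    have V: "V k \<le> H powr p * g1 (2*pi*(real k + s)/real N)" if k: "k < N" "0 \<le> s" "s \<le> 1" for k s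
    proof -
      define t where "t = 2*pi*(real k + s)/real N"
      obtain e where e: "\<bar>e\<bar> \<le> 1" "y k = cis (2 * pi * (real k + e) / real N)"
        using y k by (auto simp: node_family_def)
      have "norm (y k - cis t) \<le> \<bar>2 * pi * (real k + e) / real N - t\<bar>" unfolding e by (rule norm_cis_diff_le)
      also have "\<dots> = 2 * pi * \<bar>e - s\<bar> / real N" using N by (simp add: t_def abs_mult flip: diff_divide_distrib right_diff_distrib)
      also have "\<dots> \<le> 2 * pi * 2 / real N" using e k by (intro divide_right_mono mult_left_mono) auto
      finally have d: "norm (y k - cis t) \<le> 4 * pi / N" by simp
      have "2 * norm (y k - cis t) / (1 - r) \<le> 2 * (4 * pi / N) / (1 - r)"
        using d r by (intro divide_right_mono) auto
      also have "\<dots> = 2 * (4 * pi) / (real N * (1 - r))" by simp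
      also have "\<dots> \<le> 2 * (4 * pi) / c1" using r1 c by (intro divide_left_mono) auto
      finally have TT: "1 + 2 * norm (y k - cis t) / (1 - r) \<le> T" by (simp add: T_def)
      have T0: "0 \<le> 1 + 2 * norm (y k - cis t) / (1 - r)" using r by (intro add_nonneg_nonneg) auto
      let ?F = "norm (F (of_real r * y k))" and ?E = "norm (exp (L (of_real r * y k)))"
      have "?F \<le> norm (F (?z t)) * (1 + 2 * norm (y k - cis t) / (1 - r)) ^ 2"
        using ny k r by (intro harnack_circle hF pF) auto
      also have "\<dots> \<le> norm (F (?z t)) * T ^ 2" using TT T0 by (intro mult_left_mono power_mono) auto
      finally have hF1: "?F \<le> norm (F (?z t)) * T ^ 2" .
      have "?E \<le> E t * (1 + 2 * norm (y k - cis t) / (1 - r)) powr (4 * \<eta> / pi)"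
        unfolding E_def using ny k r by (intro exp_harnack_circle L Li) auto
      also have "\<dots> \<le> E t * T powr (4 * \<eta> / pi)" using TT T0 \<eta> by (intro mult_left_mono powr_mono2) (auto simp: E_def)
      finally have hE1: "?E \<le> E t * T powr (4 * \<eta> / pi)" .
      have E0: "E t \<ge> 0" by (simp add: E_def)
      have EF: "?E * ?F \<le> H * norm (F (?z t) * exp (L (?z t)))"
      proof -
        have "?E * ?F \<le> (E t * T powr (4 * \<eta> / pi)) * (norm (F (?z t)) * T ^ 2)"
          using hF1 hE1 E0 by (intro mult_mono) auto
        then show ?thesis by (simp add: H_def E_def norm_mult mult_ac)
      qed
      have EF0: "?E * norm (F 0) \<le> H * (norm (F 0) * E t)"
      proof -
        have "?E * norm (F 0) \<le> (E t * H) * norm (F 0)"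
          using hE1 mult_left_mono[OF HT E0] by (intro mult_right_mono) auto
        then show ?thesis by (simp add: mult_ac)
      qed
      \<comment> \<open>1 / (1 - w) is the average of the Herglotz kernel (1 + w) / (1 - w) and
        1.\<close>
      have seq: "(\<Sum>j<N. of_real (b j) / (1 - of_real (r\<^sup>2) * (y k / x j))) = (F (of_real r * y k) + F 0) / 2"
      proof -
        have "of_real (b j) / (1 - of_real (r\<^sup>2) * (y k / x j))
           = (of_real (b j) * ((1 + of_real r * (of_real r * y k) / x j) / (1 - of_real r * (of_real r * y k) / x j)) + of_real (b j)) / 2"
          if "j < N" for j
        proof -
          have "norm (of_real r * y k) < 1" using ny k r by (simp add: norm_mult)
          note nz = wn[OF this that]
          have *: "B / (1 - w) = (B * ((1 + w) / (1 - w)) + B) / 2" if "1 - w \<noteq> 0" for B w :: complex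
            using that by (simp add: divide_simps) (simp add: algebra_simps)
          have eq: "of_real (r\<^sup>2) * (y k / x j) = of_real r * (of_real r * y k) / x j"
            by (simp add: power2_eq_square)
          show ?thesis unfolding eq by (rule *[OF nz])
        qed
        then show ?thesis
          unfolding F_def F0 of_real_sum sum.distrib[symmetric] sum_divide_distrib by (intro sum.cong) auto
      qed
      have "norm (\<Sum>j<N. of_real (b j) / (1 - of_real (r\<^sup>2) * (y k / x j))) \<le> (?F + norm (F 0)) / 2"
        unfolding seq using norm_triangle_ineq[of "F (of_real r * y k)" "F 0"] by (simp add: norm_divide)
      also have "\<dots> \<le> max ?F (norm (F 0))" by simp
      finally have "V k \<le> (?E * max ?F (norm (F 0))) powr p" unfolding V_def using p
        by (intro powr_mono2 mult_left_mono) auto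
      also have "\<dots> \<le> (?E * ?F) powr p + (?E * norm (F 0)) powr p"
        by (auto simp: max_def)
      also have "\<dots> \<le> (H * norm (F (?z t) * exp (L (?z t)))) powr p + (H * (norm (F 0) * E t)) powr p"
        using EF EF0 p by (intro add_mono powr_mono2) auto
      also have "\<dots> = H powr p * g1 t" using H0 E0 by (simp add: g1_def powr_mult algebra_simps)
      finally show ?thesis unfolding t_def .
    qed
    define \<beta> where "\<beta> j = real N * b j * norm (exp (L (of_real r * x j)))" for j
    define U where "U k = (\<Sum>j<N. (M * (1 + real (cdist N j k)) powr (-s)) * \<beta> j) powr p" for k
    have U: "g3 (2*pi*(real k + \<sigma>)/real N) \<le> U k" if k: "k < N" "0 \<le> \<sigma>" "\<sigma> \<le> 1" for k \<sigma>
    proof -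
      define t where "t = 2*pi*(real k + \<sigma>)/real N"
      have termle: "b j * Re ((1 + of_real r * ?z t / x j) / (1 - of_real r * ?z t / x j)) * E t
        \<le> (M * (1 + real (cdist N j k)) powr (-s)) * \<beta> j" if j: "j < N" for j
      proof -
        define D where "D = real N * norm (cis t - x j)"
        have D0: "D \<ge> 0" by (simp add: D_def)
        obtain e where e: "\<bar>e\<bar> \<le> 1" "x j = cis (2 * pi * (real j + e) / real N)"
          using x j by (auto simp: node_family_def)
        have "4 * (real (cdist N j k) - 2) \<le> real N * norm (x j - cis t)"
          unfolding t_def e(2) using e k j by (intro cdist_le_norm) auto
        also have "real N * norm (x j - cis t) = D" by (simp add: D_def norm_minus_commute)
        finally have cd: "1 + real (cdist N j k) \<le> 3 + D" using D0 by argo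
        define u where "u = cis t / x j"
        have u: "norm u = 1" using nx[OF j] by (simp add: u_def norm_divide)
        have R: "0 \<le> r\<^sup>2" "r\<^sup>2 < 1" using r by (auto simp: power_less_one_iff abs_square_less_1)
        define q where "q = norm (1 - of_real (r\<^sup>2) * u)"
        have rr: "1 - r \<le> 1 - r\<^sup>2" using r by (auto simp: power2_eq_square mult_left_le_one_le)
        then have Nr: "c1 \<le> real N * (1 - r\<^sup>2)" using r1 mult_left_mono[OF rr, of "real N"] by linarith
        have "1 - r\<^sup>2 \<le> q" unfolding q_def by (rule norm_one_minus_scaled_ge(1)[OF R u])
        then have q0: "q > 0" using R(2) by linarith
        have D: "3 + D \<le> (3 / c1 + 2) * (real N * q)"
          unfolding D_def q_def u_def using scaled_distance_lower[OF c(1) R Nr nx[OF j], of "cis t"] by simp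
        have wu: "of_real r * ?z t / x j = of_real (r\<^sup>2) * u" by (simp add: u_def power2_eq_square)
        \<comment> \<open>The numerator 1 - r^4 is at most 4 (1 - r), hence of order 1/N; the
          denominator is at least a constant times ((3 + D) / N)^2. So the kernel has height N and
          decays quadratically.\<close>
        have P: "Re ((1 + of_real r * ?z t / x j) / (1 - of_real r * ?z t / x j)) \<le> 4 * c2 * (3 / c1 + 2)\<^sup>2 * real N * (3 + D) powr (-2)"
        proof -
          have "Re ((1 + of_real r * ?z t / x j) / (1 - of_real r * ?z t / x j)) = (1 - (r\<^sup>2)\<^sup>2) / q\<^sup>2"
            unfolding poisson_identity[OF w1[OF nz j]] unfolding wu using u R by (simp add: q_def norm_mult norm_power)
          also have "\<dots> \<le> (4 * (1 - r)) / q\<^sup>2"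
          proof (intro divide_right_mono)
            have "(1 - (r\<^sup>2)\<^sup>2) = (1 - r) * ((1 + r) * (1 + r\<^sup>2))" by (simp add: algebra_simps power2_eq_square)
            also have "\<dots> \<le> (1 - r) * (2 * 2)" using r R by (intro mult_left_mono mult_mono) auto
            finally show "(1 - (r\<^sup>2)\<^sup>2) \<le> (4 * (1 - r))" by simp
          qed auto
          also have "\<dots> = 4 * (real N * (1 - r)) * real N / (real N * q)\<^sup>2"
            using N q0 by (simp add: field_simps power2_eq_square)
          also have "\<dots> \<le> 4 * c2 * real N / ((3 + D) / (3 / c1 + 2))\<^sup>2"
          proof (intro frac_le mult_right_mono mult_left_mono power_mono)
            show "(3 + D) / (3 / c1 + 2) \<le> real N * q"
              using D \<open>3 / c1 + 2 > 0\<close> by (simp add: divide_le_eq mult.commute)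
          qed (use r2 D0 c \<open>3 / c1 + 2 > 0\<close> in auto)
          also have "\<dots> = 4 * c2 * (3 / c1 + 2)\<^sup>2 * real N * (3 + D) powr (-2)"
          proof -
            have "(3 + D) powr (-2) = 1 / (3 + D)\<^sup>2" using D0 by (simp add: powr_minus_divide)
            then show ?thesis unfolding power_divide by simp
          qed
          finally show ?thesis .
        qed
        have E: "E t \<le> norm (exp (L (of_real r * x j))) * ((1 + 2 / c1) powr (4 * \<eta> / pi) * (3 + D) powr (4 * \<eta> / pi))"
        proof -
          have "E t \<le> norm (exp (L (of_real r * x j))) * (1 + 2 * norm (cis t - x j) / (1 - r)) powr (4 * \<eta> / pi)"
            unfolding E_def using nx j r by (intro exp_harnack_circle L Li) auto
          also have "\<dots> \<le> norm (exp (L (of_real r * x j))) * ((1 + 2 / c1) * (3 + D)) powr (4 * \<eta> / pi)"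
          proof (intro mult_left_mono powr_mono2)
            have "2 * norm (cis t - x j) / (1 - r) = 2 * D / (real N * (1 - r))" using N by (simp add: D_def)
            also have "\<dots> \<le> 2 * D / c1" using r1 c D0 by (intro divide_left_mono) auto
            finally have "1 + 2 * norm (cis t - x j) / (1 - r) \<le> 1 + 2 * D / c1" by simp
            also have "\<dots> \<le> (1 + 2 / c1) * (3 + D)" using c D0 by (simp add: field_simps)
            finally show "1 + 2 * norm (cis t - x j) / (1 - r) \<le> (1 + 2 / c1) * (3 + D)" .
          qed (use r \<eta> in \<open>auto intro!: add_nonneg_nonneg\<close>)
          also have "((1 + 2 / c1) * (3 + D)) powr (4 * \<eta> / pi) = (1 + 2 / c1) powr (4 * \<eta> / pi) * (3 + D) powr (4 * \<eta> / pi)"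
            by (simp only: powr_mult)
          finally show ?thesis .
        qed
        have "b j * Re ((1 + of_real r * ?z t / x j) / (1 - of_real r * ?z t / x j)) * E t
          \<le> (b j * (4 * c2 * (3 / c1 + 2)\<^sup>2 * real N * (3 + D) powr (-2))) *
           (norm (exp (L (of_real r * x j))) * ((1 + 2 / c1) powr (4 * \<eta> / pi) * (3 + D) powr (4 * \<eta> / pi)))"
          using P E b[OF j] kpos[OF nz[of t] j] c D0
          by (intro mult_mono mult_left_mono) (auto simp: E_def intro!: mult_nonneg_nonneg intro: less_imp_le)
        also have "\<dots> = M * \<beta> j * ((3 + D) powr (-2) * (3 + D) powr (4 * \<eta> / pi))"
          unfolding M_def \<beta>_def by (simp add: mult_ac)
        also have "(3 + D) powr (-2) * (3 + D) powr (4 * \<eta> / pi) = (3 + D) powr (-s)"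
          by (subst powr_add[symmetric]) (simp add: s_def)
        also have "M * \<beta> j * (3 + D) powr (-s) \<le> M * \<beta> j * (1 + real (cdist N j k)) powr (-s)"
          using cd s M0 b[OF j] by (intro mult_left_mono powr_mono2') (auto simp: \<beta>_def intro!: mult_nonneg_nonneg)
        finally show ?thesis by (simp add: mult_ac)
      qed
      have "Re (F (?z t)) * E t \<le> (\<Sum>j<N. (M * (1 + real (cdist N j k)) powr (-s)) * \<beta> j)"
        unfolding ReF sum_distrib_right using termle by (intro sum_mono) auto
      moreover have "0 \<le> Re (F (?z t)) * E t" using pF[OF nz[of t]] by (simp add: E_def)
      ultimately show ?thesis unfolding g3_def U_def t_def[symmetric] using p by (intro powr_mono2) auto
    qed
    have \<beta>0: "\<beta> j \<ge> 0" if "j < N" for j using b[OF that] by (simp add: \<beta>_def)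
    have sumU: "(\<Sum>k<N. U k) \<le> (M * Z) powr p * (\<Sum>j<N. \<beta> j powr p)"
      unfolding U_def
    proof (rule schur_powr)
      have mz: "(\<Sum>k<N. M * (1 + real (cdist N j k)) powr (-s)) \<le> M * Z" if "j < N" for j
        using Z(2)[OF that] M0 by (simp add: sum_distrib_left[symmetric])
      then show "(\<Sum>j<N. M * (1 + real (cdist N j k)) powr (-s)) \<le> M * Z" if "k \<in> {..<N}" for k
        using mz[of k] that by (subst cdist_sym) auto
      show "(\<Sum>k<N. M * (1 + real (cdist N j k)) powr (-s)) \<le> M * Z" if "j \<in> {..<N}" for j
        using mz that by auto
    qed (use p M0 Z(1) \<beta>0 in auto)
    have "(2 * pi / N) * (\<Sum>k<N. V k) \<le> integral {0..2*pi} (\<lambda>t. H powr p * g1 t)"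
      using V cg1 N by (intro sum_le_integral_arcs continuous_intros) auto
    also have "\<dots> = H powr p * integral {0..2*pi} g1" by simp
    also have "\<dots> \<le> H powr p * (A * integral {0..2*pi} g3)" using int by (intro mult_left_mono) auto
    also have "\<dots> \<le> H powr p * (A * ((2 * pi / N) * (\<Sum>k<N. U k)))"
      using A U cg3 N by (intro mult_left_mono integral_arcs_le_sum) auto
    also have "\<dots> \<le> H powr p * (A * ((2 * pi / N) * ((M * Z) powr p * (\<Sum>j<N. \<beta> j powr p))))"
      using A sumU by (intro mult_left_mono) auto
    also have "\<dots> = (2 * pi / N) * (C * (\<Sum>j<N. \<beta> j powr p))" by (simp add: C_def mult_ac)
    finally have "(\<Sum>k<N. V k) \<le> C * (\<Sum>j<N. \<beta> j powr p)" using N by (subst (asm) mult_le_cancel_left_pos) auto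
    then show ?thesis by (simp add: V_def \<beta>_def)
  qed
  have "herglotz_bound \<real>\<^sub>\<ge>\<^sub>0 p \<eta> c1 c2 C"
    unfolding herglotz_bound_def
  proof (intro conjI allI impI C)
    fix N r x y L and b :: "nat \<Rightarrow> complex"
    assume hyp: "N > 0" "0 < r" "r < 1" "c1 \<le> real N * (1 - r)" "real N * (1 - r) \<le> c2"
      "node_family N x" "node_family N y" "L holomorphic_on ball 0 1"
      "\<forall>z. norm z < 1 \<longrightarrow> \<bar>Im (L z)\<bar> < \<eta>" "\<forall>j<N. b j \<in> \<real>\<^sub>\<ge>\<^sub>0"
    have b: "b j = of_real (Re (b j)) \<and> 0 \<le> Re (b j) \<and> norm (b j) = Re (b j)" if "j < N" for j
      using hyp(10) that by (auto simp: complex_nonneg_Reals_iff complex_eq_iff cmod_eq_Re)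
    have "(\<Sum>j<N. of_real (Re (b j)) / (1 - of_real (r\<^sup>2) * (y k / x j)))
       = (\<Sum>j<N. b j / (1 - of_real (r\<^sup>2) * (y k / x j)))" for k
      by (intro sum.cong refl) (use b in \<open>metis lessThan_iff\<close>)
    moreover have "(\<Sum>j<N. (real N * Re (b j) * norm (exp (L (of_real r * x j)))) powr p)
       = (\<Sum>j<N. (real N * norm (b j) * norm (exp (L (of_real r * x j)))) powr p)"
      using b by (intro sum.cong refl) auto
    ultimately show "(\<Sum>k<N. (norm (exp (L (of_real r * y k))) * norm (\<Sum>j<N. b j / (1 - of_real (r\<^sup>2) * (y k / x j)))) powr p)
      \<le> C * (\<Sum>j<N. (real N * norm (b j) * norm (exp (L (of_real r * x j)))) powr p)"
      using main[OF hyp(1-8), of "\<lambda>j. Re (b j)"] hyp(9) b by simp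
  qed
  then show ?thesis ..
qed

text \<open>Each coefficient is split into the positive and negative parts of its real and imaginary
  parts. The four pieces cost \<open>4 powr (p - 1)\<close> through the power mean, and 4 because
  each is dominated by the modulus.\<close>

lemma herglotz_bound_complex:
  fixes p \<eta> c1 c2 :: real
  assumes p: "1 < p" "p \<le> 2" and \<eta>: "0 \<le> \<eta>" "p * \<eta> < (p - 1) * pi / 2" and c: "0 < c1" "c1 \<le> c2"
  shows "\<exists>C. herglotz_bound UNIV p \<eta> c1 c2 C"
proof -
  from herglotz_bound_nonneg[OF assms] obtain C where HC: "herglotz_bound \<real>\<^sub>\<ge>\<^sub>0 p \<eta> c1 c2 C" ..
  then have C: "C > 0" by (simp add: herglotz_bound_def)
  define C' where "C' = 4 powr (p - 1) * (4 * C)"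
  have C': "C' > 0" using C by (simp add: C'_def)
  have main: "(\<Sum>k<N. (norm (exp (L (of_real r * y k))) * norm (\<Sum>j<N. b j / (1 - of_real (r\<^sup>2) * (y k / x j)))) powr p)
      \<le> C' * (\<Sum>j<N. (real N * norm (b j) * norm (exp (L (of_real r * x j)))) powr p)"
    if hyp: "N > 0" "0 < r" "r < 1" "c1 \<le> real N * (1 - r)" "real N * (1 - r) \<le> c2"
      "node_family N x" "node_family N y" "L holomorphic_on ball 0 1" "\<And>z. norm z < 1 \<Longrightarrow> \<bar>Im (L z)\<bar> < \<eta>"
    for N r x y L and b :: "nat \<Rightarrow> complex"
  proof -
    define B :: "nat \<Rightarrow> nat \<Rightarrow> real" where "B i j = (if i = 0 then max 0 (Re (b j)) else if i = 1 then max 0 (- Re (b j))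
       else if i = 2 then max 0 (Im (b j)) else max 0 (- Im (b j)))" for i j
    define I :: "nat set" where "I = {0,1,2,3}"
    define u :: "nat \<Rightarrow> complex" where "u i = (if i = 0 then 1 else if i = 1 then -1 else if i = 2 then \<i> else -\<i>)" for i
    have B: "0 \<le> B i j" "B i j \<le> norm (b j)" for i j
      using abs_Re_le_cmod[of "b j"] abs_Im_le_cmod[of "b j"] by (auto simp: B_def)
    have bB: "b j = (\<Sum>i\<in>I. u i * of_real (B i j))" for j
      by (auto simp: I_def u_def B_def complex_eq_iff max_def)
    have u: "norm (u i) = 1" for i by (simp add: u_def)
    define K where "K k j = 1 - of_real (r\<^sup>2) * (y k / x j)" for k j
    define E where "E k = norm (exp (L (of_real r * y k)))" for k
    have pt: "(E k * norm (\<Sum>j<N. b j / K k j)) powr p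
      \<le> 4 powr (p - 1) * (\<Sum>i\<in>I. (E k * norm (\<Sum>j<N. of_real (B i j) / K k j)) powr p)" for k
    proof -
      have "(\<Sum>j<N. b j / K k j) = (\<Sum>i\<in>I. u i * (\<Sum>j<N. of_real (B i j) / K k j))"
        unfolding bB sum_divide_distrib sum_distrib_left by (subst sum.swap) simp
      then have "norm (\<Sum>j<N. b j / K k j) \<le> (\<Sum>i\<in>I. norm (u i * (\<Sum>j<N. of_real (B i j) / K k j)))"
        by (simp only: norm_sum)
      then have "E k * norm (\<Sum>j<N. b j / K k j) \<le> E k * (\<Sum>i\<in>I. norm (\<Sum>j<N. of_real (B i j) / K k j))"
        by (intro mult_left_mono) (auto simp: norm_mult u E_def)
      then have "(E k * norm (\<Sum>j<N. b j / K k j)) powr p \<le> (\<Sum>i\<in>I. E k * norm (\<Sum>j<N. of_real (B i j) / K k j)) powr p"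
        using p unfolding sum_distrib_left by (intro powr_mono2) (auto simp: E_def)
      also have "\<dots> \<le> real (card I) powr (p - 1) * (\<Sum>i\<in>I. (E k * norm (\<Sum>j<N. of_real (B i j) / K k j)) powr p)"
        by (intro power_mean_sum p) (auto simp: E_def I_def)
      also have "card I = 4" by (simp add: I_def)
      finally show ?thesis by simp
    qed
    have "(\<Sum>k<N. (E k * norm (\<Sum>j<N. b j / K k j)) powr p)
      \<le> (\<Sum>k<N. 4 powr (p - 1) * (\<Sum>i\<in>I. (E k * norm (\<Sum>j<N. of_real (B i j) / K k j)) powr p))"
      by (intro sum_mono pt)
    also have "\<dots> = 4 powr (p - 1) * (\<Sum>i\<in>I. \<Sum>k<N. (E k * norm (\<Sum>j<N. of_real (B i j) / K k j)) powr p)"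
      by (subst sum_distrib_left[symmetric], subst sum.swap) simp
    also have "\<dots> \<le> 4 powr (p - 1) * (\<Sum>i\<in>I. C * (\<Sum>j<N. (real N * norm (of_real (B i j) :: complex) * norm (exp (L (of_real r * x j)))) powr p))"
      unfolding E_def K_def using B by (intro mult_left_mono sum_mono herglotz_boundD[OF HC hyp]) (auto simp: complex_nonneg_Reals_iff)
    also have "\<dots> \<le> 4 powr (p - 1) * (\<Sum>i\<in>I. C * (\<Sum>j<N. (real N * norm (b j) * norm (exp (L (of_real r * x j)))) powr p))"
      using C B p by (intro mult_left_mono sum_mono powr_mono2 mult_right_mono) auto
    also have "\<dots> = C' * (\<Sum>j<N. (real N * norm (b j) * norm (exp (L (of_real r * x j)))) powr p)"
      by (simp add: C'_def I_def)
    finally show ?thesis by (simp add: E_def K_def)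
  qed
  have "herglotz_bound UNIV p \<eta> c1 c2 C'"
    unfolding herglotz_bound_def by (intro conjI allI impI C', rule main) auto
  then show ?thesis ..
qed

section \<open>Poisson integrals and polynomials\<close>

definition circle_mean :: "real \<Rightarrow> (complex \<Rightarrow> complex) \<Rightarrow> real \<Rightarrow> real" where
  "circle_mean p f R = integral {0..2*pi} (\<lambda>t. norm (f (of_real R * cis t)) powr p) / (2 * pi)"

text \<open>Normalized to total integral 2 pi. Writing the denominator with \<open>cnj a\<close>
  makes it the boundary value of a function analytic in the disc.\<close>

definition poisson :: "complex \<Rightarrow> real \<Rightarrow> real" where
  "poisson a t = (1 - (norm a)\<^sup>2) / (norm (1 - cnj a * cis t))\<^sup>2"

lemma one_minus_mult_nonzero:
  fixes a b :: "'a :: real_normed_field"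
  assumes "norm a < 1" "norm b \<le> 1" shows "1 - a * b \<noteq> 0"
proof -
  have "norm (a * b) \<le> norm a * 1" using assms by (simp add: norm_mult mult_left_le)
  then show ?thesis using assms by auto
qed

lemma poisson_nonneg: "norm a < 1 \<Longrightarrow> 0 \<le> poisson a t"
  unfolding poisson_def by (intro divide_nonneg_nonneg) (auto simp: abs_square_le_1 less_imp_le)

lemma poisson_sym: "poisson (of_real R * cis s) t = poisson (of_real R * cis t) s"
proof -
  have *: "1 - cnj (of_real R * cis s) * cis t = cnj (1 - cnj (of_real R * cis t) * cis s)"
    by (simp add: mult_ac)
  show ?thesis unfolding poisson_def * complex_mod_cnj by (simp only: norm_mult norm_cis)
qed

lemma continuous_on_poisson: "norm a < 1 \<Longrightarrow> continuous_on S (poisson a)"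
  unfolding poisson_def[abs_def] using one_minus_mult_nonzero[of "cnj a"]
  by (intro continuous_intros) auto

text \<open>Cauchy's formula for f(z) (1 - |a|^2) / (1 - cnj a z): this function agrees with
  \<open>f\<close> at \<open>a\<close>, and on the circle its extra factor turns the Cauchy kernel
  into the Poisson kernel.\<close>

lemma poisson_integral:
  assumes f: "f holomorphic_on cball 0 1" and a: "norm a < 1"
  shows "((\<lambda>t. f (cis t) * of_real (poisson a t)) has_integral 2 * of_real pi * f a) {0..2*pi}"
proof -
  define g where "g z = f z * of_real (1 - (norm a)\<^sup>2) / (1 - cnj a * z)" for z
  have nz: "1 - cnj a * z \<noteq> 0" if "norm z \<le> 1" for z using one_minus_mult_nonzero[of "cnj a" z] a that by simp
  have "g holomorphic_on cball 0 1" unfolding g_def using f nz by (intro holomorphic_intros) auto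
  then have "((\<lambda>u. g u / (u - a)) has_contour_integral (2 * of_real pi * \<i> * g a)) (circlepath 0 1)"
    using a by (intro Cauchy_integral_circlepath_simple) auto
  then have "((\<lambda>t. g (cis t) / (cis t - a) * \<i> * cis t) has_integral (2 * of_real pi * \<i> * g a)) {0..2*pi}"
    unfolding circlepath_def by (subst (asm) has_contour_integral_part_circlepath_iff) auto
  then have "((\<lambda>t. (- \<i>) * (g (cis t) / (cis t - a) * \<i> * cis t)) has_integral
     (- \<i>) * (2 * of_real pi * \<i> * g a)) {0..2*pi}"
    by (rule has_integral_mult_right)
  moreover have "(- \<i>) * (g (cis t) / (cis t - a) * \<i> * cis t) = f (cis t) * of_real (poisson a t)" for t
  proof -
    have ne: "cis t - a \<noteq> 0" using a by auto
    have "(1 - cnj a * cis t) * (cis t - a) = cis t * of_real ((norm (1 - cnj a * cis t))\<^sup>2)"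
    proof -
      have "cis t * cnj (1 - cnj a * cis t) = cis t - a" by (simp add: algebra_simps cis_mult cis_cnj)
      then show ?thesis by (metis complex_norm_square mult.assoc mult.left_commute of_real_power)
    qed
    then have "f (cis t) * of_real (1 - (norm a)\<^sup>2) / ((1 - cnj a * cis t) * (cis t - a)) * cis t
      = f (cis t) * of_real (poisson a t)"
      by (simp add: poisson_def)
    then show ?thesis by (simp add: g_def mult_ac)
  qed
  moreover have "g a = f a"
  proof -
    have "1 - cnj a * a = of_real (1 - (norm a)\<^sup>2)" using complex_norm_square[of a] by (simp add: mult.commute)
    moreover have "of_real (1 - (norm a)\<^sup>2) \<noteq> (0::complex)" using nz[of a] a calculation by auto
    ultimately show ?thesis by (simp add: g_def)
  qed
  ultimately show ?thesis by (simp add: mult_ac)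
qed

lemma poisson_total: "norm a < 1 \<Longrightarrow> (poisson a has_integral 2 * pi) {0..2*pi}"
  using has_integral_linear[OF poisson_integral[of "\<lambda>_. 1" a] bounded_linear_Re] by (simp add: o_def)

text \<open>Subharmonicity of |f|^p: integrate the tangent inequality at \<open>m\<close>, the
  Poisson mean of |f|, against the Poisson kernel; the linear terms cancel and \<open>m\<close>
  dominates |f a|.\<close>

lemma poisson_jensen:
  assumes f: "f holomorphic_on cball 0 1" and a: "norm a < 1" and p: "1 < p"
  shows "2 * pi * norm (f a) powr p \<le> integral {0..2*pi} (\<lambda>t. norm (f (cis t)) powr p * poisson a t)"
proof -
  have cf: "continuous_on {0..2*pi} (\<lambda>t. f (cis t))"
    by (rule continuous_on_compose2[OF holomorphic_on_imp_continuous_on[OF f]]) (auto intro!: continuous_intros)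
  define m where "m = integral {0..2*pi} (\<lambda>t. norm (f (cis t)) * poisson a t) / (2 * pi)"
  have i1: "((\<lambda>t. norm (f (cis t)) * poisson a t) has_integral 2 * pi * m) {0..2*pi}"
    unfolding m_def using integrable_integral[OF integrable_continuous_real[OF continuous_on_mult[OF continuous_on_norm[OF cf] continuous_on_poisson[OF a]]]]
    by simp
  have m: "norm (f a) \<le> m"
  proof -
    have "norm (2 * of_real pi * f a) \<le> 2 * pi * m"
    proof (rule has_integral_norm_bound_integral_component[where k=1 and g = "\<lambda>t. norm (f (cis t)) * poisson a t", simplified, THEN order_trans])
    qed (use poisson_integral[OF f a] i1 poisson_nonneg[OF a] in \<open>auto simp: norm_mult integral_unique\<close>)
    then show ?thesis by (simp add: norm_mult)
  qed
  then have m0: "0 \<le> m" using norm_ge_zero order_trans by blast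
  have cp: "continuous_on {0..2*pi} (\<lambda>t. norm (f (cis t)) powr p)"
    using p by (intro continuous_on_powr' continuous_intros cf) auto
  have i2: "((\<lambda>t. norm (f (cis t)) powr p * poisson a t) has_integral
      integral {0..2*pi} (\<lambda>t. norm (f (cis t)) powr p * poisson a t)) {0..2*pi}"
    by (intro integrable_integral integrable_continuous_real continuous_intros cp continuous_on_poisson a)
  have h: "((\<lambda>t. (m powr p - p * m powr (p - 1) * m) * poisson a t + p * m powr (p - 1) * (norm (f (cis t)) * poisson a t))
     has_integral (m powr p - p * m powr (p - 1) * m) * (2 * pi) + p * m powr (p - 1) * (2 * pi * m)) {0..2*pi}"
    by (intro has_integral_add has_integral_mult_right i1 poisson_total a)
  have pt: "(m powr p - p * m powr (p - 1) * m) * poisson a t + p * m powr (p - 1) * (norm (f (cis t)) * poisson a t)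
    \<le> norm (f (cis t)) powr p * poisson a t" for t
    using mult_right_mono[OF powr_tangent_le[OF p norm_ge_zero[of "f (cis t)"] m0] poisson_nonneg[OF a, of t]]
    by (simp add: algebra_simps)
  have "(m powr p - p * m powr (p - 1) * m) * (2 * pi) + p * m powr (p - 1) * (2 * pi * m)
     \<le> integral {0..2*pi} (\<lambda>t. norm (f (cis t)) powr p * poisson a t)"
    using has_integral_le[OF h i2] pt by blast
  then have "2 * pi * m powr p \<le> integral {0..2*pi} (\<lambda>t. norm (f (cis t)) powr p * poisson a t)"
    by (simp add: algebra_simps)
  moreover have "norm (f a) powr p \<le> m powr p" using m p by (intro powr_mono2) auto
  ultimately show ?thesis by (meson mult_left_mono order_trans pi_ge_zero mult_nonneg_nonneg zero_le_numeral)
qed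

text \<open>Integrate the pointwise Poisson bound over the inner circle. After exchanging the
  integrals, the symmetry of the kernel in its two angles lets the inner integral collapse to 2
  pi.\<close>

lemma circle_mean_mono_one:
  assumes f: "f holomorphic_on cball 0 1" and p: "1 < p" and R: "0 \<le> R" "R < 1"
  shows "circle_mean p f R \<le> circle_mean p f 1"
proof -
  have na: "norm (of_real R * cis s) < 1" for s using R by (simp add: norm_mult)
  have cf: "continuous_on S (\<lambda>t. norm (f (cis t)) powr p)" for S
    using p by (intro continuous_on_powr' continuous_intros
      continuous_on_compose2[OF holomorphic_on_imp_continuous_on[OF f]]) auto
  have cfR: "continuous_on S (\<lambda>t. norm (f (of_real R * cis t)) powr p)" for S
    using p by (intro continuous_on_powr' continuous_intros
      continuous_on_compose2[OF holomorphic_on_imp_continuous_on[OF f]])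
      (use na[THEN less_imp_le] in auto)
  define K where "K s t = norm (f (cis t)) powr p * poisson (of_real R * cis s) t" for s t
  have cK: "continuous_on UNIV (\<lambda>(s, t). K s t)"
  proof -
    have "continuous_on UNIV (\<lambda>x::real\<times>real. norm (f (cis (snd x))) powr p)"
      using continuous_on_compose2[OF cf[of UNIV] continuous_on_snd[OF continuous_on_id]] by simp
    moreover have "1 - cnj (of_real R * cis s) * cis t \<noteq> 0" for s t
      by (rule one_minus_mult_nonzero) (use na[of s] in \<open>simp_all only: complex_mod_cnj norm_cis order_refl\<close>)
    then have "continuous_on UNIV (\<lambda>x::real\<times>real. poisson (of_real R * cis (fst x)) (snd x))"
      unfolding poisson_def by (intro continuous_intros) auto
    ultimately show ?thesis unfolding K_def case_prod_beta by (rule continuous_on_mult)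
  qed
  have cK1: "continuous_on S (K s)" for S s
    unfolding K_def by (intro continuous_on_mult cf continuous_on_poisson na)
  have "2 * pi * integral {0..2*pi} (\<lambda>s. norm (f (of_real R * cis s)) powr p)
     = integral {0..2*pi} (\<lambda>s. 2 * pi * norm (f (of_real R * cis s)) powr p)" by simp
  also have "\<dots> \<le> integral {0..2*pi} (\<lambda>s. integral {0..2*pi} (K s))"
  proof (rule integral_le)
    show "(\<lambda>s. integral {0..2*pi} (K s)) integrable_on {0..2*pi}"
      using integral_continuous_on_param[of "{0..2*pi}" 0 "2*pi" K] continuous_on_subset[OF cK]
      by (intro integrable_continuous_real) auto
    show "2 * pi * norm (f (of_real R * cis s)) powr p \<le> integral {0..2*pi} (K s)" for s
      unfolding K_def by (rule poisson_jensen[OF f na p])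
  qed (intro integrable_continuous_real continuous_intros cfR)
  also have "\<dots> = integral {0..2*pi} (\<lambda>t. integral {0..2*pi} (\<lambda>s. K s t))"
    using integral_swap_continuous[where f=K and a=0 and c=0 and b="2*pi" and d="2*pi"] continuous_on_subset[OF cK] by simp
  also have "\<dots> = integral {0..2*pi} (\<lambda>t. norm (f (cis t)) powr p * (2 * pi))"
  proof -
    have "K s t = norm (f (cis t)) powr p * poisson (of_real R * cis t) s" for s t
      unfolding K_def by (subst poisson_sym) (rule refl)
    moreover have "integral {0..2*pi} (poisson (of_real R * cis t)) = 2 * pi" for t
      by (rule integral_unique[OF poisson_total[OF na]])
    ultimately show ?thesis by simp
  qed
  also have "\<dots> = 2 * pi * integral {0..2*pi} (\<lambda>t. norm (f (cis t)) powr p)" by simp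
  finally show ?thesis unfolding circle_mean_def by (simp add: divide_right_mono)
qed

section \<open>Reversed polynomials and the lower estimate\<close>

text \<open>The function is z^n cnj (P (R / cnj z)), the reversed polynomial with conjugated and
  rescaled coefficients. It exchanges the circles of radius 1 and \<open>R\<close>, so bounds from
  an outer circle to an inner one become bounds in the opposite direction.\<close>

lemma reflected_poly:
  fixes P :: "complex poly"
  assumes "degree P \<le> n" and R: "0 < R"
  obtains f where "f holomorphic_on UNIV" "\<And>t. norm (f (cis t)) = norm (poly P (of_real R * cis t))"
    "\<And>t. norm (f (of_real R * cis t)) = R ^ n * norm (poly P (cis t))"
proof
  define f where "f z = (\<Sum>m\<le>n. cnj (coeff P m) * of_real R ^ m * z ^ (n - m))" for z :: complex
  show "f holomorphic_on UNIV" unfolding f_def by (intro holomorphic_intros)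
  have P: "poly P x = (\<Sum>m\<le>n. coeff P m * x ^ m)" for x
    unfolding poly_altdef using assms by (intro sum.mono_neutral_left) (auto simp: coeff_eq_0)
  have key: "f (of_real \<rho> * cis t) = (of_real \<rho> * cis t) ^ n * cnj (poly P (of_real (R / \<rho>) * cis t))" if \<rho>: "\<rho> > 0" for \<rho> t
  proof -
    have "cnj (coeff P m) * of_real R ^ m * (of_real \<rho> * cis t) ^ (n - m)
       = (of_real \<rho> * cis t) ^ n * cnj (coeff P m * (of_real (R / \<rho>) * cis t) ^ m)" if "m \<le> n" for m
    proof -
      have nz: "of_real \<rho> * cis t \<noteq> 0" using \<rho> by simp
      have "(of_real \<rho> * cis t) ^ n = (of_real \<rho> * cis t) ^ (n - m) * (of_real \<rho> * cis t) ^ m"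
        using that by (simp add: power_add[symmetric])
      moreover have "(of_real \<rho> * cis t) ^ m * (cnj (of_real (R / \<rho>) * cis t)) ^ m = of_real R ^ m"
      proof -
        have "(of_real \<rho> * cis t) * cnj (of_real (R / \<rho>) * cis t) = of_real R * (cis t * cnj (cis t))"
          using \<rho> by simp
        also have "cis t * cnj (cis t) = 1" by (simp add: cis_cnj cis_mult)
        finally show ?thesis by (metis power_mult_distrib mult.right_neutral)
      qed
      ultimately show ?thesis by (simp add: mult_ac)
    qed
    then show ?thesis unfolding f_def P cnj_sum sum_distrib_left by (intro sum.cong) auto
  qed
  show "norm (f (cis t)) = norm (poly P (of_real R * cis t))" for t
    using key[of 1 t] by (simp add: norm_mult norm_power)
  show "norm (f (of_real R * cis t)) = R ^ n * norm (poly P (cis t))" for t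
    using key[of R t] R by (simp add: norm_mult norm_power)
qed

text \<open>Monotonicity of the means, applied to the reversed polynomial. With \<open>R ^ n\<close>
  bounded below, the unit circle can be replaced by a slightly smaller one.\<close>

lemma circle_mean_one_le:
  fixes P :: "complex poly"
  assumes P: "degree P \<le> n" and p: "1 < p" and R: "0 < R" "R < 1"
  shows "(R ^ n) powr p * circle_mean p (poly P) 1 \<le> circle_mean p (poly P) R"
proof -
  obtain f where f: "f holomorphic_on UNIV" "\<And>t. norm (f (cis t)) = norm (poly P (of_real R * cis t))"
    "\<And>t. norm (f (of_real R * cis t)) = R ^ n * norm (poly P (cis t))" using reflected_poly[OF P R(1)] by metis
  have "circle_mean p f R \<le> circle_mean p f 1"
    using R by (intro circle_mean_mono_one p holomorphic_on_subset[OF f(1)]) auto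
  then show ?thesis using R unfolding circle_mean_def by (simp add: f powr_mult)
qed

lemma cdist_scaled_lower:
  assumes c: "0 < c1" and R: "0 \<le> R" "R < 1" and N: "c1 \<le> real N * (1 - R)" and jk: "j < N" "k < N"
    and E: "\<bar>e - e'\<bar> \<le> 2"
  shows "1 + real (cdist N j k) \<le> (3 / c1 + 2) * (real N * norm (1 - of_real R *
     (cis (2 * pi * (real k + e') / N) / cis (2 * pi * (real j + e) / N))))"
proof -
  let ?x = "cis (2 * pi * (real j + e) / N)" and ?y = "cis (2 * pi * (real k + e') / N)"
  have "4 * (real (cdist N j k) - 2) \<le> real N * norm (?x - ?y)" using jk E by (intro cdist_le_norm) auto
  also have "norm (?x - ?y) = norm (?y - ?x)" by (rule norm_minus_commute)
  finally have "4 * (real (cdist N j k) - 2) \<le> real N * norm (?y - ?x)" .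
  moreover have "0 \<le> real N * norm (?y - ?x)" by simp
  ultimately have "1 + real (cdist N j k) \<le> 3 + real N * norm (?y - ?x)" by argo
  also have "\<dots> \<le> (3 / c1 + 2) * (real N * norm (1 - of_real R * (?y / ?x)))"
    by (rule scaled_distance_lower) (use c R N in auto)
  finally show ?thesis .
qed

text \<open>The reversed polynomial sees a node as the interior point \<open>R * x j\<close> and has
  the values of \<open>P\<close> on the circle of radius \<open>R\<close> as boundary values.
  Subharmonicity bounds |P (x j)|^p by a Poisson average of width 1/N; the kernels of all nodes add
  up to at most a constant times \<open>N\<close>, as near any point at most boundedly many nodes
  lie within a grid step.\<close>

lemma sampling_bound:
  fixes p :: real
  assumes p: "1 < p"
  obtains C where "C > 0" "\<And>N x P. N > 0 \<Longrightarrow> node_family N x \<Longrightarrow> degree (P :: complex poly) < N \<Longrightarrow>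
     (\<Sum>j<N. norm (poly P (x j)) powr p) \<le> C * real N * circle_mean p (poly P) 1"
proof -
  obtain Z where Z: "Z > 0" "\<And>N j. j < N \<Longrightarrow> (\<Sum>k<N. (1 + real (cdist N j k)) powr (-2)) \<le> Z"
    using cdist_kernel_sum[of 2] by (metis one_less_numeral_iff semiring_norm(76))
  define C where "C = 64 * Z * 2 powr p"
  have "C > 0" using Z by (simp add: C_def)
  moreover have "(\<Sum>j<N. norm (poly P (x j)) powr p) \<le> C * real N * circle_mean p (poly P) 1"
    if N: "N > 0" and x: "node_family N x" and P: "degree P < N" for N x and P :: "complex poly"
  proof -
    define n where "n = N - 1"
    have dP: "degree P \<le> n" using P by (simp add: n_def)
    \<comment> \<open>Bernoulli's inequality gives \<open>R ^ N \<ge> 1 / 2\<close> for this radius,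
      whence the factor \<open>2 powr p\<close>; \<open>N * (1 - R) = 1 / 2\<close> gives the factor
      3 / (1/2) + 2 = 8 below, and its square 64.\<close>
    define R where "R = 1 - 1 / (2 * real N)"
    have R: "1/2 \<le> R" "R < 1" "0 < R" using N by (auto simp: R_def field_simps)
    have NR: "real N * (1 - R) = 1/2" using N by (simp add: R_def)
    have Rn: "1/2 \<le> R ^ n"
    proof -
      have "1 + real N * (- (1 / (2 * real N))) \<le> (1 + (- (1 / (2 * real N)))) ^ N"
        by (rule Bernoulli_inequality) (use N in \<open>auto simp: field_simps\<close>)
      then have "1/2 \<le> R ^ N" using N by (simp add: R_def)
      also have "\<dots> \<le> R ^ n" using R by (intro power_decreasing) (auto simp: n_def)
      finally show ?thesis .
    qed
    have nx: "norm (x j) = 1" if "j < N" for j using node_family_norm[OF x that] .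
    have na: "norm (of_real R * x j) < 1" if "j < N" for j using R nx[OF that] by (simp add: norm_mult)
    obtain f where f: "f holomorphic_on UNIV" "\<And>t. norm (f (cis t)) = norm (poly P (of_real R * cis t))"
      "\<And>t. norm (f (of_real R * cis t)) = R ^ n * norm (poly P (cis t))" using reflected_poly[OF dP R(3)] by metis
    have hf: "f holomorphic_on cball 0 1" by (rule holomorphic_on_subset[OF f(1)]) auto
    let ?g = "\<lambda>t. norm (poly P (of_real R * cis t)) powr p"
    have cg: "continuous_on {0..2*pi} ?g" using p by (intro continuous_on_powr' continuous_intros) auto
    have pt: "2 * pi * norm (poly P (x j)) powr p \<le> 2 powr p * integral {0..2*pi} (\<lambda>t. ?g t * poisson (of_real R * x j) t)"
      if j: "j < N" for j
    proof -
      obtain s where s: "x j = cis s" using x j by (auto simp: node_family_def)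
      have "2 * pi * norm (f (of_real R * x j)) powr p \<le> integral {0..2*pi} (\<lambda>t. norm (f (cis t)) powr p * poisson (of_real R * x j) t)"
        by (rule poisson_jensen[OF hf na[OF j] p])
      also have "\<dots> = integral {0..2*pi} (\<lambda>t. ?g t * poisson (of_real R * x j) t)" by (simp add: f)
      finally have 1: "2 * pi * (R ^ n * norm (poly P (x j))) powr p \<le> integral {0..2*pi} (\<lambda>t. ?g t * poisson (of_real R * x j) t)"
        by (simp add: s f)
      have "norm (poly P (x j)) \<le> 2 * (R ^ n * norm (poly P (x j)))"
        using mult_right_mono[OF Rn, of "norm (poly P (x j))"] by simp
      then have "norm (poly P (x j)) powr p \<le> (2 * (R ^ n * norm (poly P (x j)))) powr p" using p by (intro powr_mono2) auto
      also have "\<dots> = 2 powr p * (R ^ n * norm (poly P (x j))) powr p" using R by (subst powr_mult) auto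
      finally have "2 * pi * norm (poly P (x j)) powr p \<le> 2 * pi * (2 powr p * (R ^ n * norm (poly P (x j))) powr p)"
        by (intro mult_left_mono) auto
      also have "\<dots> = 2 powr p * (2 * pi * (R ^ n * norm (poly P (x j))) powr p)" by simp
      also have "\<dots> \<le> 2 powr p * integral {0..2*pi} (\<lambda>t. ?g t * poisson (of_real R * x j) t)"
        using 1 by (intro mult_left_mono) auto
      finally show ?thesis .
    qed
    have ker: "(\<Sum>j<N. poisson (of_real R * x j) t) \<le> 64 * Z * real N" if t: "t \<in> {0..2*pi}" for t
    proof -
      obtain k s where k: "k < N" "0 \<le> s" "s \<le> 1" "t = 2 * pi * (real k + s) / real N"
        using arc_index[of t N] t N by auto
      have "poisson (of_real R * x j) t \<le> 64 * real N * (1 + real (cdist N k j)) powr (-2)" if j: "j < N" for j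
      proof -
        obtain e where e: "\<bar>e\<bar> \<le> 1" "x j = cis (2 * pi * (real j + e) / N)" using x j by (auto simp: node_family_def)
        define q where "q = norm (1 - of_real R * (cis t / x j))"
        have "1 + real (cdist N j k) \<le> (3 / (1/2) + 2) * (real N * q)"
          unfolding q_def e(2) k(4) using R NR j k e by (intro cdist_scaled_lower) auto
        then have q: "1 + real (cdist N k j) \<le> 8 * (real N * q)" by (simp add: cdist_sym)
        have "cnj (of_real R * x j) * cis t = of_real R * (cis t / x j)"
          unfolding e(2) by (simp add: cis_cnj cis_divide cis_mult mult.assoc)
        then have "poisson (of_real R * x j) t = (1 - R\<^sup>2) / q\<^sup>2"
          using nx[OF j] R by (simp add: poisson_def q_def norm_mult)
        also have "\<dots> \<le> (1 / real N) / ((1 + real (cdist N k j)) / (8 * real N))\<^sup>2"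
        proof (intro frac_le power_mono)
          have "1 - R\<^sup>2 = (1 - R) * (1 + R)" by (simp add: power2_eq_square algebra_simps)
          also have "\<dots> \<le> (1 - R) * 2" using R by (intro mult_left_mono) auto
          also have "\<dots> = 1 / N" using N by (simp add: R_def)
          finally show "1 - R\<^sup>2 \<le> 1 / real N" .
          show "(1 + real (cdist N k j)) / (8 * real N) \<le> q" using q N by (simp add: divide_le_eq mult_ac)
        qed (use R N in \<open>auto simp: abs_square_le_1 intro!: zero_less_power divide_pos_pos\<close>)
        also have "\<dots> = 64 * real N * (1 + real (cdist N k j)) powr (-2)"
        proof -
          have "(1 + real (cdist N k j)) powr (-2) = 1 / (1 + real (cdist N k j))\<^sup>2"
            by (simp add: powr_minus_divide)
          then show ?thesis unfolding power_divide using N by (simp add: power2_eq_square)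
        qed
        finally show ?thesis .
      qed
      then have "(\<Sum>j<N. poisson (of_real R * x j) t) \<le> (\<Sum>j<N. 64 * real N * (1 + real (cdist N k j)) powr (-2))"
        by (intro sum_mono) auto
      also have "\<dots> = 64 * real N * (\<Sum>j<N. (1 + real (cdist N k j)) powr (-2))" by (simp add: sum_distrib_left)
      also have "\<dots> \<le> 64 * real N * Z" using Z(2)[OF k(1)] by (intro mult_left_mono) auto
      finally show ?thesis by (simp add: mult_ac)
    qed
    have cont: "continuous_on {0..2*pi} (\<lambda>t. ?g t * poisson (of_real R * x j) t)" if "j < N" for j
      by (intro continuous_intros cg continuous_on_poisson na that)
    have intle: "integral {0..2*pi} (\<lambda>t. \<Sum>j<N. ?g t * poisson (of_real R * x j) t)
       \<le> integral {0..2*pi} (\<lambda>t. ?g t * (64 * Z * real N))"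
    proof (rule integral_le)
      show "(\<lambda>t. \<Sum>j<N. ?g t * poisson (of_real R * x j) t) integrable_on {0..2*pi}"
        using cont by (intro integrable_continuous_real continuous_on_sum) auto
      show "(\<lambda>t. ?g t * (64 * Z * real N)) integrable_on {0..2*pi}"
        by (intro integrable_continuous_real continuous_on_mult continuous_on_const cg)
      show "(\<Sum>j<N. ?g t * poisson (of_real R * x j) t) \<le> ?g t * (64 * Z * real N)" if "t \<in> {0..2*pi}" for t
        unfolding sum_distrib_left[symmetric] using that by (intro mult_left_mono ker) auto
    qed
    have "2 * pi * (\<Sum>j<N. norm (poly P (x j)) powr p)
      \<le> (\<Sum>j<N. 2 powr p * integral {0..2*pi} (\<lambda>t. ?g t * poisson (of_real R * x j) t))"
      unfolding sum_distrib_left using pt by (intro sum_mono) auto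
    also have "\<dots> = 2 powr p * integral {0..2*pi} (\<lambda>t. \<Sum>j<N. ?g t * poisson (of_real R * x j) t)"
      using cont by (subst integral_sum) (auto intro!: integrable_continuous_real simp: sum_distrib_left)
    also have "\<dots> \<le> 2 powr p * integral {0..2*pi} (\<lambda>t. ?g t * (64 * Z * real N))"
      using intle by (intro mult_left_mono) auto
    also have "\<dots> = C * real N * (2 * pi) * circle_mean p (poly P) R"
      by (simp add: C_def circle_mean_def)
    also have "\<dots> \<le> C * real N * (2 * pi) * circle_mean p (poly P) 1"
      using R p \<open>C > 0\<close> by (intro mult_left_mono circle_mean_mono_one holomorphic_intros) auto
    finally show ?thesis by (simp add: mult_ac)
  qed
  ultimately show ?thesis using that by blast
qed

section \<open>The generating function of the nodes\<close>

definition node_prod :: "nat \<Rightarrow> (nat \<Rightarrow> complex) \<Rightarrow> complex \<Rightarrow> complex" where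
  "node_prod N x z = (\<Prod>j<N. 1 - z / x j)"

text \<open>For W = \<open>node_prod N x\<close> this is - x_j W'(x_j), the normalizing constant of
  the Lagrange basis.\<close>

definition node_coeff :: "nat \<Rightarrow> (nat \<Rightarrow> complex) \<Rightarrow> nat \<Rightarrow> complex" where
  "node_coeff N x j = (\<Prod>i\<in>{..<N} - {j}. 1 - x j / x i)"

lemma node_prod_split: "j < N \<Longrightarrow> node_prod N x z = (1 - z / x j) * (\<Prod>i\<in>{..<N} - {j}. 1 - z / x i)"
  unfolding node_prod_def by (subst prod.remove[of _ j]) auto

definition node_poly :: "nat \<Rightarrow> (nat \<Rightarrow> complex) \<Rightarrow> nat \<Rightarrow> complex poly" where
  "node_poly N x j = (\<Prod>i\<in>{..<N} - {j}. [:1, - (1 / x i):])"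

lemma poly_node_poly: "poly (node_poly N x j) u = (\<Prod>i\<in>{..<N} - {j}. 1 - u / x i)"
  by (simp add: node_poly_def poly_prod)

lemma degree_node_poly:
  assumes "j < N" shows "degree (node_poly N x j) < N"
proof -
  have "degree (node_poly N x j) \<le> (\<Sum>i\<in>{..<N} - {j}. degree [:1, - (1 / x i):])"
    unfolding node_poly_def using degree_prod_sum_le[of "{..<N} - {j}" "\<lambda>i. [:1, - (1 / x i):]"] by (simp add: o_def)
  also have "\<dots> \<le> (\<Sum>i\<in>{..<N} - {j}. 1)" by (intro sum_mono) auto
  also have "\<dots> = N - 1" using assms by simp
  finally show ?thesis using assms by simp
qed

lemma node_coeff_nonzero:
  assumes inj: "inj_on x {..<N}" and nz: "\<And>j. j < N \<Longrightarrow> x j \<noteq> 0" and j: "j < N"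
  shows "node_coeff N x j \<noteq> 0"
proof -
  have "x i \<noteq> x j" if "i < N" "i \<noteq> j" for i using inj that j by (auto dest: inj_onD)
  then show ?thesis using nz j unfolding node_coeff_def by (auto simp: field_simps)
qed

lemma lagrange_interpolation:
  fixes P :: "complex poly"
  assumes inj: "inj_on x {..<N}" and nz: "\<And>j. j < N \<Longrightarrow> x j \<noteq> 0" and P: "degree P < N"
  shows "poly P u = (\<Sum>j<N. poly P (x j) / node_coeff N x j * (\<Prod>i\<in>{..<N} - {j}. 1 - u / x i))"
proof -
  define Q where "Q = (\<Sum>j<N. smult (poly P (x j) / node_coeff N x j) (node_poly N x j))"
  have dQ: "degree Q < N" unfolding Q_def
  proof (rule degree_sum_less)
    show "degree (smult (poly P (x j) / node_coeff N x j) (node_poly N x j)) < N" if "j \<in> {..<N}" for j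
      using le_less_trans[OF degree_smult_le degree_node_poly] that by blast
  qed (use P in simp)
  have cnz: "node_coeff N x j \<noteq> 0" if "j < N" for j
    using node_coeff_nonzero[OF inj nz that] .
  have "poly Q (x k) = poly P (x k)" if k: "k < N" for k
  proof -
    have "poly Q (x k) = (\<Sum>j<N. poly P (x j) / node_coeff N x j * poly (node_poly N x j) (x k))"
      by (simp add: Q_def poly_sum)
    also have "\<dots> = (\<Sum>j<N. if j = k then poly P (x k) else 0)"
    proof (intro sum.cong refl)
      fix j assume j: "j \<in> {..<N}"
      show "poly P (x j) / node_coeff N x j * poly (node_poly N x j) (x k) = (if j = k then poly P (x k) else 0)"
      proof (cases "j = k")
        case True
        have "poly (node_poly N x k) (x k) = node_coeff N x k" by (simp add: poly_node_poly node_coeff_def)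
        then show ?thesis using True cnz[OF k] by simp
      next
        case False
        then have "poly (node_poly N x j) (x k) = 0" unfolding poly_node_poly using k nz[OF k] by (auto intro!: prod_zero bexI[of _ k])
        then show ?thesis using False by simp
      qed
    qed
    also have "\<dots> = poly P (x k)" using k by simp
    finally show ?thesis .
  qed
  moreover have "card (x ` {..<N}) = N" using inj by (simp add: card_image)
  ultimately have "Q = P" using P dQ by (intro poly_eqI_degree[of "x ` {..<N}"]) auto
  have "poly P u = poly Q u" by (simp add: \<open>Q = P\<close>)
  then show ?thesis by (simp add: Q_def poly_sum poly_node_poly)
qed

text \<open>Inside the disc no factor 1 - u / x_j vanishes, so the whole product can be taken out.
  What is left is a sum of Cauchy kernels, to which the Herglotz bound applies.\<close>

lemma lagrange_interpolation_disc:
  fixes P :: "complex poly"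
  assumes inj: "inj_on x {..<N}" and nx: "\<And>j. j < N \<Longrightarrow> norm (x j) = 1" and P: "degree P < N" and u: "norm u < 1"
  shows "poly P u = node_prod N x u * (\<Sum>j<N. poly P (x j) / node_coeff N x j / (1 - u / x j))"
proof -
  have nz: "1 - u / x j \<noteq> 0" if "j < N" for j
    using one_minus_mult_nonzero[of u "1 / x j"] u nx[OF that] by (simp add: norm_divide)
  have *: "c * Q = d * Q * (c / d)" if "d \<noteq> 0" for c Q d :: complex using that by simp
  have "poly P (x j) / node_coeff N x j * (\<Prod>i\<in>{..<N} - {j}. 1 - u / x i)
     = node_prod N x u * (poly P (x j) / node_coeff N x j / (1 - u / x j))" if "j < N" for j
    unfolding node_prod_split[OF that] by (rule *[OF nz[OF that]])
  then show ?thesis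
    using nx by (subst lagrange_interpolation[OF inj _ P]) (force simp: sum_distrib_left)+
qed

section \<open>Roots of unity and their perturbation\<close>

definition unity :: "nat \<Rightarrow> nat \<Rightarrow> complex" where "unity N j = cis (2 * pi * real j / real N)"

lemma unity_power: "N > 0 \<Longrightarrow> unity N j ^ N = 1"
  unfolding unity_def Complex.DeMoivre by (simp add: cis_multiple_2pi)

lemma inj_on_unity: "inj_on (unity N) {..<N}"
  using bij_betw_imp_inj_on[OF Complex.bij_betw_roots_unity[of N]] unfolding unity_def[abs_def] by (cases "N = 0") auto

text \<open>Both sides have degree at most N and agree at the N roots of unity; the additional point
  0 settles the remaining constant.\<close>

lemma node_prod_unity:
  assumes N: "N > 0"
  shows "node_prod N (unity N) z = 1 - z ^ N"
proof -
  define A where "A = (\<Prod>j<N. [:1, - (1 / unity N j):])"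
  define B where "B = 1 - monom (1::complex) N"
  have dA: "degree A \<le> N"
  proof -
    have "degree A \<le> (\<Sum>j<N. degree [:1, - (1 / unity N j):])"
      unfolding A_def using degree_prod_sum_le[of "{..<N}" "\<lambda>j. [:1, - (1 / unity N j):]"] by (simp add: o_def)
    also have "\<dots> \<le> (\<Sum>j<N. 1)" by (intro sum_mono) auto
    finally show ?thesis by simp
  qed
  have dB: "degree B \<le> N" unfolding B_def by (intro degree_diff_le) (auto simp: degree_monom_le)
  have pA: "poly A u = node_prod N (unity N) u" for u by (simp add: A_def poly_prod node_prod_def)
  have pB: "poly B u = 1 - u ^ N" for u by (simp add: B_def poly_monom)
  have un: "unity N j \<noteq> 0" for j by (simp add: unity_def)
  have c: "card (insert 0 (unity N ` {..<N})) = Suc N"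
    using un[symmetric] by (subst card_insert_disjoint) (auto simp: card_image inj_on_unity)
  have "A = B"
  proof (rule poly_eqI_degree[of "insert 0 (unity N ` {..<N})"])
    fix u assume "u \<in> insert 0 (unity N ` {..<N})"
    then consider "u = 0" | j where "j < N" "u = unity N j" by auto
    then show "poly A u = poly B u"
    proof cases
      case 1 then show ?thesis using N by (simp add: pA pB node_prod_def)
    next
      case 2 then show ?thesis using un by (simp add: pA pB node_prod_split unity_power[OF N])
    qed
  qed (use dA dB c in auto)
  then show ?thesis using pA[of z] pB[of z] by simp
qed

text \<open>Each fraction is a finite geometric sum over the common denominator 1 - w^N, because the
  N-th power of a root of unity is 1. Orthogonality of characters leaves only the term k =
  0.\<close>

lemma sum_unity_fraction:
  assumes N: "N > 0" and w: "norm w < 1"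
  shows "(\<Sum>j<N. 1 / (1 - w / unity N j)) = of_nat N / (1 - w ^ N)"
proof -
  have wN: "1 - w ^ N \<noteq> 0"
  proof
    assume "1 - w ^ N = 0"
    then have "norm w ^ N = 1" by (metis eq_iff_diff_eq_0 norm_one norm_power)
    moreover have "norm w ^ N < 1" using w N by (simp add: power_less_one_iff)
    ultimately show False by simp
  qed
  have un: "unity N j \<noteq> 0" for j by (simp add: unity_def)
  have 1: "1 / (1 - w / unity N j) = (\<Sum>k<N. (w / unity N j) ^ k) / (1 - w ^ N)" for j
  proof -
    have nz: "1 - w / unity N j \<noteq> 0"
      using one_minus_mult_nonzero[of w "1 / unity N j"] w by (simp add: norm_divide unity_def)
    have "(1 - w / unity N j) * (\<Sum>k<N. (w / unity N j) ^ k) = 1 - (w / unity N j) ^ N"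
      by (simp add: one_diff_power_eq)
    also have "\<dots> = 1 - w ^ N" using unity_power[OF N] by (simp add: power_divide)
    finally show ?thesis using nz wN by (simp add: field_simps)
  qed
  have 2: "(\<Sum>j<N. (w / unity N j) ^ k) = (if k = 0 then of_nat N else 0)" if k: "k < N" for k
  proof (cases "k = 0")
    case False
    define \<zeta> where "\<zeta> = 1 / unity N k"
    have z1: "\<zeta> \<noteq> 1"
    proof
      assume "\<zeta> = 1"
      then have "unity N k = unity N 0" using un[of k] by (simp add: \<zeta>_def unity_def)
      then show False using inj_onD[OF inj_on_unity, of N k 0] k N False by auto
    qed
    have "(w / unity N j) ^ k = w ^ k * \<zeta> ^ j" for j
    proof -
      have "unity N j ^ k = unity N k ^ j" unfolding unity_def Complex.DeMoivre by (simp add: mult_ac)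
      then show ?thesis by (simp add: \<zeta>_def power_divide)
    qed
    then have "(\<Sum>j<N. (w / unity N j) ^ k) = w ^ k * (\<Sum>j<N. \<zeta> ^ j)" by (simp add: sum_distrib_left)
    also have "(\<Sum>j<N. \<zeta> ^ j) = 0" using z1 unity_power[OF N, of k]
      by (simp add: geometric_sum) (simp add: \<zeta>_def power_divide)
    finally show ?thesis using False by simp
  qed auto
  have "(\<Sum>j<N. 1 / (1 - w / unity N j)) = (\<Sum>j<N. \<Sum>k<N. (w / unity N j) ^ k) / (1 - w ^ N)"
    by (simp add: 1 sum_divide_distrib)
  also have "(\<Sum>j<N. \<Sum>k<N. (w / unity N j) ^ k) = (\<Sum>k<N. \<Sum>j<N. (w / unity N j) ^ k)" by (rule sum.swap)
  also have "\<dots> = (\<Sum>k<N. if k = 0 then of_nat N else 0)" by (intro sum.cong) (auto simp: 2)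
  also have "\<dots> = of_nat N" using N by simp
  finally show ?thesis .
qed

text \<open>A primitive, in the angle of a node, of half the Poisson kernel. The logarithm alone
  would contribute Re (w / (1 - w)), which changes sign; the summand t / 2 makes the derivative
  positive.\<close>

definition arg_primitive :: "complex \<Rightarrow> real \<Rightarrow> real" where
  "arg_primitive z t = Im (Ln (1 - z * cis (-t))) + t / 2"

lemma Re_one_minus_pos: "norm w < 1 \<Longrightarrow> Re (1 - w) > 0"
  using complex_Re_le_cmod[of w] by simp

lemma arg_primitive_deriv:
  assumes z: "norm z < 1"
  shows "(arg_primitive z has_real_derivative Re ((1 + z * cis (-t)) / (1 - z * cis (-t))) / 2) (at t)"
proof -
  define w where "w = z * cis (-t)"
  have w: "norm w < 1" using z by (simp add: w_def norm_mult)
  have nonneg: "1 - w \<notin> \<real>\<^sub>\<le>\<^sub>0" using Re_one_minus_pos[OF w] by (auto simp: complex_nonpos_Reals_iff)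
  have e: "exp (- (\<i> * of_real t)) = cis (-t)" by (simp add: cis_conv_exp)
  have "((\<lambda>s. Ln (1 - z * exp (- (\<i> * s)))) has_field_derivative (\<i> * w / (1 - w))) (at (of_real t))"
    using nonneg unfolding w_def
    by (auto intro!: derivative_eq_intros simp: e divide_inverse)
  then have "((\<lambda>s. Ln (1 - z * exp (- (\<i> * of_real s)))) has_vector_derivative (\<i> * w / (1 - w))) (at t)"
    by (rule has_vector_derivative_real_field)
  then have "((\<lambda>s. Im (Ln (1 - z * cis (-s)))) has_real_derivative Im (\<i> * w / (1 - w))) (at t)"
    by (intro has_field_derivative_Im) (simp add: cis_conv_exp)
  moreover have "((\<lambda>s. s / 2) has_real_derivative 1 / 2) (at t)" by (auto intro!: derivative_eq_intros)
  ultimately have "((\<lambda>s. Im (Ln (1 - z * cis (-s))) + s / 2) has_real_derivative (Im (\<i> * w / (1 - w)) + 1 / 2)) (at t)"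
    by (rule DERIV_add)
  moreover have "Im (\<i> * w / (1 - w)) + 1 / 2 = Re ((1 + w) / (1 - w)) / 2"
  proof -
    have "1 - w \<noteq> 0" using w by auto
    then have "(1 + w) / (1 - w) = w / (1 - w) + w / (1 - w) + 1" by (simp add: divide_simps)
    moreover have "Im (\<i> * w / (1 - w)) = Re (w / (1 - w))"
      by (metis Im_i_times times_divide_eq_right)
    ultimately show ?thesis by (simp only: plus_complex.sel one_complex.sel) simp
  qed
  ultimately show ?thesis unfolding arg_primitive_def[abs_def] w_def by simp
qed

lemma poisson_kernel_pos:
  assumes "norm w < 1" shows "0 < Re ((1 + w) / (1 - w))"
proof -
  have "(norm w)\<^sup>2 < 1" using assms by (simp add: abs_square_less_1)
  moreover have "1 - w \<noteq> 0" using assms by auto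
  ultimately show ?thesis unfolding poisson_identity[OF assms] by simp
qed

lemma arg_primitive_mono:
  assumes z: "norm z < 1" and st: "s \<le> t"
  shows "arg_primitive z s \<le> arg_primitive z t"
proof (rule DERIV_nonneg_imp_nondecreasing[OF st])
  fix u
  have "norm (z * cis (-u)) < 1" using z by (simp add: norm_mult)
  then show "\<exists>y. DERIV (arg_primitive z) u :> y \<and> 0 \<le> y"
    using arg_primitive_deriv[OF z, of u] poisson_kernel_pos by (intro exI conjI) (auto intro: less_imp_le)
qed

text \<open>When all nodes turn together, the derivative is half the sum of N equally spaced Poisson
  kernels. That sum is N times the Herglotz kernel of w^N, and |w^N| \<le> \<rho> makes it nearly
  equal to N.\<close>

lemma sum_arg_primitive_bound:
  assumes N: "N > 0" and z: "norm z < 1" and \<rho>: "norm z ^ N \<le> \<rho>" "\<rho> < 1" and a: "0 \<le> a" and ab: "a = s' - s"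
  shows "(\<Sum>j<N. arg_primitive z (2 * pi * real j / N + s') - arg_primitive z (2 * pi * real j / N + s))
     \<le> a * (real N / 2 * ((1 + \<rho>) / (1 - \<rho>)))"
proof -
  define G where "G u = (\<Sum>j<N. arg_primitive z (2 * pi * real j / N + u))" for u
  define K where "K = real N / 2 * ((1 + \<rho>) / (1 - \<rho>))"
  have der: "(G has_real_derivative (\<Sum>j<N. Re ((1 + z * cis (-(2 * pi * real j / N + u))) / (1 - z * cis (-(2 * pi * real j / N + u)))) / 2)) (at u)" for u
    unfolding G_def
  proof (rule DERIV_sum)
    fix j
    let ?c = "2 * pi * real j / N"
    have "((\<lambda>u. arg_primitive z (u + ?c)) has_real_derivative Re ((1 + z * cis (-(u + ?c))) / (1 - z * cis (-(u + ?c)))) / 2) (at u)"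
      by (subst DERIV_shift[symmetric]) (rule arg_primitive_deriv[OF z])
    then show "((\<lambda>u. arg_primitive z (?c + u)) has_real_derivative Re ((1 + z * cis (-(?c + u))) / (1 - z * cis (-(?c + u)))) / 2) (at u)"
      unfolding add.commute[of _ ?c] .
  qed
  have le: "(\<Sum>j<N. Re ((1 + z * cis (-(2 * pi * real j / N + u))) / (1 - z * cis (-(2 * pi * real j / N + u)))) / 2) \<le> K" for u
  proof -
    have reN: "Re (of_nat N * X) = real N * Re X" for X by simp
    have half: "S / 2 \<le> real N / 2 * X" if "S \<le> real N * X" for S X using that by simp
    define w where "w = z * cis (-u)"
    have w: "norm w < 1" "norm (w ^ N) \<le> \<rho>" using z \<rho> by (auto simp: w_def norm_mult norm_power)
    have e: "z * cis (-(2 * pi * real j / N + u)) = w / unity N j" for j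
      unfolding w_def unity_def times_divide_eq_right[symmetric] cis_divide
      by (rule arg_cong[where f = "\<lambda>t. z * cis t"]) simp
    have "(1 + w / unity N j) / (1 - w / unity N j) = 2 * (1 / (1 - w / unity N j)) - 1" for j
    proof -
      have "1 - w / unity N j \<noteq> 0"
        using one_minus_mult_nonzero[of w "1 / unity N j"] w by (simp add: norm_divide unity_def)
      then show ?thesis by (simp add: divide_simps)
    qed
    then have "(\<Sum>j<N. (1 + w / unity N j) / (1 - w / unity N j)) = 2 * (\<Sum>j<N. 1 / (1 - w / unity N j)) - of_nat N"
      by (simp add: sum_subtractf sum_distrib_left)
    also have "\<dots> = of_nat N * ((1 + w ^ N) / (1 - w ^ N))"
    proof -
      have "1 - w ^ N \<noteq> 0" using w \<rho> by auto
      then show ?thesis unfolding sum_unity_fraction[OF N w(1)] by (simp add: field_simps)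
    qed
    finally have "(\<Sum>j<N. Re ((1 + w / unity N j) / (1 - w / unity N j))) = real N * Re ((1 + w ^ N) / (1 - w ^ N))"
      unfolding Re_sum[symmetric] by (simp only: reN)
    also have "\<dots> \<le> real N * ((1 + \<rho>) / (1 - \<rho>))"
    proof (intro mult_left_mono)
      have "Re ((1 + w ^ N) / (1 - w ^ N)) \<le> norm (1 + w ^ N) / norm (1 - w ^ N)"
        by (metis complex_Re_le_cmod norm_divide)
      also have "\<dots> \<le> (1 + \<rho>) / (1 - \<rho>)"
      proof (intro frac_le)
        show "norm (1 + w ^ N) \<le> 1 + \<rho>" using norm_triangle_ineq[of 1 "w ^ N"] w by simp
        show "1 - \<rho> \<le> norm (1 - w ^ N)" using norm_triangle_ineq2[of 1 "w ^ N"] w by simp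
        show "0 \<le> 1 + \<rho>" using w(2) norm_ge_zero[of "w ^ N"] by linarith
      qed (use \<rho> in auto)
      finally show "Re ((1 + w ^ N) / (1 - w ^ N)) \<le> (1 + \<rho>) / (1 - \<rho>)" .
    qed auto
    finally show ?thesis unfolding e K_def sum_divide_distrib[symmetric] by (rule half)
  qed
  have "K * s - G s \<le> K * s' - G s'"
  proof (rule DERIV_nonneg_imp_nondecreasing[of s s' "\<lambda>u. K * u - G u"])
    show "s \<le> s'" using a ab by simp
    fix u
    show "\<exists>y. DERIV (\<lambda>u. K * u - G u) u :> y \<and> 0 \<le> y"
      using le[of u] by (intro exI[of _ "K - _"] conjI) (auto intro!: derivative_eq_intros der)
  qed
  then show ?thesis unfolding ab K_def[symmetric] G_def by (simp add: sum_subtractf algebra_simps)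
qed

text \<open>A logarithm of W / (1 - z^N) times a unimodular constant. The constant collects the
  summands t / 2 of \<open>arg_primitive\<close>, so that the imaginary part is exactly a sum of its
  increments; the modulus of the exponential is not affected.\<close>

definition node_log :: "nat \<Rightarrow> (nat \<Rightarrow> real) \<Rightarrow> complex \<Rightarrow> complex" where
  "node_log N \<epsilon> z = (\<Sum>j<N. Ln (1 - z * cis (- (2 * pi * real j / N + \<epsilon> j))) - Ln (1 - z * cis (- (2 * pi * real j / N))))
     + \<i> * of_real ((\<Sum>j<N. \<epsilon> j) / 2)"

lemma node_log_holomorphic: "node_log N \<epsilon> holomorphic_on ball 0 1"
proof -
  have "1 - z * cis t \<notin> \<real>\<^sub>\<le>\<^sub>0" if "norm z < 1" for z t
    using Re_one_minus_pos[of "z * cis t"] that by (auto simp: complex_nonpos_Reals_iff norm_mult)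
  then show ?thesis unfolding node_log_def[abs_def] by (intro holomorphic_intros) auto
qed

lemma norm_exp_node_log:
  assumes N: "N > 0" and z: "norm z < 1" and x: "\<And>j. j < N \<Longrightarrow> x j = cis (2 * pi * real j / N + \<epsilon> j)"
  shows "norm (exp (node_log N \<epsilon> z)) = norm (node_prod N x z) / norm (1 - z ^ N)"
proof -
  have nz: "1 - z * cis t \<noteq> 0" for t using one_minus_mult_nonzero[of z "cis t"] z by simp
  define T where "T j = 2 * pi * real j / real N" for j
  have eL: "exp (Ln (1 - z * cis a) - Ln (1 - z * cis b)) = (1 - z * cis a) / (1 - z * cis b)" for a b
    unfolding exp_diff exp_Ln[OF nz] ..
  have "exp (node_log N \<epsilon> z) = exp (\<Sum>j<N. Ln (1 - z * cis (- (T j + \<epsilon> j))) - Ln (1 - z * cis (- T j)))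
     * exp (\<i> * of_real ((\<Sum>j<N. \<epsilon> j) / 2))"
    unfolding node_log_def T_def by (rule exp_add)
  also have "exp (\<Sum>j<N. Ln (1 - z * cis (- (T j + \<epsilon> j))) - Ln (1 - z * cis (- T j)))
     = (\<Prod>j<N. exp (Ln (1 - z * cis (- (T j + \<epsilon> j))) - Ln (1 - z * cis (- T j))))"
    by (rule exp_sum) simp
  also have "\<dots> = (\<Prod>j<N. (1 - z / x j) / (1 - z / unity N j))"
  proof (rule prod.cong[OF refl])
    fix j assume "j \<in> {..<N}"
    then have "1 / x j = cis (- (T j + \<epsilon> j))" by (simp add: x T_def divide_inverse cis_inverse)
    moreover have "1 / unity N j = cis (- T j)" by (simp add: unity_def T_def divide_inverse cis_inverse)
    ultimately show "exp (Ln (1 - z * cis (- (T j + \<epsilon> j))) - Ln (1 - z * cis (- T j))) = (1 - z / x j) / (1 - z / unity N j)"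
      unfolding eL by (metis times_divide_eq_right mult.right_neutral)
  qed
  also have "\<dots> = node_prod N x z / (1 - z ^ N)"
    unfolding prod_dividef node_prod_unity[OF N, symmetric] by (simp add: node_prod_def)
  finally show ?thesis by (simp add: norm_mult norm_divide)
qed

text \<open>Every increment is monotone in its displacement, so the extreme case is that all nodes
  move in one direction by the maximal amount \<open>a\<close>. There the sum over equally spaced
  nodes is known, and \<open>a * N / 2 = pi * \<delta>\<close>.\<close>

lemma node_log_Im_bound:
  assumes N: "N > 0" and z: "norm z < 1" and \<rho>: "norm z ^ N \<le> \<rho>" "\<rho> < 1"
    and \<epsilon>: "\<And>j. j < N \<Longrightarrow> \<bar>\<epsilon> j\<bar> \<le> 2 * pi * \<delta> / N" and \<delta>: "0 \<le> \<delta>"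
  shows "\<bar>Im (node_log N \<epsilon> z)\<bar> \<le> pi * \<delta> * ((1 + \<rho>) / (1 - \<rho>))"
proof -
  let ?g = "arg_primitive z" and ?t = "\<lambda>j. 2 * pi * real j / real N"
  define a where "a = 2 * pi * \<delta> / N"
  have a: "a \<ge> 0" using \<delta> by (simp add: a_def)
  have Im: "Im (node_log N \<epsilon> z) = (\<Sum>j<N. ?g (?t j + \<epsilon> j) - ?g (?t j))"
  proof -
    have "Im (node_log N \<epsilon> z) = (\<Sum>j<N. Im (Ln (1 - z * cis (- (?t j + \<epsilon> j)))) - Im (Ln (1 - z * cis (- ?t j)))) + (\<Sum>j<N. \<epsilon> j / 2)"
      unfolding node_log_def by (simp add: sum_divide_distrib)
    also have "\<dots> = (\<Sum>j<N. ?g (?t j + \<epsilon> j) - ?g (?t j))"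
      unfolding sum.distrib[symmetric] by (intro sum.cong) (auto simp: arg_primitive_def add_divide_distrib)
    finally show ?thesis .
  qed
  have "a * (real N / 2 * X) = pi * \<delta> * X" for X
    using N by (simp add: a_def)
  then have val: "a * (real N / 2 * ((1 + \<rho>) / (1 - \<rho>))) = pi * \<delta> * ((1 + \<rho>) / (1 - \<rho>))" .
  have "(\<Sum>j<N. ?g (?t j + \<epsilon> j) - ?g (?t j)) \<le> (\<Sum>j<N. ?g (?t j + a) - ?g (?t j + 0))"
  proof (intro sum_mono)
    fix j assume "j \<in> {..<N}"
    then have "?g (?t j + \<epsilon> j) \<le> ?g (?t j + a)" using \<epsilon>[of j] by (intro arg_primitive_mono z) (auto simp: a_def)
    then show "?g (?t j + \<epsilon> j) - ?g (?t j) \<le> ?g (?t j + a) - ?g (?t j + 0)" by simp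
  qed
  also have "\<dots> \<le> a * (real N / 2 * ((1 + \<rho>) / (1 - \<rho>)))"
    by (intro sum_arg_primitive_bound N z \<rho> a) simp
  finally have 1: "Im (node_log N \<epsilon> z) \<le> pi * \<delta> * ((1 + \<rho>) / (1 - \<rho>))" using Im val by simp
  have "(\<Sum>j<N. ?g (?t j) - ?g (?t j + \<epsilon> j)) \<le> (\<Sum>j<N. ?g (?t j + 0) - ?g (?t j + (-a)))"
  proof (intro sum_mono)
    fix j assume "j \<in> {..<N}"
    then have "?g (?t j + (-a)) \<le> ?g (?t j + \<epsilon> j)" using \<epsilon>[of j] by (intro arg_primitive_mono z) (auto simp: a_def)
    then show "?g (?t j) - ?g (?t j + \<epsilon> j) \<le> ?g (?t j + 0) - ?g (?t j + (-a))" by simp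
  qed
  also have "\<dots> \<le> a * (real N / 2 * ((1 + \<rho>) / (1 - \<rho>)))"
    by (intro sum_arg_primitive_bound N z \<rho> a) simp
  finally have 2: "- Im (node_log N \<epsilon> z) \<le> pi * \<delta> * ((1 + \<rho>) / (1 - \<rho>))"
    using Im val by (simp add: sum_subtractf)
  from 1 2 show ?thesis by simp
qed

lemma norm_one_minus_scaled_sq:
  assumes u: "norm (u::complex) = 1"
  shows "(norm (1 - of_real R * u))\<^sup>2 = (1 - R)\<^sup>2 + R * (norm (1 - u))\<^sup>2"
proof -
  have "(Re u)\<^sup>2 + (Im u)\<^sup>2 = 1" using u by (metis cmod_power2 power_one)
  then show ?thesis unfolding cmod_power2 by (simp add: power2_eq_square algebra_simps) (simp add: algebra_simps flip: distrib_left)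
qed

text \<open>Factor by factor |1 - R u|^2 / |1 - u|^2 is at most 1 + (1 - R)^2 / |1 - u|^2, and the
  second term is a constant times the inverse square of one plus the cyclic distance. Hence the
  product of the quotients is bounded, and the factor of the node itself supplies 1 - R. Offsets of
  at most 1/4 keep different nodes apart: 4 (d - 1/2) \<ge> 1 + d for d \<ge> 1.\<close>

lemma node_prod_scaled_le:
  fixes c2 :: real
  assumes c2: "c2 > 0"
  obtains C where "C > 0"
    "\<And>N R x j. N > 0 \<Longrightarrow> 0 < R \<Longrightarrow> R < 1 \<Longrightarrow> real N * (1 - R) \<le> c2 \<Longrightarrow>
      (\<And>j. j < N \<Longrightarrow> \<exists>e. \<bar>e\<bar> \<le> 1/4 \<and> x j = cis (2 * pi * (real j + e) / N)) \<Longrightarrow> j < N \<Longrightarrow>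
      real N * norm (node_prod N x (of_real R * x j)) \<le> C * norm (node_coeff N x j)"
proof -
  obtain Z where Z: "Z > 0" "\<And>N j. j < N \<Longrightarrow> (\<Sum>k<N. (1 + real (cdist N j k)) powr (-2)) \<le> Z"
    using cdist_kernel_sum[of 2] by (metis one_less_numeral_iff semiring_norm(76))
  define C where "C = c2 * exp (c2\<^sup>2 * Z)"
  have "C > 0" using c2 by (simp add: C_def)
  moreover have "real N * norm (node_prod N x (of_real R * x j)) \<le> C * norm (node_coeff N x j)"
    if N: "N > 0" and R: "0 < R" "R < 1" and NR: "real N * (1 - R) \<le> c2"
      and x: "\<And>j. j < N \<Longrightarrow> \<exists>e. \<bar>e\<bar> \<le> 1/4 \<and> x j = cis (2 * pi * (real j + e) / N)" and j: "j < N"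
    for N R x j
  proof -
    have nx: "norm (x i) = 1" if "i < N" for i using x[OF that] by auto
    have fac: "norm (1 - of_real R * x j / x i) \<le> norm (1 - x j / x i) * exp (c2\<^sup>2 * (1 + real (cdist N j i)) powr (-2))"
      if i: "i < N" "i \<noteq> j" for i
    proof -
      obtain e e' where e: "\<bar>e\<bar> \<le> 1/4" "x j = cis (2 * pi * (real j + e) / N)" "\<bar>e'\<bar> \<le> 1/4" "x i = cis (2 * pi * (real i + e') / N)"
        using x[OF i(1)] x[OF j] by auto
      have "\<bar>e - e'\<bar> \<le> 1/2" using e by linarith
      then have "4 * (real (cdist N j i) - 1/2) \<le> real N * norm (x j - x i)"
        unfolding e(2,4) by (intro cdist_le_norm j i)
      moreover have "cdist N j i \<ge> 1" using i j by (auto simp: cdist_def Let_def)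
      then have "1 \<le> real (cdist N j i)" by simp
      ultimately have cd: "1 + real (cdist N j i) \<le> real N * norm (x j - x i)" by argo
      define u where "u = x j / x i"
      have u: "norm u = 1" using nx i j by (simp add: u_def norm_divide)
      have "x i \<noteq> 0" using nx[OF i(1)] by auto
      then have "1 - u = (x i - x j) / x i" by (simp add: u_def diff_divide_distrib)
      then have nu: "norm (1 - u) = norm (x j - x i)" using nx i by (simp add: norm_divide norm_minus_commute)
      define d where "d = norm (1 - u)"
      have d: "1 + real (cdist N j i) \<le> real N * d" using cd nu by (simp add: d_def)
      have d0: "d > 0"
      proof (rule ccontr)
        assume "\<not> d > 0"
        then have "real N * d \<le> 0" by (simp add: mult_nonneg_nonpos)
        with d show False by simp
      qed
      have "1 - R \<le> c2 / N" using NR N by (simp add: field_simps)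
      also have "\<dots> \<le> c2 * d * (1 / (1 + real (cdist N j i)))"
        using mult_left_mono[OF d, of c2] c2 N by (simp add: field_simps)
      finally have "1 - R \<le> c2 * d * (1 / (1 + real (cdist N j i)))" .
      then have "(1 - R)\<^sup>2 \<le> (c2 * d * (1 / (1 + real (cdist N j i))))\<^sup>2" using R by (intro power_mono) auto
      also have "\<dots> = d\<^sup>2 * (c2\<^sup>2 * (1 + real (cdist N j i)) powr (-2))"
        by (simp add: powr_minus_divide power_mult_distrib power_divide)
      finally have r1: "(1 - R)\<^sup>2 \<le> d\<^sup>2 * (c2\<^sup>2 * (1 + real (cdist N j i)) powr (-2))" .
      let ?k = "c2\<^sup>2 * (1 + real (cdist N j i)) powr (-2)"
      have "(norm (1 - of_real R * u))\<^sup>2 \<le> d\<^sup>2 * ?k + 1 * d\<^sup>2"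
        unfolding norm_one_minus_scaled_sq[OF u] d_def[symmetric] using r1 R by (intro add_mono mult_right_mono) auto
      also have "\<dots> = d\<^sup>2 * (1 + ?k)" by (simp add: algebra_simps)
      also have "\<dots> \<le> d\<^sup>2 * exp ?k" by (intro mult_left_mono exp_ge_add_one_self) auto
      also have "\<dots> \<le> d\<^sup>2 * (exp ?k)\<^sup>2" using c2
        by (intro mult_left_mono) (auto simp: power2_eq_square)
      also have "\<dots> = (d * exp ?k)\<^sup>2" by (simp add: power_mult_distrib)
      finally have "norm (1 - of_real R * u) \<le> d * exp ?k" by (rule power2_le_imp_le) (use d0 in auto)
      then show ?thesis by (simp add: u_def d_def)
    qed
    have "norm (\<Prod>i\<in>{..<N} - {j}. 1 - of_real R * x j / x i)
       \<le> (\<Prod>i\<in>{..<N} - {j}. norm (1 - x j / x i) * exp (c2\<^sup>2 * (1 + real (cdist N j i)) powr (-2)))"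
      unfolding prod_norm[symmetric] using fac by (intro prod_mono) auto
    also have "\<dots> = norm (node_coeff N x j) * exp (\<Sum>i\<in>{..<N} - {j}. c2\<^sup>2 * (1 + real (cdist N j i)) powr (-2))"
      by (simp add: prod.distrib exp_sum node_coeff_def prod_norm)
    also have "\<dots> \<le> norm (node_coeff N x j) * exp (c2\<^sup>2 * Z)"
    proof -
      have "(\<Sum>i\<in>{..<N} - {j}. c2\<^sup>2 * (1 + real (cdist N j i)) powr (-2)) \<le> (\<Sum>i<N. c2\<^sup>2 * (1 + real (cdist N j i)) powr (-2))"
        by (intro sum_mono2) auto
      also have "\<dots> = c2\<^sup>2 * (\<Sum>i<N. (1 + real (cdist N j i)) powr (-2))" by (simp add: sum_distrib_left)
      also have "\<dots> \<le> c2\<^sup>2 * Z" using Z(2)[OF j] by (intro mult_left_mono) auto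
      finally show ?thesis by (intro mult_left_mono) auto
    qed
    finally have pr: "norm (\<Prod>i\<in>{..<N} - {j}. 1 - of_real R * x j / x i) \<le> norm (node_coeff N x j) * exp (c2\<^sup>2 * Z)" .
    have "x j \<noteq> 0" using nx[OF j] by auto
    then have "1 - of_real R * x j / x j = of_real (1 - R)" by simp
    then have "norm (1 - of_real R * x j / x j) = 1 - R" using R by (simp only: norm_of_real)
    then have "norm (node_prod N x (of_real R * x j)) = (1 - R) * norm (\<Prod>i\<in>{..<N} - {j}. 1 - of_real R * x j / x i)"
      unfolding node_prod_split[OF j] norm_mult by (simp only:)
    then have "real N * norm (node_prod N x (of_real R * x j)) = (real N * (1 - R)) * norm (\<Prod>i\<in>{..<N} - {j}. 1 - of_real R * x j / x i)"
      by simp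
    also have "\<dots> \<le> c2 * (norm (node_coeff N x j) * exp (c2\<^sup>2 * Z))"
      using pr NR c2 by (intro mult_mono) auto
    finally show ?thesis by (simp add: C_def mult_ac)
  qed
  ultimately show ?thesis using that by blast
qed

section \<open>The upper estimate below the threshold\<close>

text \<open>The angular offsets are named explicitly because the logarithm of the weight depends on
  them and not only on the nodes.\<close>

definition perturbed_unity :: "nat \<Rightarrow> real \<Rightarrow> (nat \<Rightarrow> real) \<Rightarrow> (nat \<Rightarrow> complex) \<Rightarrow> bool" where
  "perturbed_unity N \<delta> \<epsilon> x \<longleftrightarrow>
     (\<forall>j<N. \<bar>\<epsilon> j\<bar> \<le> 2 * pi * \<delta> / real N \<and> x j = cis (2 * pi * real j / real N + \<epsilon> j))"

lemma perturbed_unity_offset: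
  assumes x: "perturbed_unity N \<delta> \<epsilon> x" and j: "j < N"
  shows "\<exists>e. \<bar>e\<bar> \<le> \<delta> \<and> x j = cis (2 * pi * (real j + e) / real N)"
proof (intro exI conjI)
  have N: "real N > 0" using j by simp
  have "\<bar>\<epsilon> j\<bar> \<le> 2 * pi * \<delta> / real N" using x j by (simp add: perturbed_unity_def)
  then show "\<bar>\<epsilon> j * real N / (2 * pi)\<bar> \<le> \<delta>" using N by (simp add: abs_mult field_simps)
  show "x j = cis (2 * pi * (real j + \<epsilon> j * real N / (2 * pi)) / real N)"
    using x j N by (simp add: perturbed_unity_def distrib_left add_divide_distrib)
qed

lemma perturbed_unity_family:
  assumes x: "perturbed_unity N \<delta> \<epsilon> x" and "\<delta> \<le> 1"
  shows "node_family N x"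
  unfolding node_family_def using perturbed_unity_offset[OF x] assms(2) by (meson order_trans)

lemma perturbed_unity_inj:
  assumes x: "perturbed_unity N \<delta> \<epsilon> x" and \<delta>: "\<delta> \<le> 1/4"
  shows "inj_on x {..<N}"
proof (rule inj_onI)
  fix i j assume ij: "i \<in> {..<N}" "j \<in> {..<N}" and eq: "x i = x j"
  show "i = j"
  proof (rule ccontr)
    assume "i \<noteq> j"
    then have "cdist N i j \<ge> 1" using ij by (auto simp: cdist_def Let_def)
    obtain e e' where e: "\<bar>e\<bar> \<le> \<delta>" "x i = cis (2 * pi * (real i + e) / N)" "\<bar>e'\<bar> \<le> \<delta>" "x j = cis (2 * pi * (real j + e') / N)"
      using perturbed_unity_offset[OF x] ij by (metis lessThan_iff)
    have "\<bar>e - e'\<bar> \<le> 1/2" using e \<delta> by linarith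
    then have "4 * (real (cdist N i j) - 1/2) \<le> real N * norm (x i - x j)"
      unfolding e(2,4) using ij by (intro cdist_le_norm) auto
    then show False using eq \<open>cdist N i j \<ge> 1\<close> by simp
  qed
qed

lemma root_radius:
  fixes \<rho> :: real
  assumes \<rho>: "0 < \<rho>" "\<rho> < 1" and N: "N > 0"
  obtains r where "0 < r" "r < 1" "r ^ N = \<rho>"
proof
  show "0 < \<rho> powr (1 / N)" using \<rho> by simp
  show "\<rho> powr (1 / N) < 1" using powr_less_mono2[of "1 / N" \<rho> 1] \<rho> N by simp
  show "(\<rho> powr (1 / N)) ^ N = \<rho>" using \<rho> N by (simp add: powr_realpow[symmetric] powr_powr)
qed

text \<open>When \<open>r ^ N\<close> is prescribed, N (1 - r) thus lies between positive constants
  that do not depend on N.\<close>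

lemma radius_bounds:
  assumes r: "0 < r" "r < 1" and N: "N > 0"
  shows "1 - r ^ N \<le> real N * (1 - r)" "real N * (1 - r) \<le> - ln (r ^ N)"
proof -
  show "1 - r ^ N \<le> real N * (1 - r)"
    using Bernoulli_inequality[of "r - 1" N] r by (simp add: algebra_simps)
  have "real N * (1 - r) \<le> real N * (- ln r)" using ln_le_minus_one[of r] r by (intro mult_left_mono) auto
  then show "real N * (1 - r) \<le> - ln (r ^ N)" using r by (simp add: ln_realpow)
qed

text \<open>Rescaling by \<open>r\<close> makes the bound on the imaginary part, available where
  |u|^N \<le> \<rho>, valid on the whole unit disc. At the points \<open>r * y\<close> the function
  sees radius \<open>r\<^sup>2\<close>, where |1 - u^N| lies between 1 - \<rho>^2 and 2, so |exp L|
  and |W| are comparable.\<close>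

lemma scaled_node_log:
  assumes x: "perturbed_unity N \<delta> \<epsilon> x" and \<delta>: "0 \<le> \<delta>" and N: "N > 0" and r: "0 < r" "r < 1"
    and \<eta>: "pi * \<delta> * ((1 + r ^ N) / (1 - r ^ N)) < \<eta>"
  defines "L \<equiv> \<lambda>z. node_log N \<epsilon> (of_real r * z)"
  shows "L holomorphic_on ball 0 1" "norm z < 1 \<Longrightarrow> \<bar>Im (L z)\<bar> < \<eta>"
    "norm y = 1 \<Longrightarrow> norm (node_prod N x (of_real (r\<^sup>2) * y)) \<le> 2 * norm (exp (L (of_real r * y)))"
    "norm y = 1 \<Longrightarrow> norm (exp (L (of_real r * y))) * (1 - (r ^ N)\<^sup>2) \<le> norm (node_prod N x (of_real (r\<^sup>2) * y))"
proof -
  have lt: "norm (of_real r * z) < 1" if "norm z < 1" for z :: complex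
  proof -
    have "r * norm z < 1 * 1" using r that by (intro mult_strict_mono) auto
    then show ?thesis using r by (simp add: norm_mult)
  qed
  show "L holomorphic_on ball 0 1"
  proof -
    have "(\<lambda>z. of_real r * z) holomorphic_on ball 0 1" by (intro holomorphic_intros)
    from holomorphic_on_compose_gen[OF this node_log_holomorphic] lt show ?thesis
      unfolding L_def by (auto simp: o_def image_subset_iff)
  qed
  show "\<bar>Im (L z)\<bar> < \<eta>" if z: "norm z < 1"
  proof -
    have "norm (of_real r * z) \<le> r" using r z by (simp add: norm_mult)
    then have "norm (of_real r * z) ^ N \<le> r ^ N" by (intro power_mono) auto
    moreover have "r ^ N < 1" using r N by (simp add: power_less_one_iff)
    ultimately have "\<bar>Im (L z)\<bar> \<le> pi * \<delta> * ((1 + r ^ N) / (1 - r ^ N))"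
      unfolding L_def using x \<delta> by (intro node_log_Im_bound N lt z) (auto simp: perturbed_unity_def)
    then show ?thesis using \<eta> by linarith
  qed
  have e: "norm (exp (L (of_real r * y))) * norm (1 - (of_real (r\<^sup>2) * y) ^ N) = norm (node_prod N x (of_real (r\<^sup>2) * y))"
    and m: "norm ((of_real (r\<^sup>2) * y) ^ N) = (r ^ N)\<^sup>2" "(r ^ N)\<^sup>2 < 1" if y: "norm y = 1" for y
  proof -
    have R: "r\<^sup>2 < 1" using r by (simp add: abs_square_less_1)
    have eq: "of_real r * (of_real r * y) = of_real (r\<^sup>2) * y" by (simp add: power2_eq_square)
    show m: "norm ((of_real (r\<^sup>2) * y) ^ N) = (r ^ N)\<^sup>2" using y r
      by (simp add: norm_mult norm_power power_mult[symmetric] mult.commute)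
    have "r ^ N < 1" using r N by (simp add: power_less_one_iff)
    then show m2: "(r ^ N)\<^sup>2 < 1" using r by (simp add: abs_square_less_1)
    have "1 - (of_real (r\<^sup>2) * y) ^ N \<noteq> 0" using m m2 by (metis eq_iff_diff_eq_0 norm_one order_less_irrefl)
    moreover have "norm (exp (node_log N \<epsilon> (of_real (r\<^sup>2) * y))) = norm (node_prod N x (of_real (r\<^sup>2) * y)) / norm (1 - (of_real (r\<^sup>2) * y) ^ N)"
      using x R y by (intro norm_exp_node_log N) (auto simp: perturbed_unity_def norm_mult norm_power)
    ultimately show "norm (exp (L (of_real r * y))) * norm (1 - (of_real (r\<^sup>2) * y) ^ N) = norm (node_prod N x (of_real (r\<^sup>2) * y))"
      unfolding L_def eq by (simp only: nonzero_eq_divide_eq norm_eq_zero not_False_eq_True)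
  qed
  show "norm (node_prod N x (of_real (r\<^sup>2) * y)) \<le> 2 * norm (exp (L (of_real r * y)))" if y: "norm y = 1"
  proof -
    have "norm (1 - (of_real (r\<^sup>2) * y) ^ N) \<le> 1 + (r ^ N)\<^sup>2"
      using norm_triangle_ineq4[of 1 "(of_real (r\<^sup>2) * y) ^ N"] m(1)[OF y] by simp
    also have "\<dots> \<le> 2" using m(2)[OF y] by simp
    finally have "norm (exp (L (of_real r * y))) * norm (1 - (of_real (r\<^sup>2) * y) ^ N) \<le> norm (exp (L (of_real r * y))) * 2"
      by (intro mult_left_mono) auto
    then show ?thesis unfolding e[OF y] by (simp only: mult.commute)
  qed
  show "norm (exp (L (of_real r * y))) * (1 - (r ^ N)\<^sup>2) \<le> norm (node_prod N x (of_real (r\<^sup>2) * y))" if y: "norm y = 1"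
  proof -
    have "1 - (r ^ N)\<^sup>2 \<le> norm (1 - (of_real (r\<^sup>2) * y) ^ N)"
      using norm_triangle_ineq2[of 1 "(of_real (r\<^sup>2) * y) ^ N"] m(1)[OF y] by simp
    then show ?thesis unfolding e[OF y, symmetric] by (intro mult_left_mono) auto
  qed
qed

lemma rotated_unity_family: "0 \<le> s \<Longrightarrow> s \<le> 1 \<Longrightarrow> node_family N (\<lambda>k. cis (2 * pi * (real k + s) / real N))"
  by (auto simp: node_family_def intro!: exI[of _ s])

text \<open>Young's inequality is applied with a parameter \<open>t\<close> chosen such that the
  \<gamma>-part contributes X / 2, which is moved to the left. This replaces Hoelder's inequality
  followed by division by a power of \<open>X\<close>, and thus needs no case distinction for X =
  0.\<close>

lemma young_absorb:
  fixes a \<gamma> :: "nat \<Rightarrow> real"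
  assumes p: "1 < p" and K: "0 < K1" "0 < K2" and a: "\<And>j. j < N \<Longrightarrow> 0 \<le> a j" and \<gamma>: "\<And>j. j < N \<Longrightarrow> 0 \<le> \<gamma> j"
    and X: "X \<le> K1 * (\<Sum>j<N. a j * \<gamma> j)" and Y: "(\<Sum>j<N. \<gamma> j powr (p / (p - 1))) \<le> K2 * X"
  shows "X \<le> 2 * K1 * (2 * K1 * K2) powr (p - 1) * (\<Sum>j<N. a j powr p)"
proof -
  define p' where "p' = p / (p - 1)"
  have p': "p' > 1" "1 / p + 1 / p' = 1" using p by (auto simp: p'_def field_simps)
  define t where "t = (2 * K1 * K2) powr (1 / p')"
  have t: "t > 0" using K by (simp add: t_def)
  have tp: "t powr p = (2 * K1 * K2) powr (p - 1)" using p by (simp add: t_def powr_powr p'_def)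
  have tp': "t powr p' = 2 * K1 * K2" using p' K by (simp add: t_def powr_powr)
  have pt: "a j * \<gamma> j \<le> t powr p * a j powr p + \<gamma> j powr p' / (2 * K1 * K2)" if j: "j < N" for j
  proof -
    have "a j * \<gamma> j = (t * a j) * (\<gamma> j / t)" using t by simp
    also have "\<dots> \<le> (t * a j) powr p / p + (\<gamma> j / t) powr p' / p'"
      using p p' a[OF j] \<gamma>[OF j] t by (intro Youngs_inequality) auto
    also have "\<dots> \<le> (t * a j) powr p + (\<gamma> j / t) powr p'"
      using p p' by (intro add_mono) (auto simp: divide_le_eq mult_left_mono[of 1, simplified] mult_le_cancel_left1)
    also have "\<dots> = t powr p * a j powr p + \<gamma> j powr p' / (2 * K1 * K2)"
      using t a[OF j] \<gamma>[OF j] by (simp add: powr_mult powr_divide tp')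
    finally show ?thesis .
  qed
  have "K1 * (\<Sum>j<N. a j * \<gamma> j) \<le> K1 * (\<Sum>j<N. t powr p * a j powr p + \<gamma> j powr p' / (2 * K1 * K2))"
    using pt K by (intro mult_left_mono sum_mono) auto
  also have "\<dots> = K1 * (t powr p * (\<Sum>j<N. a j powr p)) + (\<Sum>j<N. \<gamma> j powr p') / (2 * K2)"
    using K by (simp add: sum.distrib sum_distrib_left[symmetric] sum_divide_distrib[symmetric] distrib_left)
  also have "(\<Sum>j<N. \<gamma> j powr p') / (2 * K2) \<le> X / 2" using Y K by (simp add: p'_def field_simps)
  finally show ?thesis using X by (simp add: tp mult_ac)
qed

text \<open>A grid rotated by \<open>s\<close> stands in for the circle, with a constant uniform in
  \<open>s\<close>. Both sides are then finite sums over N points, and the estimate can be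
  transposed.\<close>

definition rotated_upper_bound :: "real \<Rightarrow> real \<Rightarrow> real \<Rightarrow> real \<Rightarrow> bool" where
  "rotated_upper_bound p \<delta> \<rho> K \<longleftrightarrow> K > 0 \<and> (\<forall>N \<epsilon> x (P :: complex poly) s r.
     N > 0 \<longrightarrow> perturbed_unity N \<delta> \<epsilon> x \<longrightarrow> degree P < N \<longrightarrow> 0 \<le> s \<longrightarrow> s \<le> 1 \<longrightarrow> 0 < r \<longrightarrow> r < 1 \<longrightarrow> r ^ N = \<rho> \<longrightarrow>
     (\<Sum>k<N. norm (poly P (of_real (r\<^sup>2) * cis (2 * pi * (real k + s) / real N))) powr p)
       \<le> K * (\<Sum>j<N. norm (poly P (x j)) powr p))"

text \<open>Riesz's inequality is used with the exponent \<open>p0\<close> below 2, whether it is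
  \<open>p\<close> or its conjugate. In the first case interpolation is estimated directly, in the
  second its adjoint is.\<close>

lemma rotated_upper_bound_exists:
  assumes p: "1 < p" and p0: "1 < p0" "p0 \<le> 2" "p0 = p \<or> p0 = p / (p - 1)"
    and \<delta>: "0 \<le> \<delta>" "\<delta> \<le> 1/4" and \<rho>: "0 < \<rho>" "\<rho> < 1"
    and \<eta>: "pi * \<delta> * ((1 + \<rho>) / (1 - \<rho>)) < \<eta>" "p0 * \<eta> < (p0 - 1) * pi / 2"
  shows "\<exists>K. rotated_upper_bound p \<delta> \<rho> K"
proof -
  define c1 c2 where "c1 = 1 - \<rho>" and "c2 = - ln \<rho>"
  have c: "0 < c1" "c1 \<le> c2" using \<rho> ln_le_minus_one[of \<rho>] by (auto simp: c1_def c2_def)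
  have "0 \<le> pi * \<delta> * ((1 + \<rho>) / (1 - \<rho>))" using \<delta> \<rho> by auto
  then have \<eta>0: "0 \<le> \<eta>" using \<eta> by linarith
  from herglotz_bound_complex[OF p0(1,2) \<eta>0 \<eta>(2) c] obtain C where HC: "herglotz_bound UNIV p0 \<eta> c1 c2 C" ..
  then have C: "C > 0" by (simp add: herglotz_bound_def)
  have c22: "2 * c2 > 0" using c by simp
  obtain D where D: "D > 0"
    "\<And>N R x j. N > 0 \<Longrightarrow> 0 < R \<Longrightarrow> R < 1 \<Longrightarrow> real N * (1 - R) \<le> 2 * c2 \<Longrightarrow>
      (\<And>j. j < N \<Longrightarrow> \<exists>e. \<bar>e\<bar> \<le> 1/4 \<and> x j = cis (2 * pi * (real j + e) / N)) \<Longrightarrow> j < N \<Longrightarrow>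
      real N * norm (node_prod N x (of_real R * x j)) \<le> D * norm (node_coeff N x j)"
    using node_prod_scaled_le[OF c22] by metis
  define K1 where "K1 = D / (1 - \<rho>\<^sup>2)"
  have r1: "1 - \<rho>\<^sup>2 > 0" using \<rho> by (simp add: abs_square_less_1)
  then have K1: "K1 > 0" using D by (simp add: K1_def)
  define K2 where "K2 = C * 2 powr p0"
  have K2: "K2 > 0" using C by (simp add: K2_def)
  define K where "K = (if p0 = p then K2 * K1 powr p else 2 * K1 * (2 * K1 * K2) powr (p - 1))"
  have K: "K > 0" using K1 K2 by (simp add: K_def)
  have "rotated_upper_bound p \<delta> \<rho> K"
    unfolding rotated_upper_bound_def
  proof (intro conjI allI impI K)
    fix N \<epsilon> x and s r :: real and P :: "complex poly"
    assume N: "N > 0" and x: "perturbed_unity N \<delta> \<epsilon> x" and P: "degree P < N" and s: "0 \<le> s" "s \<le> 1"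
      and r: "0 < r" "r < 1" and rN: "r ^ N = \<rho>"
    define y where "y k = cis (2 * pi * (real k + s) / real N)" for k
    define L where "L z = node_log N \<epsilon> (of_real r * z)" for z
    note nl = scaled_node_log[OF x \<delta>(1) N r, folded L_def, unfolded rN, OF \<eta>(1)]
    have fx: "node_family N x" using perturbed_unity_family[OF x] \<delta> by simp
    have fy: "node_family N y" unfolding y_def by (rule rotated_unity_family[OF s])
    have nx: "norm (x j) = 1" if "j < N" for j using node_family_norm[OF fx that] .
    have ny: "norm (y k) = 1" for k by (simp add: y_def)
    have R: "r\<^sup>2 < 1" "0 < r\<^sup>2" using r by (auto simp: abs_square_less_1)
    have Nr: "c1 \<le> real N * (1 - r)" "real N * (1 - r) \<le> c2" using radius_bounds[OF r N] by (auto simp: c1_def c2_def rN)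
    have NR: "real N * (1 - r\<^sup>2) \<le> 2 * c2"
    proof -
      have "real N * (1 - r\<^sup>2) = (real N * (1 - r)) * (1 + r)" by (simp add: power2_eq_square algebra_simps)
      also have "\<dots> \<le> c2 * 2" using Nr r c by (intro mult_mono) auto
      finally show ?thesis by simp
    qed
    have off: "\<exists>e. \<bar>e\<bar> \<le> 1/4 \<and> x j = cis (2 * pi * (real j + e) / N)" if "j < N" for j
      using perturbed_unity_offset[OF x that] \<delta> by (meson order_trans)
    define W where "W k = node_prod N x (of_real (r\<^sup>2) * y k)" for k
    define v where "v k = poly P (of_real (r\<^sup>2) * y k)" for k
    define E where "E z = norm (exp (L (of_real r * z)))" for z
    define E' where "E' z = norm (exp (- L (of_real r * z)))" for z
    have EE: "E z * E' z = 1" for z by (simp only: E_def E'_def norm_mult[symmetric] exp_minus_inverse norm_one)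
    have E0: "E z > 0" "E' z > 0" for z by (simp_all add: E_def E'_def)
    have WE: "norm (W k) \<le> 2 * E (y k)" for k
      using nl(3)[OF ny[of k]] unfolding W_def E_def .
    have vk: "v k = W k * (\<Sum>j<N. poly P (x j) / node_coeff N x j / (1 - of_real (r\<^sup>2) * (y k / x j)))" for k
    proof -
      have "norm (of_real (r\<^sup>2) * y k) < 1" using R ny by (simp add: norm_mult norm_power)
      then show ?thesis unfolding v_def W_def times_divide_eq_right
        by (intro lagrange_interpolation_disc perturbed_unity_inj[OF x \<delta>(2)] nx P)
    qed
    \<comment> \<open>The Lagrange constant of a node is at least comparable to N |W| at the
      rescaled node, and |W| there is comparable to the weight. So the factor \<open>N\<close> and
      the weight on the right of the Herglotz bound cancel against the Lagrange constant.\<close>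
    have Dj: "real N * E (x j) / norm (node_coeff N x j) \<le> K1" if j: "j < N" for j
    proof -
      have "real N * (E (x j) * (1 - \<rho>\<^sup>2)) \<le> real N * norm (node_prod N x (of_real (r\<^sup>2) * x j))"
        using nl(4)[OF nx[OF j]] unfolding E_def by (intro mult_left_mono) auto
      also have "\<dots> \<le> D * norm (node_coeff N x j)" by (rule D(2)[OF N R(2,1) NR off j])
      finally have "real N * E (x j) \<le> K1 * norm (node_coeff N x j)"
        using r1 by (simp add: K1_def field_simps)
      then show ?thesis using K1 by (cases "node_coeff N x j = 0") (auto simp: divide_le_eq)
    qed
    show "(\<Sum>k<N. norm (poly P (of_real (r\<^sup>2) * cis (2 * pi * (real k + s) / real N))) powr p)
       \<le> K * (\<Sum>j<N. norm (poly P (x j)) powr p)"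
    proof (cases "p0 = p")
      case True
      define b where "b j = poly P (x j) / node_coeff N x j" for j
      define S where "S k = (\<Sum>j<N. b j / (1 - of_real (r\<^sup>2) * (y k / x j)))" for k
      have bj: "real N * norm (b j) * E (x j) \<le> K1 * norm (poly P (x j))" if j: "j < N" for j
      proof -
        have "real N * norm (b j) * E (x j) = (real N * E (x j) / norm (node_coeff N x j)) * norm (poly P (x j))"
          by (simp add: b_def norm_divide)
        also have "\<dots> \<le> K1 * norm (poly P (x j))" using Dj[OF j] by (intro mult_right_mono) auto
        finally show ?thesis .
      qed
      have "(\<Sum>k<N. norm (v k) powr p) \<le> (\<Sum>k<N. 2 powr p * (E (y k) * norm (S k)) powr p)"
      proof (intro sum_mono)
        fix k
        have "norm (v k) = norm (W k) * norm (S k)" by (simp only: vk b_def S_def norm_mult)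
        also have "\<dots> \<le> 2 * E (y k) * norm (S k)" using WE by (intro mult_right_mono) auto
        finally have "norm (v k) powr p \<le> (2 * (E (y k) * norm (S k))) powr p"
          using p by (intro powr_mono2) (auto simp: mult_ac)
        then show "norm (v k) powr p \<le> 2 powr p * (E (y k) * norm (S k)) powr p" by (simp only: powr_mult)
      qed
      also have "\<dots> = 2 powr p * (\<Sum>k<N. (E (y k) * norm (S k)) powr p)" by (simp only: sum_distrib_left)
      also have "\<dots> \<le> 2 powr p * (C * (\<Sum>j<N. (real N * norm (b j) * E (x j)) powr p))"
        unfolding E_def S_def
        by (intro mult_left_mono herglotz_boundD[OF HC[unfolded True] N r Nr fx fy nl(1,2)] UNIV_I powr_ge_zero)
      also have "\<dots> \<le> 2 powr p * (C * (\<Sum>j<N. (K1 * norm (poly P (x j))) powr p))"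
        using bj C p E0(1) by (intro mult_left_mono sum_mono powr_mono2) (auto intro!: mult_nonneg_nonneg intro: less_imp_le)
      also have "\<dots> = K2 * K1 powr p * (\<Sum>j<N. norm (poly P (x j)) powr p)"
        by (simp only: K2_def True powr_mult sum_distrib_left mult_ac)
      finally show ?thesis unfolding K_def v_def y_def using True by simp
    next
      case False
      then have p0p: "p0 = p / (p - 1)" using p0(3) by simp
      txt \<open>The transposed matrix of the interpolation operator is estimated in the dual exponent:
        nodes and evaluation points exchange their roles and the weight is inverted.\<close>
      define X where "X = (\<Sum>k<N. norm (v k) powr p)"
      \<comment> \<open>The extremal dual vector: its pairing with \<open>v\<close> is the sum of
        the |v k|^p, and |\<beta> k| to the conjugate exponent is |v k|^p again.\<close>
      define \<beta> where "\<beta> k = cnj (v k) * of_real (norm (v k) powr (p - 2))" for k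
      have \<beta>v: "\<beta> k * v k = of_real (norm (v k) powr p)" for k
      proof -
        have "\<beta> k * v k = of_real ((norm (v k))\<^sup>2 * norm (v k) powr (p - 2))"
          unfolding \<beta>_def of_real_mult complex_norm_square by (simp only: mult_ac)
        also have "(norm (v k))\<^sup>2 * norm (v k) powr (p - 2) = norm (v k) powr p"
          by (cases "v k = 0") (auto simp: powr_diff)
        finally show ?thesis .
      qed
      have \<beta>n: "norm (\<beta> k) powr p0 = norm (v k) powr p" for k
      proof (cases "v k = 0")
        case False
        have "norm (\<beta> k) = norm (v k) powr 1 * norm (v k) powr (p - 2)" using False by (simp add: \<beta>_def norm_mult)
        also have "\<dots> = norm (v k) powr (p - 1)" by (subst powr_add[symmetric]) simp
        finally show ?thesis using p by (simp add: powr_powr p0p)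
      qed (simp add: \<beta>_def)
      define c where "c k = cnj (\<beta> k * W k)" for k
      define S where "S j = (\<Sum>k<N. c k / (1 - of_real (r\<^sup>2) * (x j / y k)))" for j
      have "of_real X = (\<Sum>k<N. \<beta> k * v k)" by (simp add: X_def \<beta>v)
      also have "\<dots> = (\<Sum>k<N. \<Sum>j<N. poly P (x j) / node_coeff N x j * (\<beta> k * W k / (1 - of_real (r\<^sup>2) * (y k / x j))))"
      proof (intro sum.cong refl)
        fix k
        show "\<beta> k * v k = (\<Sum>j<N. poly P (x j) / node_coeff N x j * (\<beta> k * W k / (1 - of_real (r\<^sup>2) * (y k / x j))))"
          by (subst vk) (simp add: sum_distrib_left mult_ac)
      qed
      also have "\<dots> = (\<Sum>j<N. poly P (x j) / node_coeff N x j * (\<Sum>k<N. \<beta> k * W k / (1 - of_real (r\<^sup>2) * (y k / x j))))"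
        by (subst sum.swap) (simp only: sum_distrib_left)
      also have "\<dots> = (\<Sum>j<N. poly P (x j) / node_coeff N x j * cnj (S j))"
      proof (intro sum.cong refl arg_cong2[where f="(*)"])
        fix j assume j: "j \<in> {..<N}"
        \<comment> \<open>Conjugating a quotient of unimodular numbers inverts it, which brings the
          transposed kernel to the form of the original one with the families exchanged.\<close>
        have xy: "cnj (x j) / cnj (y k) = y k / x j" for k
        proof -
          have "x j * cnj (x j) = 1" "y k * cnj (y k) = 1" using nx ny j by (simp_all flip: complex_norm_square)
          moreover have "x j \<noteq> 0" "y k \<noteq> 0" using nx[of j] ny[of k] j by auto
          ultimately have "cnj (x j) = 1 / x j" "cnj (y k) = 1 / y k" by (simp_all add: field_simps)
          then show ?thesis by simp
        qed
        show "(\<Sum>k<N. \<beta> k * W k / (1 - of_real (r\<^sup>2) * (y k / x j))) = cnj (S j)"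
          unfolding S_def c_def cnj_sum complex_cnj_divide complex_cnj_diff complex_cnj_one complex_cnj_mult
            complex_cnj_complex_of_real complex_cnj_cnj xy ..
      qed
      finally have Xeq: "of_real X = (\<Sum>j<N. poly P (x j) / node_coeff N x j * cnj (S j))" .
      have X0: "X \<ge> 0" unfolding X_def by (intro sum_nonneg) auto
      define \<gamma> where "\<gamma> j = E' (x j) * norm (S j) / real N" for j
      have "X = norm (of_real X :: complex)" using X0 by simp
      also have "\<dots> \<le> (\<Sum>j<N. norm (poly P (x j) / node_coeff N x j * cnj (S j)))" unfolding Xeq by (rule norm_sum)
      also have "\<dots> \<le> (\<Sum>j<N. K1 * (norm (poly P (x j)) * \<gamma> j))"
      proof (intro sum_mono)
        fix j assume "j \<in> {..<N}"
        then have j: "j < N" by simp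
        have "norm (poly P (x j) / node_coeff N x j * cnj (S j)) = norm (poly P (x j)) * norm (S j) / norm (node_coeff N x j)"
          by (simp add: norm_mult norm_divide)
        also have "\<dots> = (real N * E (x j) / norm (node_coeff N x j)) * (norm (poly P (x j)) * \<gamma> j)"
        proof -
          have "real N * E (x j) * \<gamma> j = (E (x j) * E' (x j)) * norm (S j)" using N by (simp add: \<gamma>_def mult_ac)
          then have "real N * E (x j) * \<gamma> j = norm (S j)" by (simp only: EE mult_1)
          then show ?thesis by (metis mult.commute mult.left_commute times_divide_eq_right)
        qed
        also have "\<dots> \<le> K1 * (norm (poly P (x j)) * \<gamma> j)"
          using Dj[OF j] E0(2)[of "x j"] by (intro mult_right_mono) (auto simp: \<gamma>_def)
        finally show "norm (poly P (x j) / node_coeff N x j * cnj (S j)) \<le> K1 * (norm (poly P (x j)) * \<gamma> j)" .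
      qed
      finally have X1: "X \<le> K1 * (\<Sum>j<N. norm (poly P (x j)) * \<gamma> j)" by (simp only: sum_distrib_left)
      \<comment> \<open>Here the Herglotz bound is used with nodes \<open>y\<close>, evaluation
        points \<open>x\<close> and weight \<open>E'\<close>, the inverse of \<open>E\<close>; the
        factor \<open>W k\<close> in the coefficients is compensated by
        \<open>E' (y k)\<close>.\<close>
      have "(\<Sum>j<N. (real N * \<gamma> j) powr p0) = (\<Sum>j<N. (E' (x j) * norm (S j)) powr p0)"
        using N by (simp add: \<gamma>_def)
      also have "\<dots> \<le> C * (\<Sum>k<N. (real N * norm (c k) * E' (y k)) powr p0)"
        unfolding E'_def S_def
        by (rule herglotz_boundD[OF HC N r Nr fy fx, of "\<lambda>z. - L z"]) (use nl(1,2) in \<open>auto intro: holomorphic_on_minus\<close>)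
      also have "\<dots> \<le> C * (\<Sum>k<N. (real N * (2 * norm (\<beta> k))) powr p0)"
      proof (intro mult_left_mono sum_mono powr_mono2)
        fix k
        have "norm (W k) * E' (y k) \<le> 2 * E (y k) * E' (y k)" using WE[of k] E0(2)[of "y k"]
          by (intro mult_right_mono) auto
        then have "norm (W k) * E' (y k) \<le> 2" using EE[of "y k"] by (simp only: mult.assoc mult_1_right)
        then have "real N * norm (\<beta> k) * (norm (W k) * E' (y k)) \<le> real N * norm (\<beta> k) * 2" by (intro mult_left_mono) auto
        then show "real N * norm (c k) * E' (y k) \<le> real N * (2 * norm (\<beta> k))" by (simp add: c_def norm_mult mult_ac)
      qed (use C p0 E0 in \<open>auto intro!: mult_nonneg_nonneg intro: less_imp_le\<close>)
      also have "\<dots> = real N powr p0 * (K2 * X)"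
        by (simp add: K2_def X_def powr_mult \<beta>n sum_distrib_left mult_ac)
      finally have "real N powr p0 * (\<Sum>j<N. \<gamma> j powr p0) \<le> real N powr p0 * (K2 * X)"
        by (simp only: powr_mult sum_distrib_left)
      then have X2: "(\<Sum>j<N. \<gamma> j powr p0) \<le> K2 * X" using N by (subst (asm) mult_le_cancel_left_pos) auto
      have "X \<le> 2 * K1 * (2 * K1 * K2) powr (p - 1) * (\<Sum>j<N. norm (poly P (x j)) powr p)"
      proof (rule young_absorb[OF p K1 K2 _ _ X1])
        show "0 \<le> \<gamma> j" for j
          unfolding \<gamma>_def using E0(2)[of "x j"] by (intro divide_nonneg_nonneg mult_nonneg_nonneg) auto
      qed (use X2 p0p in auto)
      then show ?thesis unfolding K_def X_def v_def y_def using False by simp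
    qed
  qed
  then show ?thesis ..
qed

text \<open>All arcs are folded onto the first one, so the integral becomes the average over
  \<open>s\<close> of the sums over rotated grids.\<close>

lemma integral_le_rotated_sum:
  fixes g :: "real \<Rightarrow> real"
  assumes g: "continuous_on UNIV g" and N: "N > 0"
    and le: "\<And>s. 0 \<le> s \<Longrightarrow> s \<le> 1 \<Longrightarrow> (\<Sum>k<N. g (2 * pi * (real k + s) / real N)) \<le> M"
  shows "integral {0..2*pi} g \<le> 2 * pi / N * M"
proof -
  let ?h = "2 * pi / real N"
  have g': "continuous_on S g" for S using g continuous_on_subset by blast
  have sh: "integral {2*pi*real k/real N..2*pi*(real k+1)/real N} g = integral {0..?h} (\<lambda>t. g (2*pi*real k/real N + t))" for k
  proof -
    have "integral {0..?h} (g \<circ> (+) (2*pi*real k/real N)) = integral {0 + 2*pi*real k/real N..?h + 2*pi*real k/real N} g"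
      by (rule integral_shift_Icc_real)
    moreover have "?h + 2*pi*real k/real N = 2*pi*(real k+1)/real N" by (simp add: distrib_left add_divide_distrib)
    ultimately show ?thesis by (simp add: o_def)
  qed
  have c: "continuous_on {0..?h} (\<lambda>t. g (2*pi*real k/real N + t))" for k
    by (rule continuous_on_compose2[OF g]) (auto intro!: continuous_intros)
  have "integral {0..2*pi} g = (\<Sum>k<N. integral {0..?h} (\<lambda>t. g (2*pi*real k/real N + t)))"
    unfolding integral_arcs[OF g' N] sh ..
  also have "\<dots> = integral {0..?h} (\<lambda>t. \<Sum>k<N. g (2*pi*real k/real N + t))"
    by (intro integral_sum[symmetric] integrable_continuous_real c) auto
  also have "\<dots> \<le> integral {0..?h} (\<lambda>t. M)"
  proof (intro integral_le integrable_continuous_real continuous_on_sum c continuous_on_const)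
    fix t assume t: "t \<in> {0..?h}"
    define s where "s = t * N / (2 * pi)"
    have "0 \<le> s" "s \<le> 1" using t N by (auto simp: s_def field_simps)
    moreover have "2*pi*real k/real N + t = 2 * pi * (real k + s) / real N" for k
      using N by (simp add: s_def distrib_left add_divide_distrib)
    ultimately show "(\<Sum>k<N. g (2*pi*real k/real N + t)) \<le> M" using le[of s] by simp
  qed
  also have "\<dots> = 2 * pi / N * M" by simp
  finally show ?thesis .
qed

lemma max_conjugate_ge_2:
  fixes p :: real
  assumes "1 < p"
  shows "2 \<le> max p (p / (p - 1))"
proof (cases "p \<ge> 2")
  case False
  then have "2 \<le> p / (p - 1)" using assms by (simp add: field_simps)
  then show ?thesis by simp
qed simp

text \<open>The open condition \<delta> < 1 / (2 q) leaves room for \<eta> strictly between pi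
  \<delta> and pi / (2 q), and then for a positive \<rho>. Going back from radius
  \<open>r\<^sup>2\<close> to 1 costs the power p of
  \<open>(r\<^sup>2) ^ N = \<rho>\<^sup>2\<close>, independent of N.\<close>

lemma upper_bound:
  assumes p: "1 < p" and q: "q = max p (p / (p - 1))" and \<delta>: "0 \<le> \<delta>" "\<delta> < 1 / (2 * q)"
  obtains K where "K > 0" "\<And>N \<epsilon> x P. N > 0 \<Longrightarrow> perturbed_unity N \<delta> \<epsilon> x \<Longrightarrow> degree (P :: complex poly) < N \<Longrightarrow>
     circle_mean p (poly P) 1 \<le> K / real N * (\<Sum>j<N. norm (poly P (x j)) powr p)"
proof -
  have q2: "q \<ge> 2" using max_conjugate_ge_2[OF p] q by simp
  have "1 / (2 * q) \<le> 1 / (2 * 2)" using q2 by (intro divide_left_mono) auto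
  then have \<delta>4: "\<delta> \<le> 1/4" using \<delta> by linarith
  define \<eta> where "\<eta> = (pi * \<delta> + pi / (2 * q)) / 2"
  have "pi * \<delta> < pi * (1 / (2 * q))" using \<delta> by (intro mult_strict_left_mono) auto
  then have \<eta>: "pi * \<delta> < \<eta>" "\<eta> < pi / (2 * q)" by (auto simp: \<eta>_def)
  have pd: "0 \<le> pi * \<delta>" using \<delta> by simp
  \<comment> \<open>Half of the value at which pi \<delta> (1 + \<rho>) / (1 - \<rho>) would equal
    \<eta>.\<close>
  define \<rho> where "\<rho> = (\<eta> - pi * \<delta>) / (2 * (\<eta> + pi * \<delta>))"
  have \<rho>: "0 < \<rho>" "\<rho> < 1" using \<eta> pd by (auto simp: \<rho>_def divide_simps)
  have half: "X / (2 * Y) * Y = X / 2" if "Y > 0" for X Y :: real using that by simp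
  have "\<rho> * (\<eta> + pi * \<delta>) = (\<eta> - pi * \<delta>) / 2" unfolding \<rho>_def by (rule half) (use \<eta> pd in linarith)
  then have "\<rho> * (\<eta> + pi * \<delta>) < \<eta> - pi * \<delta>" using \<eta> by simp
  then have "pi * \<delta> * (1 + \<rho>) < \<eta> * (1 - \<rho>)" by (simp add: algebra_simps)
  then have \<eta>\<rho>: "pi * \<delta> * ((1 + \<rho>) / (1 - \<rho>)) < \<eta>" using \<rho> by (simp add: divide_less_eq)
  have \<eta>q: "2 * q * \<eta> < pi" using \<eta>(2) q2 by (simp add: field_simps)
  define p0 where "p0 = q / (q - 1)"
  have p01: "1 < p0" "p0 \<le> 2" "p0 - 1 = 1 / (q - 1)" using q2 by (auto simp: p0_def field_simps)
  have p0p: "p0 = p \<or> p0 = p / (p - 1)"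
  proof (cases "q = p")
    case False
    then have qp: "q = p / (p - 1)" using q by (simp add: max_def split: if_splits)
    have "q - 1 = 1 / (p - 1)" using p unfolding qp by (simp add: field_simps)
    then have "p0 = q * (p - 1)" by (simp add: p0_def)
    then show ?thesis using p qp by simp
  qed (simp add: p0_def)
  have p0\<eta>: "p0 * \<eta> < (p0 - 1) * pi / 2"
  proof -
    have "p0 * \<eta> = q * \<eta> / (q - 1)" by (simp add: p0_def)
    also have "\<dots> < (pi / 2) / (q - 1)" using \<eta>q q2 by (intro divide_strict_right_mono) auto
    also have "\<dots> = (p0 - 1) * pi / 2" unfolding p01(3) by simp
    finally show ?thesis .
  qed
  from rotated_upper_bound_exists[OF p p01(1,2) p0p \<delta>(1) \<delta>4 \<rho> \<eta>\<rho> p0\<eta>]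
  obtain K where RK: "rotated_upper_bound p \<delta> \<rho> K" ..
  then have K: "K > 0" by (simp add: rotated_upper_bound_def)
  define K' where "K' = K / (\<rho>\<^sup>2) powr p"
  have K': "K' > 0" using K \<rho> by (simp add: K'_def)
  have main: "circle_mean p (poly P) 1 \<le> K' / real N * (\<Sum>j<N. norm (poly P (x j)) powr p)"
    if N: "N > 0" and x: "perturbed_unity N \<delta> \<epsilon> x" and P: "degree P < N" for N \<epsilon> x and P :: "complex poly"
  proof -
    obtain r where r: "0 < r" "r < 1" "r ^ N = \<rho>" using root_radius[OF \<rho> N] .
    define g where "g t = norm (poly P (of_real (r\<^sup>2) * cis t)) powr p" for t
    define M where "M = K * (\<Sum>j<N. norm (poly P (x j)) powr p)"
    have cg: "continuous_on UNIV g" unfolding g_def using p by (intro continuous_on_powr' continuous_intros) auto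
    have "integral {0..2*pi} g \<le> 2 * pi / N * M"
    proof (rule integral_le_rotated_sum[OF cg N])
      fix s :: real assume "0 \<le> s" "s \<le> 1"
      then show "(\<Sum>k<N. g (2 * pi * (real k + s) / real N)) \<le> M"
        using RK N x P r unfolding rotated_upper_bound_def g_def M_def by blast
    qed
    then have "integral {0..2*pi} g / (2 * pi) \<le> (2 * pi / N * M) / (2 * pi)" by (intro divide_right_mono) auto
    then have cm: "circle_mean p (poly P) (r\<^sup>2) \<le> M / N" unfolding circle_mean_def g_def[symmetric] by simp
    have R: "0 < r\<^sup>2" "r\<^sup>2 < 1" using r by (auto simp: abs_square_less_1)
    have dP: "degree P \<le> N" using P by simp
    have "(r\<^sup>2) ^ N = \<rho>\<^sup>2" using r(3) by (metis power_mult mult.commute)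
    then have "(\<rho>\<^sup>2) powr p * circle_mean p (poly P) 1 \<le> M / N"
      using circle_mean_one_le[OF dP p R] cm by simp
    moreover have "(\<rho>\<^sup>2) powr p > 0" using \<rho> by simp
    ultimately have "circle_mean p (poly P) 1 \<le> M / N / (\<rho>\<^sup>2) powr p"
      by (simp only: pos_le_divide_eq mult.commute)
    then show ?thesis by (simp add: M_def K'_def mult_ac)
  qed
  show ?thesis by (rule that[OF K' main])
qed

section \<open>A configuration with a jump in the perturbation\<close>

text \<open>For nonnegative \<open>b\<close> the sum \<open>\<Sum> b j / (1 - u / x j)\<close> cannot be small on the unit circle, because
  \<open>1 / (1 - v)\<close> has real part \<open>1/2\<close> for all unimodular \<open>v \<noteq> 1\<close>.\<close>

lemma positive_interpolation_bound:
  fixes b :: "nat \<Rightarrow> real"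
  assumes p: "1 < p" and N: "N > 0" and nx: "\<And>j. j < N \<Longrightarrow> norm (x j) = 1" and inj: "inj_on x {..<N}"
    and b: "\<And>j. j < N \<Longrightarrow> 0 \<le> b j"
    and MZ: "\<And>P :: complex poly. degree P < N \<Longrightarrow>
      circle_mean p (poly P) 1 \<le> C / real N * (\<Sum>j<N. norm (poly P (x j)) powr p)"
  shows "(\<Sum>j<N. b j) powr p * circle_mean p (node_prod N x) 1
     \<le> 2 powr p * (C / real N * (\<Sum>j<N. (b j * norm (node_coeff N x j)) powr p))"
proof -
  \<comment> \<open>The polynomial with value b_j times the Lagrange constant at x_j.\<close>
  define P where "P = (\<Sum>j<N. smult (of_real (b j)) (node_poly N x j))"
  have xnz: "x j \<noteq> 0" if "j < N" for j using nx[OF that] by auto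
  have pP: "poly P u = (\<Sum>j<N. of_real (b j) * (\<Prod>i\<in>{..<N} - {j}. 1 - u / x i))" for u
    by (simp add: P_def poly_sum poly_node_poly)
  have dP: "degree P < N" unfolding P_def
  proof (rule degree_sum_less)
    show "degree (smult (of_real (b j)) (node_poly N x j)) < N" if "j \<in> {..<N}" for j
      using le_less_trans[OF degree_smult_le degree_node_poly] that by blast
  qed (use N in simp)
  have val: "poly P (x k) = of_real (b k) * node_coeff N x k" if k: "k < N" for k
  proof -
    have "poly P (x k) = (\<Sum>j<N. if j = k then of_real (b k) * node_coeff N x k else 0)"
      unfolding pP
    proof (intro sum.cong refl)
      fix j assume j: "j \<in> {..<N}"
      have "(\<Prod>i\<in>{..<N} - {j}. 1 - x k / x i) = 0" if "j \<noteq> k"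
        using that k xnz[OF k] by (intro prod_zero bexI[of _ k]) auto
      then show "of_real (b j) * (\<Prod>i\<in>{..<N} - {j}. 1 - x k / x i) = (if j = k then of_real (b k) * node_coeff N x k else 0)"
        by (auto simp: node_coeff_def)
    qed
    then show ?thesis using k by simp
  qed
  have low: "(\<Sum>j<N. b j) * norm (node_prod N x (cis t)) \<le> 2 * norm (poly P (cis t))" for t
  \<comment> \<open>At a node \<open>W\<close> vanishes and the inequality is trivial; elsewhere
    \<open>W\<close> can be factored out.\<close>
  proof (cases "\<exists>j<N. x j = cis t")
    case True
    then obtain j where "j < N" "x j = cis t" by auto
    then have "node_prod N x (cis t) = 0" using xnz by (simp add: node_prod_split)
    then show ?thesis by simp
  next
    case False
    define v where "v j = cis t / x j" for j
    have v: "norm (v j) = 1" "1 - v j \<noteq> 0" if "j < N" for j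
      using that False nx[OF that] xnz[OF that] by (auto simp: v_def norm_divide field_simps)
    have Re: "Re (1 / (1 - v j)) = 1 / 2" if "j < N" for j
    proof -
      have "(1 - Re (v j))\<^sup>2 + (Im (v j))\<^sup>2 = 2 * (1 - Re (v j))"
        using v(1)[OF that] cmod_power2[of "v j"] by (simp add: power2_eq_square algebra_simps)
      moreover have "Re (v j) \<noteq> 1"
      proof
        assume "Re (v j) = 1"
        then have "(Im (v j))\<^sup>2 = 0" using cmod_power2[of "v j"] v(1)[OF that] by simp
        then show False using \<open>Re (v j) = 1\<close> v(2)[OF that] by (simp add: complex_eq_iff)
      qed
      ultimately show ?thesis by (simp add: Re_divide)
    qed
    have "poly P (cis t) = node_prod N x (cis t) * (\<Sum>j<N. of_real (b j) * (1 / (1 - v j)))"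
      unfolding pP sum_distrib_left
    proof (intro sum.cong refl)
      fix j assume "j \<in> {..<N}"
      then have j: "j < N" by simp
      have *: "c * Q = (d * Q) * (c * (1 / d))" if "d \<noteq> 0" for c d Q :: complex using that by simp
      show "of_real (b j) * (\<Prod>i\<in>{..<N} - {j}. 1 - cis t / x i) = node_prod N x (cis t) * (of_real (b j) * (1 / (1 - v j)))"
        unfolding node_prod_split[OF j] v_def by (rule *) (use v(2)[OF j] in \<open>simp add: v_def\<close>)
    qed
    moreover have "(\<Sum>j<N. b j) / 2 \<le> norm (\<Sum>j<N. of_real (b j) * (1 / (1 - v j)))"
    proof -
      have "Re (of_real c * z) = c * Re z" for c z by simp
      then have "Re (\<Sum>j<N. of_real (b j) * (1 / (1 - v j))) = (\<Sum>j<N. b j * Re (1 / (1 - v j)))"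
        unfolding Re_sum by presburger
      also have "\<dots> = (\<Sum>j<N. b j * (1 / 2))" by (intro sum.cong refl arg_cong2[where f="(*)"] Re) auto
      also have "\<dots> = (\<Sum>j<N. b j) / 2" by (simp add: sum_divide_distrib)
      finally show ?thesis using complex_Re_le_cmod by metis
    qed
    ultimately have "norm (node_prod N x (cis t)) * ((\<Sum>j<N. b j) / 2) \<le> norm (poly P (cis t))"
      by (simp only: norm_mult) (intro mult_left_mono, auto)
    then show ?thesis by (simp add: mult_ac)
  qed
  have B: "0 \<le> (\<Sum>j<N. b j)" using b by (intro sum_nonneg) auto
  have cW: "continuous_on {0..2*pi} (\<lambda>t. norm (node_prod N x (cis t)) powr p)"
    unfolding node_prod_def using p xnz by (intro continuous_on_powr' continuous_intros) auto
  have cP: "continuous_on {0..2*pi} (\<lambda>t. norm (poly P (cis t)) powr p)"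
    using p by (intro continuous_on_powr' continuous_intros) auto
  have "(\<Sum>j<N. b j) powr p * integral {0..2*pi} (\<lambda>t. norm (node_prod N x (cis t)) powr p)
    = integral {0..2*pi} (\<lambda>t. (\<Sum>j<N. b j) powr p * norm (node_prod N x (cis t)) powr p)" by simp
  also have "\<dots> \<le> integral {0..2*pi} (\<lambda>t. 2 powr p * norm (poly P (cis t)) powr p)"
  proof (intro integral_le integrable_continuous_real continuous_on_mult continuous_on_const cW cP)
    fix t
    have "((\<Sum>j<N. b j) * norm (node_prod N x (cis t))) powr p \<le> (2 * norm (poly P (cis t))) powr p"
      using low[of t] B p by (intro powr_mono2) auto
    then show "(\<Sum>j<N. b j) powr p * norm (node_prod N x (cis t)) powr p \<le> 2 powr p * norm (poly P (cis t)) powr p"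
      by (simp only: powr_mult)
  qed
  also have "\<dots> = 2 powr p * integral {0..2*pi} (\<lambda>t. norm (poly P (cis t)) powr p)" by simp
  finally have "(\<Sum>j<N. b j) powr p * circle_mean p (node_prod N x) 1 \<le> 2 powr p * circle_mean p (poly P) 1"
    unfolding circle_mean_def by (simp add: divide_right_mono)
  also have "\<dots> \<le> 2 powr p * (C / real N * (\<Sum>j<N. norm (poly P (x j)) powr p))"
    using MZ[OF dP] by (intro mult_left_mono) auto
  also have "(\<Sum>j<N. norm (poly P (x j)) powr p) = (\<Sum>j<N. (b j * norm (node_coeff N x j)) powr p)"
    using b by (intro sum.cong refl) (simp add: val norm_mult)
  finally show ?thesis .
qed

section \<open>Size of the node product for the split configuration\<close>

text \<open>The logarithm of a factor, as a function of the displacement, has second derivative at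
  most \<open>B\<close>, so its value at a fraction \<delta> of the full step differs little from
  linear interpolation between the two ends. The purpose is to replace fractional moves by \<delta>
  times full grid steps, whose effects telescope.\<close>

lemma log_second_difference:
  assumes v: "norm v < 1" and \<delta>: "0 \<le> \<delta>" "\<delta> \<le> 1"
    and B: "\<And>s. 0 \<le> s \<Longrightarrow> s \<le> 1 \<Longrightarrow> \<kappa>\<^sup>2 \<le> B * (norm (1 - v * cis (\<kappa> * s)))\<^sup>2"
  shows "\<bar>ln (norm (1 - v * cis (\<kappa> * \<delta>))) - ln (norm (1 - v))
    - \<delta> * (ln (norm (1 - v * cis \<kappa>)) - ln (norm (1 - v)))\<bar> \<le> B"
proof -
  define w where "w s = v * cis (\<kappa> * s)" for s
  have w: "norm (w s) < 1" for s using v by (simp add: w_def norm_mult)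
  have wnz: "1 - w s \<noteq> 0" for s using w[of s] by auto
  have nonneg: "1 - w s \<notin> \<real>\<^sub>\<le>\<^sub>0" for s using Re_one_minus_pos[OF w, of s] by (auto simp: complex_nonpos_Reals_iff)
  have e: "exp (\<i> * of_real \<kappa> * of_real s) = cis (\<kappa> * s)" for s by (simp add: cis_conv_exp mult.assoc)
  define F where "F s = Re (Ln (1 - w s))" for s
  define F' where "F' s = Re (- (\<i> * of_real \<kappa>) * (w s / (1 - w s)))" for s
  define F'' where "F'' s = Re (of_real (\<kappa>\<^sup>2) * (w s / (1 - w s)\<^sup>2))" for s
  have ReD: "((\<lambda>s. Re (f s)) has_real_derivative Re D) (at s)" if "(f has_vector_derivative D) (at s)"
    for f D and s :: real
    using that unfolding has_vector_derivative_complex_iff by blast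
  have d1: "(F has_real_derivative F' s) (at s)" for s
  proof -
    have "((\<lambda>s. Ln (1 - v * exp (\<i> * of_real \<kappa> * s))) has_field_derivative - (\<i> * of_real \<kappa>) * (w s / (1 - w s))) (at (of_real s))"
      using nonneg[of s] unfolding w_def
      by (auto intro!: derivative_eq_intros simp: e divide_inverse)
    from has_vector_derivative_real_field[OF this] show ?thesis
      unfolding F_def[abs_def] F'_def w_def e by (rule ReD)
  qed
  have d2: "(F' has_real_derivative F'' s) (at s)" for s
  proof -
    have "((\<lambda>s. - (\<i> * of_real \<kappa>) * (v * exp (\<i> * of_real \<kappa> * s) / (1 - v * exp (\<i> * of_real \<kappa> * s))))
       has_field_derivative of_real (\<kappa>\<^sup>2) * (w s / (1 - w s)\<^sup>2)) (at (of_real s))"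
      using wnz[of s] unfolding w_def
      by (auto intro!: derivative_eq_intros simp: e power2_eq_square) (simp add: field_simps)
    from has_vector_derivative_real_field[OF this] show ?thesis
      unfolding F'_def[abs_def] F''_def w_def e by (rule ReD)
  qed
  have b2: "\<bar>F'' s\<bar> \<le> B" if "0 \<le> s" "s \<le> 1" for s
  proof -
    have "\<bar>F'' s\<bar> \<le> norm (of_real (\<kappa>\<^sup>2) * (w s / (1 - w s)\<^sup>2))" unfolding F''_def by (rule abs_Re_le_cmod)
    also have "\<dots> = \<kappa>\<^sup>2 * norm (w s) / (norm (1 - w s))\<^sup>2" by (simp only: norm_mult norm_of_real norm_divide norm_power) simp
    also have "\<dots> \<le> \<kappa>\<^sup>2 * 1 / (norm (1 - w s))\<^sup>2" using w[of s] by (intro divide_right_mono mult_left_mono) auto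
    also have "\<dots> \<le> B" using B[OF that] wnz[of s] by (simp add: w_def divide_le_eq)
    finally show ?thesis .
  qed
  have B0: "B \<ge> 0" using b2[of 0] by simp
  have lip: "\<bar>F' s - F' t\<bar> \<le> B" if "0 \<le> s" "s \<le> 1" "0 \<le> t" "t \<le> 1" for s t
  proof -
    have "norm (F' s - F' t) \<le> B * norm (s - t)"
    proof (rule field_differentiable_bound[of "{0..1}" F' F''])
      show "(F' has_real_derivative F'' u) (at u within {0..1})" for u
        by (rule has_field_derivative_at_within[OF d2])
    qed (use that b2 in auto)
    also have "\<dots> \<le> B * 1" using that B0 by (intro mult_left_mono) auto
    finally show ?thesis by simp
  qed
  have "\<bar>F \<delta> - F 0 - \<delta> * (F 1 - F 0)\<bar> \<le> B"
  proof (cases "\<delta> = 0")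
    case False
    \<comment> \<open>Both difference quotients are values of \<open>F'\<close> inside the unit
      interval, so they differ by at most the bound for \<open>F''\<close>.\<close>
    obtain \<xi> where xi: "0 < \<xi>" "\<xi> < \<delta>" "F \<delta> - F 0 = (\<delta> - 0) * F' \<xi>"
      using MVT2[of 0 \<delta> F F'] \<delta> False d1 by auto
    obtain \<zeta> where ze: "0 < \<zeta>" "\<zeta> < 1" "F 1 - F 0 = (1 - 0) * F' \<zeta>"
      using MVT2[of 0 1 F F'] d1 by auto
    have "F \<delta> - F 0 - \<delta> * (F 1 - F 0) = \<delta> * (F' \<xi> - F' \<zeta>)" using xi ze by (simp add: algebra_simps)
    then have "\<bar>F \<delta> - F 0 - \<delta> * (F 1 - F 0)\<bar> = \<delta> * \<bar>F' \<xi> - F' \<zeta>\<bar>" using \<delta> by (simp add: abs_mult)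
    also have "\<dots> \<le> 1 * B" using lip[of \<xi> \<zeta>] xi ze \<delta> by (intro mult_mono) auto
    finally show ?thesis by simp
  qed (use B0 in simp)
  moreover have "F s = ln (norm (1 - v * cis (\<kappa> * s)))" for s using wnz[of s] by (simp add: F_def w_def)
  ultimately show ?thesis by simp
qed

text \<open>There are \<open>2 * m\<close> nodes, an even number, so that both points where the
  displacement changes sign, 1 and -1, are grid points.\<close>

definition split_offset :: "nat \<Rightarrow> real \<Rightarrow> nat \<Rightarrow> real" where
  "split_offset m \<delta> j = (if j < m then 2 * pi * \<delta> / real (2 * m) else - (2 * pi * \<delta> / real (2 * m)))"

definition split_node :: "nat \<Rightarrow> real \<Rightarrow> nat \<Rightarrow> complex" where
  "split_node m \<delta> j = cis (2 * pi * real j / real (2 * m) + split_offset m \<delta> j)"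

lemma perturbed_split_node: "0 \<le> \<delta> \<Longrightarrow> perturbed_unity (2 * m) \<delta> (split_offset m \<delta>) (split_node m \<delta>)"
  unfolding perturbed_unity_def split_node_def split_offset_def by (auto simp: abs_mult)

text \<open>One grid step moves the point by at most 2 pi / N < 7 / N, while the distance to 1 is at
  least 1 / N. Hence the modulus changes at most by the factor 1 + 7.\<close>

lemma log_norm_shift:
  assumes w: "norm (w :: complex) = R" "real N * (1 - R) = 1" "R < 1" and N: "N > 0"
  shows "\<bar>ln (norm (1 - w * cis (a + 2 * pi / N))) - ln (norm (1 - w * cis a))\<bar> \<le> ln 8"
proof -
  have main: "ln (norm (1 - w * cis s)) \<le> ln 8 + ln (norm (1 - w * cis t))" if "\<bar>s - t\<bar> = 2 * pi / N" for s t
  proof -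
    have lb: "1 / N \<le> norm (1 - w * cis u)" for u
    proof -
      have "norm (1::complex) - norm (w * cis u) \<le> norm (1 - w * cis u)" by (rule norm_triangle_ineq2)
      moreover have "1 / N = 1 - R" using w(2) N by (simp add: field_simps)
      ultimately show ?thesis using w(1) by (simp add: norm_mult)
    qed
    have pos: "norm (1 - w * cis u) > 0" for u
      by (rule less_le_trans[OF _ lb[of u]]) (use N in simp)
    have R: "R \<le> 1" "R \<ge> 0" using w by auto
    have "1 - w * cis s = (1 - w * cis t) - w * (cis s - cis t)" by (simp add: algebra_simps)
    then have "norm (1 - w * cis s) \<le> norm (1 - w * cis t) + norm (w * (cis s - cis t))" by (metis norm_triangle_ineq4)
    also have "norm (w * (cis s - cis t)) \<le> 1 * \<bar>s - t\<bar>"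
      unfolding norm_mult using R w norm_cis_diff_le[of s t] by (intro mult_mono) auto
    also have "1 * \<bar>s - t\<bar> \<le> 7 * (1 / N)" using that pi_less_4 pi_approx N by (simp add: field_simps)
    also have "7 * (1 / N) \<le> 7 * norm (1 - w * cis t)" using lb by (intro mult_left_mono) auto
    finally have "norm (1 - w * cis s) \<le> 8 * norm (1 - w * cis t)" by simp
    then have "ln (norm (1 - w * cis s)) \<le> ln (8 * norm (1 - w * cis t))" using pos by (intro ln_mono) auto
    also have "\<dots> = ln 8 + ln (norm (1 - w * cis t))" using pos[of t] by (subst ln_mult) auto
    finally show ?thesis .
  qed
  show ?thesis using main[of "a + 2 * pi / N" a] main[of a "a + 2 * pi / N"] by auto
qed

text \<open>Up to errors with summable bounds, ln |W| is the unperturbed sum plus \<delta> times the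
  effect of full grid steps. The unperturbed sum is ln |1 - w^N|, which is bounded; the full steps
  telescope on either half circle and leave values at -1 and 1 only, each essentially twice.\<close>

lemma split_node_prod_estimate:
  obtains A where "A > 0"
    "\<And>m \<delta> w. m > 0 \<Longrightarrow> 0 \<le> \<delta> \<Longrightarrow> \<delta> \<le> 1/4 \<Longrightarrow> norm w = 1 - 1 / real (2 * m) \<Longrightarrow>
       norm (node_prod (2 * m) (split_node m \<delta>) w) \<le> A * (norm (1 + w) / norm (1 - w)) powr (2 * \<delta>)"
    "\<And>m \<delta> w. m > 0 \<Longrightarrow> 0 \<le> \<delta> \<Longrightarrow> \<delta> \<le> 1/4 \<Longrightarrow> norm w = 1 - 1 / real (2 * m) \<Longrightarrow>
       (norm (1 + w) / norm (1 - w)) powr (2 * \<delta>) \<le> A * norm (node_prod (2 * m) (split_node m \<delta>) w)"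
proof -
  obtain Z where Z: "Z > 0" "\<And>N j. j < N \<Longrightarrow> (\<Sum>k<N. (1 + real (cdist N j k)) powr (-2)) \<le> Z"
    using cdist_kernel_sum[of 2] by (metis one_less_numeral_iff semiring_norm(76))
  define K where "K = 100 * pi\<^sup>2 * Z + ln 8 + ln 2"
  have main: "norm (node_prod (2 * m) (split_node m \<delta>) w) > 0 \<and> norm (1 + w) > 0 \<and> norm (1 - w) > 0 \<and>
      \<bar>ln (norm (node_prod (2 * m) (split_node m \<delta>) w)) - 2 * \<delta> * (ln (norm (1 + w)) - ln (norm (1 - w)))\<bar> \<le> K"
    if m: "m > 0" and \<delta>: "0 \<le> \<delta>" "\<delta> \<le> 1/4" and nw: "norm w = 1 - 1 / real (2 * m)" for m \<delta> w
  proof -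
    define N where "N = 2 * m"
    define R where "R = 1 - 1 / real N"
    define h where "h = 2 * pi / real N"
    have N: "N > 0" "N \<ge> 2" using m by (auto simp: N_def)
    have R: "0 < R" "R < 1" "real N * (1 - R) = 1" using N by (auto simp: R_def)
    have nw: "norm w = R" by (simp add: nw R_def N_def)
    define \<zeta> where "\<zeta> = w / of_real R"
    have w: "w = of_real R * \<zeta>" and \<zeta>: "norm \<zeta> = 1" using nw R by (auto simp: \<zeta>_def norm_divide)
    have nw1: "norm w < 1" using nw R by simp
    have nz: "1 - w * cis a \<noteq> 0" for a using one_minus_mult_nonzero[OF nw1, of "cis a"] by simp
    obtain k e' where k: "k < N" "0 \<le> e'" "e' \<le> 1" "\<zeta> = cis (2 * pi * (real k + e') / real N)"
    proof -
      have "\<zeta> = cis (Arg2pi \<zeta>)" using \<zeta> Arg2pi_eq[of \<zeta>] by (simp add: cis_conv_exp)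
      moreover have "0 \<le> Arg2pi \<zeta>" "Arg2pi \<zeta> \<le> 2 * pi" using Arg2pi[of \<zeta>] by auto
      ultimately show thesis using that arc_index[OF _ _ N(1)] by metis
    qed
    let ?x = "split_node m \<delta>"
    define F where "F j = ln (norm (1 - w * cis (- (h * j))))" for j :: real
    define T where "T j = ln (norm (1 - w / ?x j))" for j
    \<comment> \<open>The value at the neighbouring grid point in the direction of the
      displacement.\<close>
    define G where "G j = (if j < m then F (real j + 1) else F (real j - 1))" for j
    have wx: "w / ?x j = w * cis (- (h * real j)) * cis (- split_offset m \<delta> j)" for j
    proof -
      have "inverse (?x j) = cis (- (h * real j)) * cis (- split_offset m \<delta> j)"
        unfolding split_node_def cis_inverse cis_mult by (simp add: h_def N_def)
      then show ?thesis by (simp only: divide_inverse mult.assoc)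
    qed
    have bnd: "\<bar>T j - F (real j) - \<delta> * (G j - F (real j))\<bar> \<le> 100 * pi\<^sup>2 * (1 + real (cdist N k j)) powr (-2)"
      if j: "j < N" for j
    proof -
      define \<sigma> :: real where "\<sigma> = (if j < m then 1 else -1)"
      have \<sigma>: "\<sigma> = 1 \<or> \<sigma> = -1" by (simp add: \<sigma>_def)
      define v where "v = w * cis (- (h * real j))"
      have nv: "norm v < 1" using nw1 by (simp add: v_def norm_mult)
      have "\<bar>ln (norm (1 - v * cis (- (\<sigma> * h) * \<delta>))) - ln (norm (1 - v))
         - \<delta> * (ln (norm (1 - v * cis (- (\<sigma> * h)))) - ln (norm (1 - v)))\<bar> \<le> 100 * pi\<^sup>2 * (1 + real (cdist N k j)) powr (-2)"
      proof (rule log_second_difference[OF nv])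
        fix s :: real assume s: "0 \<le> s" "s \<le> 1"
        define X where "X = cis (2 * pi * (real j + \<sigma> * s) / real N)"
        have vX: "v * cis (- (\<sigma> * h) * s) = of_real R * (\<zeta> / X)"
        proof -
          have "v * cis (- (\<sigma> * h) * s) = w * cis (- (h * real j) + - (\<sigma> * h) * s)" by (simp add: v_def cis_mult mult.assoc)
          also have "- (h * real j) + - (\<sigma> * h) * s = - (2 * pi * (real j + \<sigma> * s) / real N)"
            using N by (simp add: h_def field_simps)
          finally show ?thesis by (simp add: w X_def divide_inverse cis_inverse mult.assoc)
        qed
        have "\<bar>\<sigma> * s - e'\<bar> \<le> 2" using \<sigma> s k by auto
        \<comment> \<open>The distance from the circle is exactly 1 / N, so the constant is 3 / 1 +
          2 = 5; with the squared step (2 pi / N)^2 it produces 4 * 25 = 100.\<close>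
        then have "1 + real (cdist N j k) \<le> (3 / 1 + 2) * (real N * norm (1 - of_real R * (\<zeta> / X)))"
          unfolding k(4) X_def using R j k by (intro cdist_scaled_lower) auto
        then have "1 + real (cdist N k j) \<le> 5 * real N * norm (1 - v * cis (- (\<sigma> * h) * s))"
          unfolding vX by (simp add: cdist_sym)
        then have sq: "(1 + real (cdist N k j))\<^sup>2 \<le> (5 * real N * norm (1 - v * cis (- (\<sigma> * h) * s)))\<^sup>2"
          by (intro power_mono) auto
        have "(- (\<sigma> * h))\<^sup>2 = 4 * pi\<^sup>2 / (real N)\<^sup>2" using \<sigma> by (auto simp: h_def power_divide power_mult_distrib)
        also have "\<dots> = 4 * pi\<^sup>2 / (real N)\<^sup>2 * ((1 + real (cdist N k j))\<^sup>2 * (1 + real (cdist N k j)) powr (-2))"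
          by (simp add: powr_minus_divide)
        also have "\<dots> \<le> 4 * pi\<^sup>2 / (real N)\<^sup>2 * ((5 * real N * norm (1 - v * cis (- (\<sigma> * h) * s)))\<^sup>2 * (1 + real (cdist N k j)) powr (-2))"
          using sq by (intro mult_left_mono mult_right_mono) auto
        also have "\<dots> = 100 * pi\<^sup>2 * (1 + real (cdist N k j)) powr (-2) * (norm (1 - v * cis (- (\<sigma> * h) * s)))\<^sup>2"
          using N by (simp add: power_mult_distrib)
        finally show "(- (\<sigma> * h))\<^sup>2 \<le> 100 * pi\<^sup>2 * (1 + real (cdist N k j)) powr (-2) * (norm (1 - v * cis (- (\<sigma> * h) * s)))\<^sup>2" .
      qed (use \<delta> in auto)
      moreover have "ln (norm (1 - v * cis (- (\<sigma> * h) * \<delta>))) = T j"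
      proof -
        have "- split_offset m \<delta> j = - (\<sigma> * h) * \<delta>" by (simp add: split_offset_def \<sigma>_def h_def N_def)
        then show ?thesis unfolding T_def wx v_def by simp
      qed
      moreover have "ln (norm (1 - v)) = F (real j)" by (simp add: v_def F_def)
      moreover have "ln (norm (1 - v * cis (- (\<sigma> * h)))) = G j"
      proof -
        have "v * cis (- (\<sigma> * h)) = w * cis (- (h * (real j + \<sigma>)))"
          by (simp add: v_def cis_mult mult.assoc algebra_simps)
        then show ?thesis by (simp add: G_def F_def \<sigma>_def)
      qed
      ultimately show ?thesis by simp
    qed
    have S1: "\<bar>(\<Sum>j<N. T j) - (\<Sum>j<N. F (real j)) - \<delta> * (\<Sum>j<N. G j - F (real j))\<bar> \<le> 100 * pi\<^sup>2 * Z"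
    proof -
      have "\<bar>\<Sum>j<N. T j - F (real j) - \<delta> * (G j - F (real j))\<bar> \<le> (\<Sum>j<N. 100 * pi\<^sup>2 * (1 + real (cdist N k j)) powr (-2))"
        using bnd by (intro order_trans[OF sum_abs] sum_mono) auto
      also have "\<dots> = 100 * pi\<^sup>2 * (\<Sum>j<N. (1 + real (cdist N k j)) powr (-2))" by (simp only: sum_distrib_left)
      also have "\<dots> \<le> 100 * pi\<^sup>2 * Z" using Z(2)[OF k(1)] by (intro mult_left_mono) auto
      finally show ?thesis by (subst sum_distrib_left) (simp only: sum_subtractf)
    qed
    have S2: "(\<Sum>j<N. G j - F (real j)) = F (real m) - F 0 + (F (real m - 1) - F (real N - 1))"
    proof -
      have "(\<Sum>j<N. G j - F (real j)) = (\<Sum>j<m. G j - F (real j)) + (\<Sum>j=m..<m+m. G j - F (real j))"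
      proof -
        have eq: "{..<N} = {..<m} \<union> {m..<m+m}" by (auto simp: N_def)
        show ?thesis unfolding eq by (rule sum.union_disjoint) auto
      qed
      also have "(\<Sum>j<m. G j - F (real j)) = (\<Sum>j<m. F (real (Suc j)) - F (real j))"
        by (intro sum.cong) (auto simp: G_def add.commute)
      also have "\<dots> = F (real m) - F 0" using sum_lessThan_telescope[of "\<lambda>j. F (real j)" m] by simp
      also have "(\<Sum>j=m..<m+m. G j - F (real j)) = (\<Sum>j<m. G (j + m) - F (real (j + m)))"
        using sum.shift_bounds_nat_ivl[of "\<lambda>j. G j - F (real j)" 0 m m] by (simp add: lessThan_atLeast0)
      also have "\<dots> = (\<Sum>j<m. F (real m - 1 + real j) - F (real m - 1 + real (Suc j)))"
        by (intro sum.cong) (auto simp: G_def algebra_simps)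
      also have "\<dots> = F (real m - 1) - F (real m - 1 + real m)"
        using sum_lessThan_telescope'[of "\<lambda>j. F (real m - 1 + real j)" m] by simp
      also have "real m - 1 + real m = real N - 1" by (simp add: N_def)
      finally show ?thesis .
    qed
    have Fm: "F (real m) = ln (norm (1 + w))"
    proof -
      have "h * real m = pi" using m by (simp add: h_def N_def)
      then show ?thesis by (simp add: F_def cis_conv_exp exp_minus)
    qed
    have F0: "F 0 = ln (norm (1 - w))" by (simp add: F_def)
    have FN: "F (real N) = F 0"
    proof -
      have "h * real N = 2 * pi" using N by (simp add: h_def)
      moreover have "cis (- (2 * pi)) = 1" by (metis cis_2pi cis_cnj complex_cnj_one)
      ultimately show ?thesis by (simp add: F_def)
    qed
    have sh: "\<bar>F (u - 1) - F u\<bar> \<le> ln 8" for u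
    proof -
      have "- (h * (u - 1)) = - (h * u) + 2 * pi / N" unfolding h_def[symmetric] by (simp add: algebra_simps)
      then show ?thesis unfolding F_def using log_norm_shift[OF nw R(3,2) N(1), of "- (h * u)"] by simp
    qed
    \<comment> \<open>The backward half ends one step short of -1 and of 1; shifting these two end
      values costs ln 8 each.\<close>
    have S3: "\<bar>(\<Sum>j<N. G j - F (real j)) - 2 * (ln (norm (1 + w)) - ln (norm (1 - w)))\<bar> \<le> 2 * ln 8"
    proof -
      have "\<bar>p - q + (a - b) - 2 * (p - q)\<bar> \<le> 2 * c" if "\<bar>a - p\<bar> \<le> c" "\<bar>b - q\<bar> \<le> c" for a b c p q :: real
        using that by (smt (verit))
      from this[OF sh[of "real m"] sh[of "real N"]] show ?thesis unfolding S2 FN unfolding Fm F0 .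
    qed
    have S4: "\<bar>\<Sum>j<N. F (real j)\<bar> \<le> ln 2"
    proof -
      have "(\<Sum>j<N. F (real j)) = ln (\<Prod>j<N. norm (1 - w * cis (- (h * real j))))"
        unfolding F_def using nz by (subst ln_prod) auto
      also have "(\<Prod>j<N. norm (1 - w * cis (- (h * real j)))) = norm (node_prod N (unity N) w)"
        unfolding node_prod_def prod_norm[symmetric]
      proof (intro prod.cong refl)
        fix j
        have "inverse (unity N j) = cis (- (h * real j))" unfolding unity_def cis_inverse by (simp add: h_def)
        then show "norm (1 - w * cis (- (h * real j))) = norm (1 - w / unity N j)" by (simp only: divide_inverse)
      qed
      also have "\<dots> = norm (1 - w ^ N)" by (simp only: node_prod_unity[OF N(1)])
      finally have eq: "(\<Sum>j<N. F (real j)) = ln (norm (1 - w ^ N))" .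
      \<comment> \<open>R^N is below 1 / e, so |1 - w^N| stays between 1/2 and 2.\<close>
      have RN: "R ^ N \<le> 1 / 2"
      proof -
        have "R ^ N \<le> exp (- (1 / real N)) ^ N" using exp_ge_add_one_self[of "- (1 / real N)"] R
          by (intro power_mono) (auto simp: R_def)
        also have "\<dots> = exp (-1)" using N by (simp add: exp_of_nat_mult[symmetric])
        also have "\<dots> \<le> 1 / 2" using exp_ge_add_one_self[of 1] by (simp add: exp_minus field_simps)
        finally show ?thesis .
      qed
      have nwN: "norm (w ^ N) = R ^ N" by (simp add: norm_power nw)
      have "1 / 2 \<le> norm (1 - w ^ N)" using norm_triangle_ineq2[of 1 "w ^ N"] nwN RN by simp
      moreover have "norm (1 - w ^ N) \<le> 2" using norm_triangle_ineq4[of 1 "w ^ N"] nwN RN by simp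
      ultimately have "ln (1 / 2) \<le> ln (norm (1 - w ^ N))" "ln (norm (1 - w ^ N)) \<le> ln 2"
        by (auto intro!: ln_mono)
      then show ?thesis unfolding eq by (auto simp: ln_div)
    qed
    have wxnz: "1 - w / ?x j \<noteq> 0" for j unfolding wx mult.assoc cis_mult by (rule nz)
    have S5: "ln (norm (node_prod N ?x w)) = (\<Sum>j<N. T j)"
      unfolding node_prod_def prod_norm[symmetric] T_def using wxnz by (subst ln_prod) auto
    define D where "D = (\<Sum>j<N. G j - F (real j))"
    define l where "l = ln (norm (1 + w)) - ln (norm (1 - w))"
    have "\<bar>\<delta> * (D - 2 * l)\<bar> \<le> (1/2) * (2 * ln 8)"
      unfolding abs_mult using S3 \<delta> by (intro mult_mono) (auto simp: D_def l_def)
    then have "\<bar>\<delta> * D - 2 * \<delta> * l\<bar> \<le> ln 8" by (simp add: algebra_simps)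
    then have "\<bar>ln (norm (node_prod N ?x w)) - 2 * \<delta> * l\<bar> \<le> K"
      using S1 S4 unfolding S5 K_def D_def[symmetric] by linarith
    moreover have "norm (node_prod N ?x w) > 0" using wxnz by (auto simp: node_prod_def)
    moreover have "norm (1 + w) > 0" using nz[of pi] by simp
    moreover have "norm (1 - w) > 0" using nz[of 0] by simp
    ultimately show ?thesis by (simp add: l_def N_def)
  qed
  show ?thesis
  proof (rule that[of "exp K"])
    fix m :: nat and \<delta> :: real and w :: complex
    assume as: "m > 0" "0 \<le> \<delta>" "\<delta> \<le> 1/4" "norm w = 1 - 1 / real (2 * m)"
    define W where "W = norm (node_prod (2 * m) (split_node m \<delta>) w)"
    note M = main[OF as]
    have Wp: "W > 0" using M by (simp add: W_def)
    have pw: "(norm (1 + w) / norm (1 - w)) powr (2 * \<delta>) = exp (2 * \<delta> * (ln (norm (1 + w)) - ln (norm (1 - w))))"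
      using M by (simp add: powr_def ln_div)
    have W: "W = exp (ln W)" using Wp by simp
    have ab: "\<bar>ln W - 2 * \<delta> * (ln (norm (1 + w)) - ln (norm (1 - w)))\<bar> \<le> K" using M by (simp add: W_def)
    show "norm (node_prod (2 * m) (split_node m \<delta>) w) \<le> exp K * (norm (1 + w) / norm (1 - w)) powr (2 * \<delta>)"
      unfolding W_def[symmetric] pw exp_add[symmetric] by (subst W) (use ab in simp)
    show "(norm (1 + w) / norm (1 - w)) powr (2 * \<delta>) \<le> exp K * norm (node_prod (2 * m) (split_node m \<delta>) w)"
      unfolding W_def[symmetric] pw by (subst W, subst exp_add[symmetric]) (use ab in simp)
  qed simp
qed

text \<open>Every factor satisfies |1 - R u|^2 \<ge> R |1 - u|^2, and the powers of R lost, at most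
  N - 1 of them, amount to at least 1/4. At this radius the factor of the node itself is exactly 1 /
  N.\<close>

lemma node_coeff_le:
  assumes m: "m > 0" and nx: "\<And>j. j < 2 * m \<Longrightarrow> norm (x j) = 1" and j: "j < 2 * m"
  shows "norm (node_coeff (2 * m) x j) \<le> 2 * real (2 * m) * norm (node_prod (2 * m) x (of_real (1 - 1 / real (2 * m)) * x j))"
proof -
  define N where "N = 2 * m"
  define R where "R = 1 - 1 / real N"
  have N: "N \<ge> 2" using m by (simp add: N_def)
  have R: "0 < R" "R < 1" using N by (auto simp: R_def)
  let ?I = "{..<N} - {j}"
  have fac: "R * (norm (1 - x j / x i))\<^sup>2 \<le> (norm (1 - of_real R * x j / x i))\<^sup>2" if "i < N" for i
  proof -
    have "norm (x j / x i) = 1" using nx j that by (simp add: norm_divide N_def)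
    from norm_one_minus_scaled_sq[OF this, of R] show ?thesis by simp
  qed
  have "1 + real m * (- (1 / real N)) \<le> (1 + (- (1 / real N))) ^ m"
    by (rule Bernoulli_inequality) (use N in \<open>auto simp: field_simps\<close>)
  then have "1 / 2 \<le> R ^ m" using m by (simp add: R_def N_def)
  then have "(1 / 2)\<^sup>2 \<le> (R ^ m)\<^sup>2" by (intro power_mono) auto
  also have "(R ^ m)\<^sup>2 = R ^ N" by (simp add: N_def power_mult[symmetric] mult.commute)
  also have "\<dots> \<le> R ^ card ?I" using R j by (intro power_decreasing) (auto simp: N_def)
  finally have RI: "1 / 4 \<le> R ^ card ?I" by (simp add: power2_eq_square)
  define Q where "Q = norm (\<Prod>i\<in>?I. 1 - of_real R * x j / x i)"
  have "R ^ card ?I * (norm (node_coeff N x j))\<^sup>2 = (\<Prod>i\<in>?I. R * (norm (1 - x j / x i))\<^sup>2)"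
    by (simp add: node_coeff_def prod.distrib prod_norm[symmetric] prod_power_distrib)
  also have "\<dots> \<le> (\<Prod>i\<in>?I. (norm (1 - of_real R * x j / x i))\<^sup>2)" using fac R by (intro prod_mono) auto
  also have "\<dots> = Q\<^sup>2" by (simp add: Q_def prod_norm[symmetric] prod_power_distrib)
  finally have "R ^ card ?I * (norm (node_coeff N x j))\<^sup>2 \<le> Q\<^sup>2" .
  moreover have "1 / 4 * (norm (node_coeff N x j))\<^sup>2 \<le> R ^ card ?I * (norm (node_coeff N x j))\<^sup>2"
    using RI by (intro mult_right_mono) auto
  ultimately have "(norm (node_coeff N x j))\<^sup>2 \<le> (2 * Q)\<^sup>2" by (simp add: power_mult_distrib)
  then have le: "norm (node_coeff N x j) \<le> 2 * Q" by (rule power2_le_imp_le) (simp add: Q_def)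
  have jN: "j < N" using j by (simp add: N_def)
  have "x j \<noteq> 0" using nx[OF j] by auto
  then have "1 - of_real R * x j / x j = of_real (1 - R)" by simp
  then have "norm (1 - of_real R * x j / x j) = 1 - R" using R by (simp only: norm_of_real)
  then have "norm (node_prod N x (of_real R * x j)) = (1 - R) * Q"
    unfolding node_prod_split[OF jN] norm_mult Q_def by (simp only:)
  then have "real N * norm (node_prod N x (of_real R * x j)) = Q" using N by (simp add: R_def)
  with le show ?thesis by (simp add: N_def R_def)
qed

section \<open>Failure at the threshold\<close>

lemma harm_unbounded: "\<exists>l>0. X < (harm l :: real)"
proof -
  define l where "l = nat \<lceil>exp X\<rceil> + 1"
  have "exp X < real l + 1" unfolding l_def by linarith
  then have "X < ln (real l + 1)" by (metis exp_gt_zero ln_exp ln_less_cancel_iff order_less_trans)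
  also have "\<dots> \<le> harm l" by (rule ln_le_harm)
  finally show ?thesis by (auto simp: l_def)
qed

text \<open>With 4 l nodes the indices from l to 2 l - 1 fill the second quadrant, where the nodes
  are pushed towards -1. The distance to -1 is at most 7 (2 l - j) / N along the circle plus 1 / N
  radially, hence the 8.\<close>

lemma split_node_near_minus_one:
  assumes l: "l > 0" and \<delta>: "0 \<le> \<delta>" "\<delta> \<le> 1/4" and j: "l \<le> j" "j < 2 * l"
  defines "N \<equiv> 2 * (2 * l)" and "x \<equiv> split_node (2 * l) \<delta>" and "R \<equiv> 1 - 1 / real (2 * (2 * l))"
  shows "1 \<le> norm (1 - of_real R * x j)" "norm (1 + of_real R * x j) \<le> 8 * real (2 * l - j) / real N"
    "norm (1 + of_real R * x j) \<le> 2" "0 < norm (1 + of_real R * x j)"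
proof -
  define h where "h = 2 * pi / real N"
  define t where "t = h * (real j + \<delta>)"
  have N: "real N = 4 * real l" "real N > 0" using l by (auto simp: N_def)
  have R: "0 < R" "R < 1" "1 - R = 1 / real N" using l by (auto simp: R_def N_def field_simps)
  have h: "h > 0" "h * real l = pi / 2" using l by (auto simp: h_def N)
  have xt: "x j = cis t"
    using j by (simp add: x_def split_node_def split_offset_def t_def h_def N_def distrib_left add_divide_distrib)
  have t1: "pi / 2 \<le> t"
  proof -
    have "h * real l \<le> h * (real j + \<delta>)" using j \<delta> h by (intro mult_left_mono) auto
    then show ?thesis using h by (simp add: t_def)
  qed
  have jl: "real j + 1 \<le> 2 * real l" using j by linarith
  have pt: "pi - t = h * (2 * real l - real j - \<delta>)" using h(2) by (simp add: t_def algebra_simps)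
  have "0 \<le> h * (2 * real l - real j - \<delta>)" using h jl \<delta> by (intro mult_nonneg_nonneg) auto
  then have t2: "t \<le> pi" using pt by simp
  have "cos t \<le> cos (pi / 2)" using t1 t2 by (intro cos_monotone_0_pi_le) auto
  then have "R * cos t \<le> 0" using R by (simp add: mult_nonneg_nonpos)
  then have "1 \<le> Re (1 - of_real R * x j)" by (simp add: xt)
  then show "1 \<le> norm (1 - of_real R * x j)" using complex_Re_le_cmod order_trans by blast
  have "1 + of_real R * x j = of_real (1 - R) + of_real R * (x j - cis pi)" by (simp add: algebra_simps)
  then have "norm (1 + of_real R * x j) \<le> norm (of_real (1 - R) :: complex) + norm (of_real R * (x j - cis pi))"
    by (metis norm_triangle_ineq)
  also have "norm (of_real (1 - R) :: complex) = 1 / real N" using R by (simp only: norm_of_real)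
  also have "norm (of_real R * (x j - cis pi)) \<le> 1 * \<bar>t - pi\<bar>"
    unfolding norm_mult xt using R by (intro mult_mono norm_cis_diff_le) auto
  also have "1 * \<bar>t - pi\<bar> = h * (2 * real l - real j - \<delta>)" using t2 pt by simp
  also have "\<dots> \<le> h * (2 * real l - real j)" using h \<delta> by (intro mult_left_mono) auto
  also have "h * (2 * real l - real j) \<le> (7 * (2 * real l - real j)) / real N"
  proof -
    have "2 * pi * (2 * real l - real j) \<le> 7 * (2 * real l - real j)"
      using jl pi_approx by (intro mult_right_mono) auto
    then have "2 * pi * (2 * real l - real j) / real N \<le> 7 * (2 * real l - real j) / real N"
      using N by (intro divide_right_mono) auto
    then show ?thesis by (simp add: h_def)
  qed
  also have "1 / real N + 7 * (2 * real l - real j) / real N = (1 + 7 * (2 * real l - real j)) / real N"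
    by (simp add: add_divide_distrib)
  also have "\<dots> \<le> 8 * (2 * real l - real j) / real N" using jl N by (intro divide_right_mono) auto
  also have "2 * real l - real j = real (2 * l - j)" using j by (simp add: of_nat_diff)
  finally show "norm (1 + of_real R * x j) \<le> 8 * real (2 * l - j) / real N" by simp
  have nR: "norm (of_real R * x j) = R" using R by (simp add: xt norm_mult)
  show "norm (1 + of_real R * x j) \<le> 2" using norm_triangle_ineq[of 1 "of_real R * x j"] nR R by simp
  have "norm (1::complex) - norm (- (of_real R * x j)) \<le> norm (1 - (- (of_real R * x j)))" by (rule norm_triangle_ineq2)
  then have "1 - R \<le> norm (1 + of_real R * x j)" using nR by simp
  then show "0 < norm (1 + of_real R * x j)" using R(2) by linarith
qed

text \<open>In the first quadrant the numerator is at least 1, and the denominator is at most 1 / N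
  radially plus 7 (k + 1) / N along the circle. This is the region where the node product is
  large.\<close>

lemma split_node_near_one:
  assumes l: "l > 0" and k: "k < l" and s: "0 \<le> s" "s \<le> 1"
  defines "N \<equiv> 2 * (2 * l)" and "R \<equiv> 1 - 1 / real (2 * (2 * l))"
  defines "w \<equiv> of_real R * cis (2 * pi * (real k + s) / real N)"
  shows "real N / (8 * (real k + 1)) \<le> norm (1 + w) / norm (1 - w)"
proof -
  define t where "t = 2 * pi * (real k + s) / real N"
  have N: "real N = 4 * real l" "real N > 0" using l by (auto simp: N_def)
  have R: "0 < R" "R < 1" "1 - R = 1 / real N" using l by (auto simp: R_def N_def field_simps)
  have t0: "0 \<le> t" using s N by (simp add: t_def)
  have t1: "t \<le> 2 * pi * (real k + 1) / real N" unfolding t_def using s N by (intro divide_right_mono mult_left_mono) auto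
  have "2 * pi * (real k + 1) / real N \<le> 2 * pi * real l / real N" using k N by (intro divide_right_mono mult_left_mono) auto
  then have t2: "t \<le> pi / 2" using t1 N l by simp
  have "0 \<le> cos t" using t0 t2 by (intro cos_ge_zero) auto
  then have "1 \<le> Re (1 + w)" using R by (simp add: w_def t_def[symmetric])
  then have n1: "1 \<le> norm (1 + w)" using complex_Re_le_cmod order_trans by blast
  have "1 - w = of_real (1 - R) + of_real R * (cis 0 - cis t)" by (simp add: w_def t_def algebra_simps)
  then have "norm (1 - w) \<le> norm (of_real (1 - R) :: complex) + norm (of_real R * (cis 0 - cis t))"
    by (metis norm_triangle_ineq)
  also have "norm (of_real (1 - R) :: complex) = 1 / real N" using R by (simp only: norm_of_real)
  also have "norm (of_real R * (cis 0 - cis t)) \<le> 1 * \<bar>0 - t\<bar>"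
    unfolding norm_mult using R by (intro mult_mono norm_cis_diff_le) auto
  also have "1 * \<bar>0 - t\<bar> \<le> 7 * (real k + 1) / real N"
  proof -
    have "2 * pi * (real k + 1) / real N \<le> 7 * (real k + 1) / real N"
      using N pi_approx by (intro divide_right_mono mult_right_mono) auto
    then show ?thesis using t0 t1 by simp
  qed
  also have "1 / real N + 7 * (real k + 1) / real N = (1 + 7 * (real k + 1)) / real N"
    by (simp add: add_divide_distrib)
  also have "\<dots> \<le> 8 * (real k + 1) / real N" using N by (intro divide_right_mono) auto
  finally have n2: "norm (1 - w) \<le> 8 * (real k + 1) / real N" by simp
  have "norm w = R" using R by (simp add: w_def norm_mult)
  then have n3: "0 < norm (1 - w)" using R by auto
  have "real N / (8 * (real k + 1)) = 1 / (8 * (real k + 1) / real N)" by simp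
  also have "\<dots> \<le> norm (1 + w) / norm (1 - w)" using n1 n2 n3 by (intro frac_le) auto
  finally show ?thesis .
qed

text \<open>The node product blows up like a power -2 \<delta> of the distance to 1 and vanishes
  like a power 2 \<delta> of the distance to -1. For p at least 2 the blow-up makes the mean of
  |W|^p diverge like the logarithm of N. For p < 2 the small Lagrange constants near -1 let
  coefficients of large sum have small cost. The threshold value makes the critical exponent 1 in
  either case, which gives a harmonic sum.\<close>

lemma sampling_fails_at_threshold:
  assumes p: "1 < p" and q: "q = max p (p / (p - 1))" and \<delta>: "\<delta> = 1 / (2 * q)"
    and MZ: "\<And>N \<epsilon> x P. N > 0 \<Longrightarrow> perturbed_unity N \<delta> \<epsilon> x \<Longrightarrow> degree (P :: complex poly) < N \<Longrightarrow>
      circle_mean p (poly P) 1 \<le> C / real N * (\<Sum>j<N. norm (poly P (x j)) powr p)"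
  shows False
proof -
  have q2: "q \<ge> 2" using max_conjugate_ge_2[OF p] q by simp
  have \<delta>0: "0 \<le> \<delta>" "\<delta> \<le> 1/4" using q2 unfolding \<delta> by (auto simp: field_simps)
  have \<delta>q: "2 * \<delta> * q = 1" using q2 by (simp add: \<delta>)
  obtain A where A: "A > 0"
    and up: "\<And>m \<delta> w. m > 0 \<Longrightarrow> 0 \<le> \<delta> \<Longrightarrow> \<delta> \<le> 1/4 \<Longrightarrow> norm w = 1 - 1 / real (2 * m) \<Longrightarrow>
       norm (node_prod (2 * m) (split_node m \<delta>) w) \<le> A * (norm (1 + w) / norm (1 - w)) powr (2 * \<delta>)"
    and low: "\<And>m \<delta> w. m > 0 \<Longrightarrow> 0 \<le> \<delta> \<Longrightarrow> \<delta> \<le> 1/4 \<Longrightarrow> norm w = 1 - 1 / real (2 * m) \<Longrightarrow>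
       (norm (1 + w) / norm (1 - w)) powr (2 * \<delta>) \<le> A * norm (node_prod (2 * m) (split_node m \<delta>) w)"
    using split_node_prod_estimate by metis
  define x where "x l = split_node (2 * l) \<delta>" for l
  define N where "N l = 2 * (2 * l)" for l :: nat
  define R where "R l = 1 - 1 / real (N l)" for l
  define W where "W l = node_prod (N l) (x l)" for l
  define J where "J l = {l..<2 * l}" for l :: nat
  have NJ: "N l > 0" "real (N l) = 4 * real l" "J l \<subseteq> {..<N l}" if "l > 0" for l
    using that by (auto simp: N_def J_def)
  have R: "0 < R l" "R l < 1" if "l > 0" for l using that by (auto simp: R_def N_def field_simps)
  have nx: "norm (x l j) = 1" for l j by (simp add: x_def split_node_def)
  have nR: "norm (of_real (R l) * \<zeta>) = 1 - 1 / real (2 * (2 * l))" if "l > 0" "norm \<zeta> = 1" for l and \<zeta> :: complex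
  proof -
    have "norm (of_real (R l) * \<zeta>) = R l" using R[OF that(1)] that(2) by (simp add: norm_mult)
    then show ?thesis by (simp only: R_def N_def)
  qed
  have xnz: "x l j \<noteq> 0" for l j using nx[of l j] by auto
  have pert: "perturbed_unity (N l) \<delta> (split_offset (2 * l) \<delta>) (x l)" for l
    unfolding N_def x_def by (rule perturbed_split_node[OF \<delta>0(1)])
  note inj = perturbed_unity_inj[OF pert \<delta>0(2)]
  have hol: "W l holomorphic_on S" for l S
    unfolding W_def node_prod_def[abs_def] using xnz by (intro holomorphic_intros) auto
  have coeff: "norm (node_coeff (N l) (x l) j) \<le> 2 * real (N l) * A * norm (1 + of_real (R l) * x l j) powr (2 * \<delta>)"
    if l: "l > 0" and j: "j \<in> J l" for l j
  proof -
    define w where "w = of_real (R l) * x l j"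
    have jl: "l \<le> j" "j < 2 * l" using j by (auto simp: J_def)
    have "1 \<le> norm (1 - w)" "0 < norm (1 + w)"
      using split_node_near_minus_one(1,4)[OF l \<delta>0 jl] by (simp_all only: w_def R_def N_def x_def)
    then have "norm (1 + w) / norm (1 - w) \<le> norm (1 + w) / 1" by (intro divide_left_mono) auto
    then have "A * (norm (1 + w) / norm (1 - w)) powr (2 * \<delta>) \<le> A * norm (1 + w) powr (2 * \<delta>)"
      using \<delta>0 A by (intro mult_left_mono powr_mono2) auto
    moreover have "norm (W l w) \<le> A * (norm (1 + w) / norm (1 - w)) powr (2 * \<delta>)"
      unfolding W_def x_def N_def w_def by (rule up[OF _ \<delta>0 nR[OF l]]) (use l nx in \<open>auto simp: x_def\<close>)
    ultimately have "norm (W l w) \<le> A * norm (1 + w) powr (2 * \<delta>)" by (rule order_trans[rotated])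
    then have "2 * real (N l) * norm (W l w) \<le> 2 * real (N l) * (A * norm (1 + w) powr (2 * \<delta>))" by (intro mult_left_mono) auto
    moreover have "norm (node_coeff (N l) (x l) j) \<le> 2 * real (N l) * norm (W l w)"
      unfolding W_def w_def R_def unfolding N_def using jl by (intro node_coeff_le nx) auto
    ultimately show ?thesis by (simp only: w_def mult.assoc)
  qed
  have test: "(\<Sum>j\<in>J l. b j) powr p * circle_mean p (W l) 1
      \<le> 2 powr p * (C / real (N l) * (\<Sum>j\<in>J l. (b j * norm (node_coeff (N l) (x l) j)) powr p))"
    if l: "l > 0" and b: "\<And>j. 0 \<le> b j" for l and b :: "nat \<Rightarrow> real"
  proof -
    \<comment> \<open>Only coefficients in the second quadrant are used: there |1 - w| \<ge> 1 and
      the Lagrange constants are under control.\<close>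
    define b' where "b' j = (if j \<in> J l then b j else 0)" for j
    have s: "(\<Sum>j<N l. b' j) = (\<Sum>j\<in>J l. b j)"
      using NJ(3)[OF l] by (intro sum.mono_neutral_cong_right) (auto simp: b'_def)
    have "(\<Sum>j<N l. (b' j * norm (node_coeff (N l) (x l) j)) powr p) = (\<Sum>j\<in>J l. (b j * norm (node_coeff (N l) (x l) j)) powr p)"
      using NJ(3)[OF l] by (intro sum.mono_neutral_cong_right) (auto simp: b'_def)
    then show ?thesis unfolding s[symmetric] W_def
      using positive_interpolation_bound[OF p NJ(1)[OF l] nx inj _ MZ[OF NJ(1)[OF l] pert], of b'] b by (simp add: b'_def)
  qed
  have bound: "\<exists>X. \<forall>l>0. (harm l :: real) \<le> X"
  proof (cases "p \<ge> 2")
    case True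
    then have "p / (p - 1) \<le> p / 1" by (intro divide_left_mono) auto
    then have \<delta>p: "2 * \<delta> * p = 1" using \<delta>q q by simp
    \<comment> \<open>Coefficients constant 1 on a quarter of the nodes: both sides scale alike in
      N, so the mean of |W|^p would have to stay bounded, whereas the arcs near 1 contribute N / (k
      + 1) each.\<close>
    have "harm l \<le> 8 * A powr p * (2 powr p * C * (16 * A) powr p / 4)" if l: "l > 0" for l
    proof -
      have Dj: "norm (node_coeff (N l) (x l) j) \<le> 4 * real (N l) * A" if j: "j \<in> J l" for j
      proof -
        have jl: "l \<le> j" "j < 2 * l" using j by (auto simp: J_def)
        have "norm (1 + of_real (R l) * x l j) \<le> 2"
          using split_node_near_minus_one(3)[OF l \<delta>0 jl] by (simp only: R_def N_def x_def)
        then have "norm (1 + of_real (R l) * x l j) powr (2 * \<delta>) \<le> 2 powr (2 * \<delta>)"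
          using \<delta>0 by (intro powr_mono2) auto
        also have "\<dots> \<le> 2 powr 1" using \<delta>0 by (intro powr_mono) auto
        finally have "2 * real (N l) * A * norm (1 + of_real (R l) * x l j) powr (2 * \<delta>) \<le> 2 * real (N l) * A * 2"
          using A by (intro mult_left_mono) auto
        from order_trans[OF coeff[OF l j] this] show ?thesis by (simp add: mult_ac)
      qed
      have cJ: "card (J l) = l" by (simp add: J_def)
      define cm where "cm = circle_mean p (W l) 1"
      have pib: "real l powr p * cm \<le> 2 powr p * (C / real (N l) * (\<Sum>j\<in>J l. norm (node_coeff (N l) (x l) j) powr p))"
        using test[OF l, of "\<lambda>_. 1"] by (simp add: cJ cm_def)
      have sumD: "(\<Sum>j\<in>J l. norm (node_coeff (N l) (x l) j) powr p) \<le> real l * (4 * real (N l) * A) powr p"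
      proof -
        have "(\<Sum>j\<in>J l. norm (node_coeff (N l) (x l) j) powr p) \<le> (\<Sum>j\<in>J l. (4 * real (N l) * A) powr p)"
          using Dj p by (intro sum_mono powr_mono2) auto
        then show ?thesis by (simp add: cJ)
      qed
      \<comment> \<open>The sign of \<open>C\<close> follows from the assumed estimate for the
        constant polynomial 1.\<close>
      have C: "C \<ge> 0"
      proof -
        have "1 \<le> C / real (N l) * (\<Sum>j<N l. norm (poly (1::complex poly) (x l j)) powr p)"
          using MZ[OF NJ(1)[OF l] pert, of 1] NJ[OF l] by (simp add: circle_mean_def)
        then show ?thesis using NJ[OF l] by (simp add: nx)
      qed
      note pib
      also have "2 powr p * (C / real (N l) * (\<Sum>j\<in>J l. norm (node_coeff (N l) (x l) j) powr p))
        \<le> 2 powr p * (C / real (N l) * (real l * (4 * real (N l) * A) powr p))"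
        using sumD C by (intro mult_left_mono) auto
      also have "\<dots> = real l powr p * (2 powr p * C * (16 * A) powr p / 4)"
      proof -
        have "(4 * real (N l) * A) powr p = real l powr p * (16 * A) powr p"
          unfolding NJ(2)[OF l] powr_mult[symmetric] by (simp add: mult_ac)
        moreover have "C / real (N l) * real l = C / 4" using l by (simp add: NJ(2)[OF l])
        moreover have "2 powr p * (C / real (N l) * (real l * Y)) = 2 powr p * ((C / real (N l) * real l) * Y)" for Y
          by (simp only: mult.assoc)
        ultimately show ?thesis by (simp only:) simp
      qed
      finally have cm: "cm \<le> 2 powr p * C * (16 * A) powr p / 4" using l by (subst (asm) mult_le_cancel_left_pos) auto
      define g where "g t = norm (W l (of_real (R l) * cis t)) powr p" for t
      define V where "V k = (if k < l then real (N l) / (8 * (real k + 1)) / A powr p else 0)" for k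
      have cg: "continuous_on {0..2*pi} g" unfolding g_def W_def node_prod_def
        using p xnz by (intro continuous_on_powr' continuous_intros) auto
      have "(2 * pi / real (N l)) * (\<Sum>k<N l. V k) \<le> integral {0..2*pi} g"
      proof (rule sum_le_integral_arcs[OF cg NJ(1)[OF l]])
        fix k and s :: real assume k: "k < N l" "0 \<le> s" "s \<le> 1"
        show "V k \<le> g (2 * pi * (real k + s) / real (N l))"
        proof (cases "k < l")
          case True
          define \<zeta> where "\<zeta> = cis (2 * pi * (real k + s) / real (N l))"
          define a where "a = norm (1 + of_real (R l) * \<zeta>) / norm (1 - of_real (R l) * \<zeta>)"
          have "real (N l) / (8 * (real k + 1)) \<le> a"
            unfolding a_def \<zeta>_def R_def N_def by (rule split_node_near_one[OF l True k(2,3)])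
          moreover have "a = (a powr (2 * \<delta>)) powr p" using \<delta>p by (simp add: powr_powr a_def)
          moreover have "(a powr (2 * \<delta>)) powr p \<le> (A * norm (W l (of_real (R l) * \<zeta>))) powr p"
          proof (intro powr_mono2)
            show "a powr (2 * \<delta>) \<le> A * norm (W l (of_real (R l) * \<zeta>))"
              unfolding a_def W_def x_def N_def by (rule low[OF _ \<delta>0 nR[OF l]]) (use l in \<open>auto simp: \<zeta>_def\<close>)
          qed (use p in auto)
          moreover have "\<dots> = A powr p * g (2 * pi * (real k + s) / real (N l))" by (simp add: powr_mult g_def \<zeta>_def)
          ultimately have "real (N l) / (8 * (real k + 1)) \<le> A powr p * g (2 * pi * (real k + s) / real (N l))" by linarith
          moreover have "V k = real (N l) / (8 * (real k + 1)) / A powr p" using True by (simp only: V_def if_True)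
          moreover have "A powr p > 0" using A by simp
          ultimately show ?thesis by (simp only: pos_divide_le_eq mult.commute)
        qed (simp add: V_def g_def)
      qed
      moreover have "(\<Sum>k<N l. V k) = real (N l) * (harm l / (8 * A powr p))"
      proof -
        have "(\<Sum>k<N l. V k) = (\<Sum>k<l. real (N l) / (8 * (real k + 1)) / A powr p)"
          by (intro sum.mono_neutral_cong_right) (auto simp: V_def N_def)
        also have "\<dots> = (\<Sum>k<l. real (N l) / (8 * A powr p) * inverse (real (Suc k)))"
          by (intro sum.cong refl) (simp add: field_simps)
        also have "\<dots> = real (N l) / (8 * A powr p) * harm l"
          unfolding harm_altdef sum_distrib_left ..
        finally show ?thesis by simp
      qed
      ultimately have "2 * pi * (harm l / (8 * A powr p)) \<le> integral {0..2*pi} g" using NJ[OF l] by simp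
      then have "harm l / (8 * A powr p) \<le> circle_mean p (W l) (R l)"
        unfolding circle_mean_def g_def[symmetric] by (simp add: field_simps)
      also have "\<dots> \<le> cm" unfolding cm_def using R[OF l] by (intro circle_mean_mono_one hol p) auto
      finally have "harm l / (8 * A powr p) \<le> 2 powr p * C * (16 * A) powr p / 4" using cm by linarith
      then have "harm l \<le> (2 powr p * C * (16 * A) powr p / 4) * (8 * A powr p)"
        using A by (subst (asm) pos_divide_le_eq) auto
      then show ?thesis by (simp only: mult_ac)
    qed
    then show ?thesis by blast
  next
    case False
    have "p \<le> p / (p - 1)" using p False by (simp add: field_simps)
    then have qp: "q = p / (p - 1)" using q by simp
    have q1: "(q - 1) * p = q" "(1 - q) * (p - 1) = - 1" using p by (auto simp: qp field_simps)
    \<comment> \<open>The coefficients d_j^(-q) are optimal in Hoelder's sense: the p-th power of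
      d_j^(-q) d_j is d_j^(-q) again, so the sum \<open>S\<close> occurs on both sides and S^(p - 1)
      would be at most a constant over N. The lower bound for \<open>S\<close> contradicts this by
      the factor \<open>harm l\<close>.\<close>
    have "harm l \<le> 8 * (2 * A) powr q * (2 powr p * C) powr (1 / (p - 1))" if l: "l > 0" for l
    proof -
      define d where "d j = norm (node_coeff (N l) (x l) j)" for j
      have d0: "d j > 0" if "j \<in> J l" for j
        using node_coeff_nonzero[OF inj xnz] that NJ(3)[OF l] by (auto simp: d_def)
      define S where "S = (\<Sum>j\<in>J l. d j powr (- q))"
      have dlow: "(2 * real (N l) * A) powr (- q) * (real (N l) / (8 * real (2 * l - j))) \<le> d j powr (- q)" if j: "j \<in> J l" for j
      proof -
        have jl: "l \<le> j" "j < 2 * l" using j by (auto simp: J_def)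
        define a where "a = norm (1 + of_real (R l) * x l j)"
        have a: "0 < a" "a \<le> 8 * real (2 * l - j) / real (N l)"
          using split_node_near_minus_one(2,4)[OF l \<delta>0 jl] by (simp_all only: a_def R_def N_def x_def)
        have "d j \<le> (2 * real (N l) * A) * a powr (2 * \<delta>)" using coeff[OF l j] by (simp only: d_def a_def)
        then have e1: "((2 * real (N l) * A) * a powr (2 * \<delta>)) powr (- q) \<le> d j powr (- q)"
          using d0[OF j] q2 by (intro powr_mono2') auto
        have e2: "((2 * real (N l) * A) * a powr (2 * \<delta>)) powr (- q) = (2 * real (N l) * A) powr (- q) * (1 / a)"
          using \<delta>q a by (simp add: powr_mult powr_powr powr_minus_divide)
        have "real (N l) / (8 * real (2 * l - j)) \<le> 1 / a"
          using a NJ[OF l] jl by (simp add: field_simps)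
        then have e3: "(2 * real (N l) * A) powr (- q) * (real (N l) / (8 * real (2 * l - j))) \<le> (2 * real (N l) * A) powr (- q) * (1 / a)"
          by (intro mult_left_mono) auto
        show ?thesis by (rule order_trans[OF e3 e1[unfolded e2]])
      qed
      have "(2 * real (N l) * A) powr (- q) * (real (N l) / 8) * harm l \<le> S"
      proof -
        have "(2 * real (N l) * A) powr (- q) * (real (N l) / 8) * harm l
          = (\<Sum>k<l. (2 * real (N l) * A) powr (- q) * (real (N l) / (8 * real (Suc k))))"
        proof -
          have *: "c * (M / 8) * inverse s = c * (M / (8 * s))" for c M s :: real by (simp add: field_simps)
          show ?thesis unfolding harm_altdef sum_distrib_left by (rule sum.cong[OF refl]) (rule *)
        qed
        also have "\<dots> = (\<Sum>j\<in>J l. (2 * real (N l) * A) powr (- q) * (real (N l) / (8 * real (2 * l - j))))"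
          \<comment> \<open>Counting backwards from -1: \<open>2 * l - j\<close> becomes
            \<open>Suc k\<close>.\<close>
          by (rule sum.reindex_bij_witness[where i = "\<lambda>j. 2 * l - 1 - j" and j = "\<lambda>k. 2 * l - 1 - k"])
             (auto simp: J_def of_nat_diff Suc_diff_Suc)
        also have "\<dots> \<le> S" unfolding S_def using dlow by (intro sum_mono) auto
        finally show ?thesis .
      qed
      moreover have "(2 * real (N l) * A) powr (- q) * (real (N l) / 8) * harm l = (harm l / (8 * (2 * A) powr q)) * real (N l) powr (1 - q)"
      proof -
        have e1: "(2 * real (N l) * A) powr (- q) = (2 * A) powr (- q) * real (N l) powr (- q)"
          unfolding powr_mult[symmetric] by (simp add: mult_ac)
        have e2: "real (N l) powr (- q) * real (N l) = real (N l) powr (1 - q)"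
          using NJ[OF l] by (simp add: powr_diff powr_minus_divide)
        have "(2 * real (N l) * A) powr (- q) * (real (N l) / 8) * harm l
          = (2 * A) powr (- q) * (real (N l) powr (- q) * real (N l)) * harm l / 8" unfolding e1 by simp
        then show ?thesis unfolding e2 by (simp add: powr_minus_divide mult.commute)
      qed
      ultimately have Sl: "(harm l / (8 * (2 * A) powr q)) * real (N l) powr (1 - q) \<le> S" by simp
      define H where "H = harm l / (8 * (2 * A) powr q)"
      have H: "H > 0" using l A harm_pos[of l] by (simp add: H_def)
      have "H * real (N l) powr (1 - q) > 0" using H NJ[OF l] by simp
      then have S0: "S > 0" using Sl unfolding H_def[symmetric] by linarith
      define cm where "cm = circle_mean p (W l) 1"
      have "S powr p * cm \<le> 2 powr p * (C / real (N l) * (\<Sum>j\<in>J l. (d j powr (- q) * d j) powr p))"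
        unfolding cm_def S_def d_def by (rule test[OF l]) simp
      also have "(\<Sum>j\<in>J l. (d j powr (- q) * d j) powr p) = S" unfolding S_def
        proof (intro sum.cong refl)
          fix j assume "j \<in> J l"
          then have "d j powr (- q) * d j = d j powr (1 - q)" using d0[of j] by (simp add: powr_diff powr_minus_divide)
          moreover have "(1 - q) * p = - q" using q1(1) by (simp add: algebra_simps)
          ultimately show "(d j powr (- q) * d j) powr p = d j powr (- q)" by (simp add: powr_powr)
        qed
      finally have SS: "S powr p * cm \<le> 2 powr p * C / real (N l) * S" by simp
      \<comment> \<open>The product equals 1 at the origin, where the Poisson kernel is constant 1,
        so its mean is at least 1.\<close>
      have "2 * pi * norm (W l 0) powr p \<le> integral {0..2*pi} (\<lambda>t. norm (W l (cis t)) powr p * poisson 0 t)"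
        by (rule poisson_jensen[OF hol _ p]) simp
      then have cm1: "1 \<le> cm" by (simp add: cm_def circle_mean_def poisson_def W_def node_prod_def)
      have "S powr p \<le> S powr p * cm" using cm1 by (simp add: mult_le_cancel_left1)
      then have "S powr p \<le> 2 powr p * C / real (N l) * S" using SS by linarith
      moreover have "S powr p = S powr (p - 1) * S" using S0 by (simp add: powr_diff)
      ultimately have "S powr (p - 1) * S \<le> 2 powr p * C / real (N l) * S" by simp
      then have S1: "S powr (p - 1) \<le> 2 powr p * C / real (N l)" using S0 by (subst (asm) mult_le_cancel_right_pos) auto
      have "(H * real (N l) powr (1 - q)) powr (p - 1) \<le> S powr (p - 1)"
        using Sl H p unfolding H_def[symmetric] by (intro powr_mono2) auto
      then have "H powr (p - 1) * real (N l) powr (- 1) \<le> 2 powr p * C / real (N l)"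
        using S1 by (simp add: powr_mult powr_powr q1(2))
      then have H1: "H powr (p - 1) \<le> 2 powr p * C" using NJ[OF l] by (simp add: powr_minus_divide divide_le_cancel)
      have "H = (H powr (p - 1)) powr (1 / (p - 1))" using H p by (simp add: powr_powr)
      also have "\<dots> \<le> (2 powr p * C) powr (1 / (p - 1))" using H1 p by (intro powr_mono2) auto
      finally have "harm l \<le> (2 powr p * C) powr (1 / (p - 1)) * (8 * (2 * A) powr q)"
        using A unfolding H_def by (subst (asm) pos_divide_le_eq) auto
      then show ?thesis by (simp only: mult_ac)
    qed
    then show ?thesis by blast
  qed
  then show False using harm_unbounded by (meson not_le)
qed

section \<open>The equivalence\<close>

lemma circle_mean_nonneg: "0 \<le> circle_mean p f R"
proof (cases "(\<lambda>t. norm (f (of_real R * cis t)) powr p) integrable_on {0..2*pi}")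
  case True
  then show ?thesis unfolding circle_mean_def
    by (intro divide_nonneg_nonneg Henstock_Kurzweil_Integration.integral_nonneg) auto
qed (simp add: circle_mean_def not_integrable_integral)

lemma perturbed_unity_Arg:
  assumes z: "\<forall>j\<le>n. norm (z j) = 1 \<and> \<bar>Arg (z j * cnj (root_unity n j))\<bar> \<le> 2 * pi * \<delta> / real (n + 1)"
  shows "perturbed_unity (n + 1) \<delta> (\<lambda>j. Arg (z j * cnj (root_unity n j))) z"
  unfolding perturbed_unity_def
proof (intro allI impI conjI)
  fix j assume "j < n + 1"
  then have j: "j \<le> n" by simp
  show "\<bar>Arg (z j * cnj (root_unity n j))\<bar> \<le> 2 * pi * \<delta> / real (n + 1)" using z j by blast
  define u where "u = z j * cnj (root_unity n j)"
  have nu: "norm u = 1" using z j by (simp add: u_def norm_mult root_unity_def)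
  then have "cis (Arg u) = u" by (subst cis_Arg) (auto simp: sgn_div_norm)
  then have "cis (2 * pi * real j / real (n + 1) + Arg u) = root_unity n j * u"
    by (simp only: cis_mult[symmetric] root_unity_def)
  also have "\<dots> = z j * (root_unity n j * cnj (root_unity n j))" by (simp only: u_def mult_ac)
  also have "root_unity n j * cnj (root_unity n j) = 1" by (simp add: root_unity_def cis_cnj cis_mult)
  finally show "z j = cis (2 * pi * real j / real (n + 1) + Arg (z j * cnj (root_unity n j)))" by (simp add: u_def)
qed

text \<open>The bound 1/4 keeps every offset within pi / 2, so the principal argument returns the
  offset itself. Allowing \<open>d \<le> \<delta>\<close> transfers a configuration built for the
  threshold to every larger \<delta>.\<close>

lemma Arg_perturbed_unity:
  assumes x: "perturbed_unity (n + 1) d \<epsilon> x" and d: "d \<le> 1/4" "d \<le> \<delta>" and j: "j \<le> n"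
  shows "norm (x j) = 1 \<and> \<bar>Arg (x j * cnj (root_unity n j))\<bar> \<le> 2 * pi * \<delta> / real (n + 1)"
proof -
  have e: "\<bar>\<epsilon> j\<bar> \<le> 2 * pi * d / real (n + 1)" and xj: "x j = cis (2 * pi * real j / real (n + 1) + \<epsilon> j)"
    using x j by (auto simp: perturbed_unity_def)
  have "0 \<le> 2 * pi * d / real (n + 1)" using e abs_ge_zero order_trans by blast
  then have d0: "0 \<le> d" using pi_gt_zero by (auto simp: zero_le_divide_iff zero_le_mult_iff)
  have "2 * pi * d / real (n + 1) \<le> 2 * pi * d / 1" using d0 by (intro divide_left_mono) auto
  also have "\<dots> \<le> 2 * pi * (1 / 4)" using d unfolding div_by_1 by (intro mult_left_mono) auto
  finally have "\<bar>\<epsilon> j\<bar> \<le> pi / 2" using e by simp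
  then have "- pi < \<epsilon> j" "\<epsilon> j \<le> pi" using pi_gt_zero by linarith+
  then have "\<epsilon> j \<in> {-pi<..pi}" by simp
  then have A: "Arg (cis (\<epsilon> j)) = \<epsilon> j" by (rule Arg_cis)
  have "x j * cnj (root_unity n j) = cis (\<epsilon> j)" by (simp add: xj root_unity_def cis_cnj cis_mult)
  moreover have "2 * pi * d / real (n + 1) \<le> 2 * pi * \<delta> / real (n + 1)"
    using d by (intro divide_right_mono mult_left_mono) auto
  ultimately show ?thesis using e A by (simp add: xj)
qed

theorem mainTheorem1:
  fixes p \<delta> q :: real
  assumes "1 < p" and "q = max p (p / (p - 1))" and "0 \<le> \<delta>"
  shows "MZ_property p \<delta> \<longleftrightarrow> \<delta> < 1 / (2 * q)"
proof
  note p = assms(1) and q = assms(2)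
  have "q \<ge> 2" using max_conjugate_ge_2[OF p] q by simp
  then have "1 / (2 * q) \<le> 1 / (2 * 2)" by (intro divide_left_mono) auto
  then have d4: "1 / (2 * q) \<le> 1 / 4" by simp
  have sum_eq: "(\<Sum>j\<le>n. f j) = (\<Sum>j<n + 1. f j)" for f :: "nat \<Rightarrow> real" and n
    by (simp add: lessThan_Suc_atMost)
  have mean: "integral {0..2*pi} (\<lambda>\<theta>. norm (poly P (cis \<theta>)) powr p) / (2 * pi) = circle_mean p (poly P) 1" for P :: "complex poly"
    by (simp add: circle_mean_def)
  {
    assume "MZ_property p \<delta>"
    then obtain C where C: "\<And>n z (P :: complex poly). (\<forall>j\<le>n. norm (z j) = 1 \<and>
               \<bar>Arg (z j * cnj (root_unity n j))\<bar> \<le> 2 * pi * \<delta> / real (n + 1)) \<Longrightarrow> degree P \<le> n \<Longrightarrow>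
          circle_mean p (poly P) 1 \<le> (C / real (n + 1)) * (\<Sum>j\<le>n. norm (poly P (z j)) powr p)"
      unfolding MZ_property_def mean by blast
    show "\<delta> < 1 / (2 * q)"
    proof (rule ccontr)
      assume "\<not> \<delta> < 1 / (2 * q)"
      then have le: "1 / (2 * q) \<le> \<delta>" by simp
      show False
      \<comment> \<open>The property at \<delta> includes all configurations with smaller
        displacement, so it suffices to refute the threshold itself.\<close>
      proof (rule sampling_fails_at_threshold[OF p q refl])
        fix N \<epsilon> x and P :: "complex poly"
        assume N: "N > 0" and x: "perturbed_unity N (1 / (2 * q)) \<epsilon> x" and P: "degree P < N"
        obtain n where n: "N = n + 1" using N by (cases N) auto
        have "circle_mean p (poly P) 1 \<le> (C / real (n + 1)) * (\<Sum>j\<le>n. norm (poly P (x j)) powr p)"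
          using Arg_perturbed_unity[OF x[unfolded n] d4 le] P n by (intro C) auto
        then show "circle_mean p (poly P) 1 \<le> C / real N * (\<Sum>j<N. norm (poly P (x j)) powr p)"
          unfolding n sum_eq .
      qed
    qed
  next
    assume \<delta>: "\<delta> < 1 / (2 * q)"
    obtain K where K: "K > 0" "\<And>N \<epsilon> x P. N > 0 \<Longrightarrow> perturbed_unity N \<delta> \<epsilon> x \<Longrightarrow> degree (P :: complex poly) < N \<Longrightarrow>
       circle_mean p (poly P) 1 \<le> K / real N * (\<Sum>j<N. norm (poly P (x j)) powr p)"
      using upper_bound[OF p q assms(3) \<delta>] by blast
    obtain S where S: "S > 0" "\<And>N x P. N > 0 \<Longrightarrow> node_family N x \<Longrightarrow> degree (P :: complex poly) < N \<Longrightarrow>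
       (\<Sum>j<N. norm (poly P (x j)) powr p) \<le> S * real N * circle_mean p (poly P) 1"
      using sampling_bound[OF p] by blast
    define C where "C = max K S"
    have C: "C > 0" "K \<le> C" "S \<le> C" using K by (auto simp: C_def)
    have "inverse C / real (n + 1) * (\<Sum>j\<le>n. norm (poly P (z j)) powr p) \<le> circle_mean p (poly P) 1 \<and>
      circle_mean p (poly P) 1 \<le> C / real (n + 1) * (\<Sum>j\<le>n. norm (poly P (z j)) powr p)"
      if z: "\<forall>j\<le>n. norm (z j) = 1 \<and> \<bar>Arg (z j * cnj (root_unity n j))\<bar> \<le> 2 * pi * \<delta> / real (n + 1)"
        and P: "degree P \<le> n" for n z and P :: "complex poly"
    proof
      note x = perturbed_unity_Arg[OF z]
      have fam: "node_family (n + 1) z" using perturbed_unity_family[OF x] \<delta> d4 by simp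
      define \<Sigma> where "\<Sigma> = (\<Sum>j\<le>n. norm (poly P (z j)) powr p)"
      have \<Sigma>0: "\<Sigma> \<ge> 0" unfolding \<Sigma>_def by (intro sum_nonneg) auto
      define M where "M = circle_mean p (poly P) 1"
      have dP: "degree P < n + 1" using P by simp
      have up: "M \<le> K / real (n + 1) * \<Sigma>" unfolding \<Sigma>_def sum_eq M_def by (rule K(2)[OF _ x dP]) simp
      also have "\<dots> \<le> C / real (n + 1) * \<Sigma>" using C \<Sigma>0 by (intro mult_right_mono divide_right_mono) auto
      finally show "M \<le> C / real (n + 1) * \<Sigma>" .
      have "0 \<le> K / real (n + 1) * \<Sigma>" using K(1) \<Sigma>0 by simp
      have M0: "M \<ge> 0" unfolding M_def by (rule circle_mean_nonneg)
      have "\<Sigma> \<le> S * real (n + 1) * M" unfolding \<Sigma>_def sum_eq M_def by (rule S(2)[OF _ fam dP]) simp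
      also have "\<dots> \<le> C * real (n + 1) * M" using C M0 by (intro mult_right_mono) auto
      finally have "\<Sigma> / (C * real (n + 1)) \<le> M" using C(1) by (subst pos_divide_le_eq) (auto simp: mult_ac)
      moreover have "inverse C / real (n + 1) * \<Sigma> = \<Sigma> / (C * real (n + 1))"
        by (simp only: divide_inverse inverse_mult_distrib mult_ac)
      ultimately show "inverse C / real (n + 1) * \<Sigma> \<le> M" by simp
    qed
    then show "MZ_property p \<delta>" unfolding MZ_property_def mean using C(1) by blast
  }
qed

end
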